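(* Let $A_G(q_1,q_2,\dots)$ denote the Abel polynomial and $W_G(q_1,q_2,\dots)$ the weighted chromatic polynomial of a simple graph $G$. Put $$\mathcal{A}=\sum_{G\text{ connected}}\frac{A_G}{|\mathrm{Aut}(G)|},\qquad \mathcal{A}^\circ=\exp(\mathcal{A})=\sum_{G}\frac{A_G}{|\mathrm{Aut}(G)|},\qquad \mathcal{W}=\sum_{G\text{ connected}}\frac{W_G}{|\mathrm{Aut}(G)|},\qquad \mathcal{W}^\circ=\exp(\mathcal{W}),$$ where the sums over connected $G$ run over isomorphism classes of non-empty connected simple graphs and the sum over $G$ runs over isomorphism classes of all simple graphs (including the empty one). Let $a_n=2^{(n-1)(n-2)/2}n^{n-1}$ for $n\ge1$, and let $(c_n)_{n\ge1}$ be defined by $c_1=1$ and $c_n=(-1)^{n+1}\left[1+\sum_{k=1}^{n-1}(-1)^k2^{k(n-k)}\binom{n-1}{k-1}c_k\right]$. Then after the substitution $$q_n=\frac{2^{n(n-1)/2}(n-1)!}{a_n}\,p_n\qquad(n=1,2,\dots)$$ the generating function $\mathcal{A}$ becomes a solution to the KP hierarchy, and this solution is the same power series in $p_1,p_2,\dots$ as the one obtained from $\mathcal{W}$ by the substitution $q_n=\frac{2^{n(n-1)/2}(n-1)!}{c_n}p_n$ $(n=1,2,\dots)$. Consequently, after the former substitution $\mathcal{A}^\circ$ becomes a $\tau$-function of the KP hierarchy, the same one as obtained from $\mathcal{W}^\circ$ by the latter substitution.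
   Context: Graphs are finite; a simple graph has no loops or multiple edges. $\mathrm{Aut}(G)$ is the automorphism group of $G$ and $|\mathrm{Aut}(G)|$ its order. The empty graph is not counted as connected. Abel polynomial. A spanning forest of $G$ is an acyclic spanning subgraph (all vertices of $G$, a subset of edges without cycles); its trees are its connected components. $A_G(q_1,q_2,\dots)=\sum_F\prod_{T}\bigl(i(T)\,q_{i(T)}\bigr)$, the sum over all (non-rooted) spanning forests $F$ of $G$, the product over the trees $T$ of $F$, with $i(T)$ the number of vertices of $T$. For the empty graph the value is $1$. Weighted chromatic polynomial. A weighted graph is a simple graph $G$ with a weight function $w:V(G)\to\{1,2,3,\dots\}$. To every weighted graph one assigns a polynomial $W_G\in\mathbb{C}[q_1,q_2,\dots]$ determined by: (i) if $G$ has no edges, $W_G=\prod_{v\in V(G)}q_{w(v)}$ (so $W=1$ for the empty graph); (ii) for every edge $e$ of $G$, $W_G=W_{G'_e}+W_{G''_e}$, where $G'_e$ is $G$ with $e$ deleted and $G''_e$ is $G$ with $e$ contracted, multiple edges that arise being replaced by single edges, the weight of the new vertex being the sum of the weights of the two ends of $e$, and the other weights being unchanged. For an ordinary simple graph, $W_G$ is defined by giving every vertex weight $1$. Equivalently, for a simple graph $G$, $W_G=\sum_{E'\subseteq E(G)}(-1)^{|E'|-|V(G)|+k(E')}q_{v_1}\cdots q_{v_k}$, where $k=k(E')$ is the number of connected components of the spanning subgraph $(V(G),E')$ and $v_1,\dots,v_k$ are the numbers of vertices of these components. KP hierarchy. Define one-part Schur polynomials $s_n(p_1,p_2,\dots)$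 by $\sum_{n\ge0}s_n=\exp\left(\sum_{k\ge1}p_k/k\right)$ ($s_n$ being the part of weighted degree $n$, with $p_i$ of degree $i$; $s_n=0$ for $n<0$), and for a partition $\lambda=(\lambda_1\ge\dots\ge\lambda_l)$ put $s_\lambda=\det(s_{\lambda_i-i+j})_{1\le i,j\le l}$. A $\tau$-function of the KP hierarchy is a formal power series in $p_1,p_2,\dots$ obtained as follows. Take formal Laurent series $\beta_i(z)=z^{-i}+c_{i1}z^{-i+1}+c_{i2}z^{-i+2}+\cdots$, $i=1,2,\dots$, and expand the semi-infinite wedge product $\beta_1\wedge\beta_2\wedge\beta_3\wedge\cdots=\sum_\mu c_\mu v_\mu$ over partitions $\mu$, where $v_\mu=z^{m_1}\wedge z^{m_2}\wedge\cdots$ with $m_i=\mu_i-i$ ($\mu_i=0$ for $i$ large); explicitly $c_\mu=\det\left([z^{\mu_j-j}]\beta_i\right)_{1\le i,j\le n}$ for any $n\ge$ the number of parts of $\mu$, so $c_\emptyset=1$. The corresponding $\tau$-function is $\sum_\mu c_\mu s_\mu(p_1,p_2,\dots)$. Solutions of the KP hierarchy are the logarithms of $\tau$-functions (the KP equations are the form taken by the Hirota, i.e. Plücker, equations for the coefficients $c_\mu$ when rewritten for the logarithm of the $\tau$-function; the first of them is $\frac{\partial^2F}{\partial p_2^2}=\frac{\partial^2F}{\partial p_1\partial p_3}-\frac12\left(\frac{\partial^2F}{\partial p_1^2}\right)^2-\frac1{12}\frac{\partial^4F}{\partial p_1^4}$). *)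

theory Defs
  imports
    Complex_Main
    "HOL-Library.Multiset"
    "HOL-Combinatorics.Permutations"
    "HOL-Computational_Algebra.Formal_Laurent_Series"
    "Jordan_Normal_Form.Determinant"
begin

section \<open>Formal power series in countably many variables\<close>

text \<open>
  The multiset \<open>{#i\<^sub>1, \<dots>, i\<^sub>k#}\<close> stands for the monomial
  \<open>x\<^bsub>i\<^sub>1\<^esub> \<cdots> x\<^bsub>i\<^sub>k\<^esub>\<close>, so that \<open>sum_mset m\<close> is the weighted degree of the monomial \<open>m\<close>.
  Polynomials are regarded as series with finitely many non-zero coefficients. The mathematics uses
  the variables with index at least \<open>1\<close> only; the variable with index \<open>0\<close> never occurs.
\<close>

typedef 'a mser = "UNIV :: (nat multiset \<Rightarrow> 'a) set"
  morphisms mser_nth Abs_mser ..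

setup_lifting type_definition_mser

lemma mser_eq_iff: "F = G \<longleftrightarrow> (\<forall>m. mser_nth F m = mser_nth G m)"
  by transfer auto

lemma finite_submultisets [simp]: "finite {a. a \<subseteq># (m :: 'b multiset)}"
proof (induction m)
  case empty
  then show ?case by simp
next
  case (add x m)
  have "{a. a \<subseteq># add_mset x m} \<subseteq> {a. a \<subseteq># m} \<union> add_mset x ` {a. a \<subseteq># m}"
  proof
    fix a assume "a \<in> {a. a \<subseteq># add_mset x m}"
    hence a: "a \<subseteq># add_mset x m" by simp
    show "a \<in> {a. a \<subseteq># m} \<union> add_mset x ` {a. a \<subseteq># m}"
    proof (cases "x \<in># a")
      case True
      then obtain b where "a = add_mset x b" by (metis insert_DiffM)
      with a show ?thesis by auto
    next
      case False
      with a show ?thesis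
        by (metis Diff_eq_empty_iff_mset UnI1 mem_Collect_eq minus_add_mset_if_not_in_lhs)
    qed
  qed
  then show ?case using add.IH by (meson finite_UnI finite_imageI finite_subset)
qed

lemma diff_diff_submultiset: "a \<subseteq># m \<Longrightarrow> m - (m - a) = (a :: 'b multiset)"
  by (auto simp: multiset_eq_iff subseteq_mset_def)

instantiation mser :: (comm_ring_1) comm_ring_1
begin

lift_definition zero_mser :: "'a mser" is "\<lambda>_. 0" .
lift_definition one_mser :: "'a mser" is "\<lambda>m. if m = {#} then 1 else 0" .
lift_definition plus_mser :: "'a mser \<Rightarrow> 'a mser \<Rightarrow> 'a mser" is "\<lambda>F G m. F m + G m" .
lift_definition minus_mser :: "'a mser \<Rightarrow> 'a mser \<Rightarrow> 'a mser" is "\<lambda>F G m. F m - G m" .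
lift_definition uminus_mser :: "'a mser \<Rightarrow> 'a mser" is "\<lambda>F m. - F m" .
lift_definition times_mser :: "'a mser \<Rightarrow> 'a mser \<Rightarrow> 'a mser"
  is "\<lambda>F G m. \<Sum>a | a \<subseteq># m. F a * G (m - a)" .

instance
proof
  fix F G H :: "'a mser"
  show "F + G + H = F + (G + H)" by transfer (auto simp: algebra_simps)
  show "F + G = G + F" by transfer (auto simp: algebra_simps)
  show "0 + F = F" by transfer auto
  show "- F + F = 0" by transfer auto
  show "F - G = F + - G" by transfer auto
  show "(F + G) * H = F * H + G * H"
    by transfer (auto simp: algebra_simps sum.distrib)
  show "(0 :: 'a mser) \<noteq> 1"
    by transfer (metis zero_neq_one)
  show "F * G = G * F"
  proof (transfer, rule ext)
    fix F G :: "nat multiset \<Rightarrow> 'a" and m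
    show "(\<Sum>a | a \<subseteq># m. F a * G (m - a)) = (\<Sum>a | a \<subseteq># m. G a * F (m - a))"
      by (rule sum.reindex_bij_witness[of _ "\<lambda>a. m - a" "\<lambda>a. m - a"])
         (auto simp: mult.commute diff_diff_submultiset)
  qed
  show "1 * F = F"
  proof (transfer, rule ext)
    fix F :: "nat multiset \<Rightarrow> 'a" and m
    have "(\<Sum>a | a \<subseteq># m. (if a = {#} then 1 else 0) * F (m - a))
        = (\<Sum>a\<in>{{#}}. (if a = {#} then 1 else 0) * F (m - a))"
      by (rule sum.mono_neutral_right) auto
    thus "(\<Sum>a | a \<subseteq># m. (if a = {#} then 1 else 0) * F (m - a)) = F m" by simp
  qed
  show "F * G * H = F * (G * H)"
  proof (transfer, rule ext)
    fix F G H :: "nat multiset \<Rightarrow> 'a" and m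
    have "(\<Sum>a | a \<subseteq># m. (\<Sum>b | b \<subseteq># a. F b * G (a - b)) * H (m - a))
        = (\<Sum>(a, b)\<in>(SIGMA a:{a. a \<subseteq># m}. {b. b \<subseteq># a}). F b * G (a - b) * H (m - a))"
      by (simp add: sum_distrib_right sum.Sigma)
    also have "\<dots> = (\<Sum>(b, c)\<in>(SIGMA b:{b. b \<subseteq># m}. {c. c \<subseteq># m - b}). F b * (G c * H (m - b - c)))"
      by (rule sum.reindex_bij_witness[of _ "\<lambda>(b, c). (b + c, b)" "\<lambda>(a, b). (b, a - b)"])
         (auto simp: mult.assoc multiset_eq_iff subseteq_mset_def le_diff_conv2 algebra_simps
            intro!: diff_le_mono intro: order_trans)
    also have "\<dots> = (\<Sum>b | b \<subseteq># m. F b * (\<Sum>c | c \<subseteq># m - b. G c * H (m - b - c)))"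
      by (simp add: sum_distrib_left sum.Sigma)
    finally show "(\<Sum>a | a \<subseteq># m. (\<Sum>b | b \<subseteq># a. F b * G (a - b)) * H (m - a))
        = (\<Sum>b | b \<subseteq># m. F b * (\<Sum>c | c \<subseteq># m - b. G c * H (m - b - c)))" .
  qed
qed

end

lift_definition mser_const :: "'a :: comm_ring_1 \<Rightarrow> 'a mser" is "\<lambda>c m. if m = {#} then c else 0" .

lift_definition mser_var :: "nat \<Rightarrow> 'a :: comm_ring_1 mser" is "\<lambda>i m. if m = {#i#} then 1 else 0" .

text \<open>
  The formal sum of a (possibly infinite) family, coefficient by coefficient. It is meaningful for
  families in which every monomial occurs in only finitely many members; all families below are of
  this kind, for reasons of degree or of weighted degree.
\<close>

definition mser_Sum :: "'i set \<Rightarrow> ('i \<Rightarrow> 'a :: comm_ring_1 mser) \<Rightarrow> 'a mser" where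
  "mser_Sum I F = Abs_mser (\<lambda>m. \<Sum>i | i \<in> I \<and> mser_nth (F i) m \<noteq> 0. mser_nth (F i) m)"

text \<open>
  \<open>mser_exp F\<close> is meant for series \<open>F\<close> with constant term \<open>0\<close>, and \<open>mser_ln F\<close> for series \<open>F\<close>
  with constant term \<open>1\<close>.
\<close>

definition mser_exp :: "complex mser \<Rightarrow> complex mser" where
  "mser_exp F = mser_Sum UNIV (\<lambda>k. mser_const (1 / fact k) * F ^ k)"

definition mser_ln :: "complex mser \<Rightarrow> complex mser" where
  "mser_ln F = mser_Sum {1..} (\<lambda>k. mser_const ((- 1) ^ (k + 1) / of_nat k) * (F - 1) ^ k)"

text \<open>The substitution of \<open>r i * x\<^sub>i\<close> for the variable \<open>x\<^sub>i\<close>, for every \<open>i\<close>.\<close>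

lift_definition mser_rescale :: "(nat \<Rightarrow> 'a :: comm_ring_1) \<Rightarrow> 'a mser \<Rightarrow> 'a mser"
  is "\<lambda>r F m. (\<Prod>i\<in>#m. r i) * F m" .

text \<open>The part of weighted degree \<open>n\<close>, where the variable with index \<open>i\<close> has degree \<open>i\<close>.\<close>

lift_definition mser_homogeneous_part :: "int \<Rightarrow> 'a :: comm_ring_1 mser \<Rightarrow> 'a mser"
  is "\<lambda>n F m. if int (sum_mset m) = n then F m else 0" .


section \<open>Simple graphs\<close>

type_synonym 'a graph = "'a set \<times> 'a set set"

abbreviation verts :: "'a graph \<Rightarrow> 'a set" where "verts G \<equiv> fst G"
abbreviation edges :: "'a graph \<Rightarrow> 'a set set" where "edges G \<equiv> snd G"

definition simple_graph :: "'a graph \<Rightarrow> bool" where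
  "simple_graph G \<longleftrightarrow> finite (verts G) \<and> (\<forall>e\<in>edges G. e \<subseteq> verts G \<and> card e = 2)"

definition reachable :: "'a graph \<Rightarrow> 'a \<Rightarrow> 'a \<Rightarrow> bool" where
  "reachable G = (\<lambda>u v. {u, v} \<in> edges G)\<^sup>*\<^sup>*"

definition connected_graph :: "'a graph \<Rightarrow> bool" where
  "connected_graph G \<longleftrightarrow> verts G \<noteq> {} \<and> (\<forall>u\<in>verts G. \<forall>v\<in>verts G. reachable G u v)"

text \<open>The vertex sets of the connected components.\<close>

definition components :: "'a graph \<Rightarrow> 'a set set" where
  "components G = (\<lambda>u. {v \<in> verts G. reachable G u v}) ` verts G"

definition is_cycle :: "'a graph \<Rightarrow> 'a list \<Rightarrow> bool" where
  "is_cycle G vs \<longleftrightarrow> length vs \<ge> 3 \<and> distinct vs \<and>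
     (\<forall>i<length vs. {vs ! i, vs ! (Suc i mod length vs)} \<in> edges G)"

definition acyclic_graph :: "'a graph \<Rightarrow> bool" where
  "acyclic_graph G \<longleftrightarrow> (\<nexists>vs. is_cycle G vs)"

definition graph_isomorphic :: "'a graph \<Rightarrow> 'b graph \<Rightarrow> bool" where
  "graph_isomorphic G H \<longleftrightarrow>
     (\<exists>f. bij_betw f (verts G) (verts H) \<and> (\<lambda>e. f ` e) ` edges G = edges H)"

text \<open>
  Automorphisms are represented by permutations that fix everything outside the vertex set, so that
  each of them is counted once.
\<close>

definition automorphisms :: "'a graph \<Rightarrow> ('a \<Rightarrow> 'a) set" where
  "automorphisms G = {f. f permutes verts G \<and> (\<lambda>e. f ` e) ` edges G = edges G}"

text \<open>
  Every finite simple graph is isomorphic to one whose vertices are natural numbers, so the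
  isomorphism classes of finite simple graphs correspond to those of the simple graphs on finite sets
  of natural numbers.
\<close>

definition graph_classes :: "nat graph set set" where
  "graph_classes =
     {G. simple_graph G} // {(G, H). simple_graph G \<and> simple_graph H \<and> graph_isomorphic G H}"

text \<open>
  The sum of \<open>\<Phi> G / |Aut G|\<close> over the isomorphism classes of simple graphs satisfying \<open>P\<close>, where
  \<open>P\<close> and \<open>\<Phi>\<close> are meant to be invariant under isomorphisms.
\<close>

definition class_sum :: "(nat graph \<Rightarrow> bool) \<Rightarrow> (nat graph \<Rightarrow> complex mser) \<Rightarrow> complex mser" where
  "class_sum P \<Phi> = mser_Sum {C \<in> graph_classes. \<forall>G\<in>C. P G}
     (\<lambda>C. let G = (SOME G. G \<in> C) in mser_const (1 / of_nat (card (automorphisms G))) * \<Phi> G)"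


section \<open>The Abel polynomial\<close>

definition abel_poly :: "'a graph \<Rightarrow> complex mser" where
  "abel_poly G = (\<Sum>F | F \<subseteq> edges G \<and> acyclic_graph (verts G, F).
     \<Prod>T\<in>components (verts G, F). of_nat (card T) * mser_var (card T))"


section \<open>The weighted chromatic polynomial\<close>

definition delete_edge :: "'a set \<Rightarrow> 'a graph \<Rightarrow> 'a graph" where
  "delete_edge e G = (verts G, edges G - {e})"

text \<open>
  Contraction of the edge \<open>{u, v}\<close>; the new vertex is called \<open>u\<close>. Multiple edges are merged
  because the edges form a set.
\<close>

definition contract_edge :: "'a \<Rightarrow> 'a \<Rightarrow> 'a graph \<Rightarrow> 'a graph" where
  "contract_edge u v G =
     (verts G - {v}, (\<lambda>e. (\<lambda>x. if x = v then u else x) ` e) ` (edges G - {{u, v}}))"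

text \<open>
  \<open>deletion_contraction G w P\<close> states that \<open>P\<close> is a result of evaluating the defining recurrence on
  the graph \<open>G\<close> with the weight function \<open>w\<close>, for some choice of the edges. For a weighted simple
  graph the result exists and does not depend on the choice, so the definite description below
  denotes the polynomial satisfying the recurrence for every edge.
\<close>

inductive deletion_contraction :: "'a graph \<Rightarrow> ('a \<Rightarrow> nat) \<Rightarrow> complex mser \<Rightarrow> bool" where
  no_edges: "edges G = {} \<Longrightarrow> deletion_contraction G w (\<Prod>v\<in>verts G. mser_var (w v))"
| edge: "{u, v} \<in> edges G \<Longrightarrow> u \<noteq> v \<Longrightarrow>
     deletion_contraction (delete_edge {u, v} G) w P \<Longrightarrow>
     deletion_contraction (contract_edge u v G) (w(u := w u + w v)) Q \<Longrightarrow>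
     deletion_contraction G w (P + Q)"

definition weighted_chromatic_poly :: "'a graph \<Rightarrow> ('a \<Rightarrow> nat) \<Rightarrow> complex mser" where
  "weighted_chromatic_poly G w = (THE P. deletion_contraction G w P)"


section \<open>The KP hierarchy\<close>

definition schur_one :: "int \<Rightarrow> complex mser" where
  "schur_one n = mser_homogeneous_part n
     (mser_exp (mser_Sum {1..} (\<lambda>k. mser_const (1 / of_nat k) * mser_var k)))"

definition partitions :: "nat list set" where
  "partitions = {\<mu>. sorted_wrt (\<ge>) \<mu> \<and> (\<forall>k\<in>set \<mu>. k > 0)}"

text \<open>List and matrix indices start from \<open>0\<close>, whereas the mathematical ones start from \<open>1\<close>.\<close>

definition schur :: "nat list \<Rightarrow> complex mser" where
  "schur \<mu> = det (mat (length \<mu>) (length \<mu>) (\<lambda>(i, j). schur_one (int (\<mu> ! i) - int i + int j)))"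

definition admissible_basis :: "(nat \<Rightarrow> complex fls) \<Rightarrow> bool" where
  "admissible_basis \<beta> \<longleftrightarrow>
     (\<forall>i\<ge>1. fls_nth (\<beta> i) (- int i) = 1 \<and> (\<forall>k < - int i. fls_nth (\<beta> i) k = 0))"

text \<open>
  The coefficient of \<open>v\<^sub>\<mu>\<close> in \<open>\<beta> 1 \<and> \<beta> 2 \<and> \<beta> 3 \<and> \<dots>\<close>; \<open>\<beta> 0\<close> is not used. For an
  admissible \<open>\<beta>\<close>, appending zero parts to \<open>\<mu>\<close> enlarges the matrix by a unitriangular block and does not
  change the determinant, so the number of parts is taken as the size.
\<close>

definition wedge_coeff :: "(nat \<Rightarrow> complex fls) \<Rightarrow> nat list \<Rightarrow> complex" where
  "wedge_coeff \<beta> \<mu> = det (mat (length \<mu>) (length \<mu>)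
     (\<lambda>(i, j). fls_nth (\<beta> (Suc i)) (int (\<mu> ! j) - int (Suc j))))"

definition KP_tau_function :: "complex mser \<Rightarrow> bool" where
  "KP_tau_function \<tau> \<longleftrightarrow> (\<exists>\<beta>. admissible_basis \<beta> \<and>
     \<tau> = mser_Sum partitions (\<lambda>\<mu>. mser_const (wedge_coeff \<beta> \<mu>) * schur \<mu>))"

definition KP_solution :: "complex mser \<Rightarrow> bool" where
  "KP_solution F \<longleftrightarrow> (\<exists>\<tau>. KP_tau_function \<tau> \<and> F = mser_ln \<tau>)"


section \<open>The generating functions and the substitutions\<close>

definition abel_gf :: "complex mser" where
  "abel_gf = class_sum connected_graph abel_poly"

definition chromatic_gf :: "complex mser" where
  "chromatic_gf = class_sum connected_graph (\<lambda>G. weighted_chromatic_poly G (\<lambda>_. 1))"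

definition abel_seq :: "nat \<Rightarrow> nat" where
  "abel_seq n = 2 ^ ((n - 1) * (n - 2) div 2) * n ^ (n - 1)"

text \<open>For \<open>n = 1\<close> the sum is empty, so that the recurrence yields the initial value \<open>1\<close> as well.\<close>

function chromatic_seq :: "nat \<Rightarrow> int" where
  "chromatic_seq n = (- 1) ^ (n + 1) *
     (1 + (\<Sum>k=1..n-1. (- 1) ^ k * 2 ^ (k * (n - k)) * int ((n - 1) choose (k - 1)) * chromatic_seq k))"
  by auto
termination by (relation "measure (\<lambda>n. n)") auto

declare chromatic_seq.simps [simp del]

definition abel_scale :: "nat \<Rightarrow> complex" where
  "abel_scale n = 2 ^ (n * (n - 1) div 2) * fact (n - 1) / of_nat (abel_seq n)"

definition chromatic_scale :: "nat \<Rightarrow> complex" where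
  "chromatic_scale n = 2 ^ (n * (n - 1) div 2) * fact (n - 1) / of_int (chromatic_seq n)"

end

theory Submission
  imports Defs
begin

text \<open>
  Both graph polynomials belong to one family. For a number \<open>y\<close> and a function \<open>r\<close>, give the graph
  \<open>(V, F)\<close> the weight \<open>y ^ \<nu>(F) * (\<Prod>T. r(|T|) * q\<^bsub>|T|\<^esub>)\<close>, where \<open>T\<close> ranges over the vertex sets of the
  connected components and the nullity \<open>\<nu>(F)\<close> is the number of edges plus the number of components
  minus the number of vertices; then sum the weights over all spanning subgraphs of a graph. The Abel
  polynomial is the case \<open>y = 0\<close>, \<open>r(n) = n\<close>, because forests are the graphs of nullity \<open>0\<close>. The
  weighted chromatic polynomial is the case \<open>y = -1\<close>, \<open>r(n) = 1\<close>: the corresponding sum with vertex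
  weights satisfies the deletion-contraction recurrence (\<open>weighted_chromatic_poly_eq_expansion\<close>).

  By the orbit-stabilizer theorem, a sum over isomorphism classes with the weights \<open>1 / |Aut G|\<close> is a
  sum over labelled graphs with the weights \<open>1 / n!\<close> (\<open>class_sum_eq_graded\<close>). The family is
  multiplicative under disjoint unions, so splitting off the component of one vertex
  (\<open>graph_sum_recurrence\<close>) relates the sums \<open>f\<^sub>n\<close> over all labelled graphs on \<open>n\<close> vertices, divided
  by \<open>n!\<close>, to the corresponding sums \<open>g\<^sub>n\<close> over the connected ones:
  \<open>n * f\<^sub>n = \<Sum>\<^sub>k k * g\<^sub>k * f\<^bsub>n-k\<^esub>\<close>. This is the differential equation that characterizes the series
  \<open>\<Sum>\<^sub>n f\<^sub>n\<close> as the exponential of \<open>\<Sum>\<^sub>n g\<^sub>n\<close> (\<open>mser_graded_exp\<close>).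

  An edge set \<open>F\<close> lies in \<open>2 ^ ((n choose 2) - |F|)\<close> graphs on \<open>n\<close> vertices. Hence the sum of degree
  \<open>n\<close> over all graphs is \<open>2 ^ (n choose 2)\<close> times a sum \<open>h\<^sub>n\<close> of weights divided by \<open>2 ^ |F|\<close>. These
  weights are again multiplicative, and their sum over the connected graphs on \<open>k\<close> vertices is
  \<open>b\<^sub>k * q\<^sub>k\<close> with a number \<open>b\<^sub>k\<close>. The substitution \<open>q\<^sub>k = (k - 1)! / b\<^sub>k * p\<^sub>k\<close> turns the recurrence for
  \<open>h\<^sub>n / n!\<close> into that of the one-part Schur polynomials, so the generating function becomes
  \<open>\<Sum>\<^sub>n 2 ^ (n choose 2) * s\<^sub>n\<close>, independently of \<open>y\<close> and \<open>r\<close> (\<open>rescale_class_sum_eq_tau\<close>). This series is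
  a tau function: for \<open>\<beta>\<^sub>1 = \<Sum>\<^sub>n 2 ^ (n choose 2) * z ^ (n - 1)\<close> and \<open>\<beta>\<^sub>i = z ^ (- i)\<close>, \<open>i \<ge> 2\<close>, the
  coefficients of all partitions with at least two parts vanish (\<open>KP_one_part_tau\<close>).

  It remains to compute \<open>2 ^ (n choose 2) * b\<^sub>n\<close>. In the first case it is \<open>a\<^sub>n\<close> by Cayley's formula, which
  is proved by Pitman's double counting of rooted forests (\<open>cayley\<close>). In the second case it satisfies
  the recurrence of \<open>c\<^sub>n\<close> (\<open>chromatic_seq_eq\<close>), and \<open>c\<^sub>n\<close> is odd, hence not zero.
\<close>


section \<open>Exponential and logarithm of formal power series\<close>

lemma mser_nth_sum: "mser_nth (sum f A) m = (\<Sum>x\<in>A. mser_nth (f x) m)"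
  by (induction A rule: infinite_finite_induct) (auto simp: plus_mser.rep_eq zero_mser.rep_eq)

lemma mser_nth_mult: "mser_nth (F * G) m = (\<Sum>a | a \<subseteq># m. mser_nth F a * mser_nth G (m - a))"
  by (simp add: times_mser.rep_eq)

lemma mser_nth_const_mult [simp]: "mser_nth (mser_const c * F) m = c * mser_nth F m"
proof -
  have "mser_nth (mser_const c * F) m
      = (\<Sum>a\<in>{{#}}. (if a = {#} then c else 0) * mser_nth F (m - a))"
    unfolding mser_nth_mult mser_const.rep_eq by (rule sum.mono_neutral_right) auto
  thus ?thesis by simp
qed

lemma mser_const_1 [simp]: "mser_const 1 = 1"
  by transfer auto

lemma mser_const_mult: "mser_const (a * b) = mser_const a * mser_const b"
  by (auto simp: mser_eq_iff mser_const.rep_eq)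

lemma mser_const_0 [simp]: "mser_const 0 = 0"
  by transfer auto

lemma mser_const_add: "mser_const (a + b) = mser_const a + mser_const b"
  by transfer auto

lemma mser_const_of_nat: "mser_const (of_nat n) = of_nat n"
  by (induction n) (auto simp: mser_const_add)

lemma mser_const_sum: "mser_const (sum f A) = (\<Sum>x\<in>A. mser_const (f x))"
  by (induction A rule: infinite_finite_induct) (auto simp: mser_const_add)

lemma mser_nth_of_nat_mult [simp]: "mser_nth (of_nat n * F) m = of_nat n * mser_nth F m"
  by (simp flip: mser_const_of_nat)

lemma mser_nth_empty_mult [simp]: "mser_nth (F * G) {#} = mser_nth F {#} * mser_nth G {#}"
proof -
  have "{a. a \<subseteq># {#}} = {{#} :: nat multiset}" by auto
  thus ?thesis by (simp add: mser_nth_mult)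
qed

lemma mser_nth_Sum:
  "mser_nth (mser_Sum I F) m = (\<Sum>i | i \<in> I \<and> mser_nth (F i) m \<noteq> 0. mser_nth (F i) m)"
  by (simp add: mser_Sum_def Abs_mser_inverse)

lemma mser_nth_Sum_finite:
  assumes "finite A" "A \<subseteq> I" "\<And>i. i \<in> I - A \<Longrightarrow> mser_nth (F i) m = 0"
  shows "mser_nth (mser_Sum I F) m = (\<Sum>i\<in>A. mser_nth (F i) m)"
  unfolding mser_nth_Sum by (rule sum.mono_neutral_left) (use assms in auto)

text \<open>
  The substitution of multiples of the variables for the variables is a ring homomorphism, because
  \<open>m \<mapsto> \<Prod>i\<in>#m. r i\<close> turns sums of multisets into products.
\<close>

lemma mser_nth_rescale: "mser_nth (mser_rescale r F) m = (\<Prod>i\<in>#m. r i) * mser_nth F m"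
  by (simp add: mser_rescale.rep_eq)

lemma mser_rescale_mult: "mser_rescale r (F * G) = mser_rescale r F * mser_rescale r G"
proof -
  have "(\<Prod>i\<in>#m. r i) * (mser_nth F a * mser_nth G (m - a))
      = (\<Prod>i\<in>#a. r i) * mser_nth F a * ((\<Prod>i\<in>#m - a. r i) * mser_nth G (m - a))"
    if "a \<subseteq># m" for a m
  proof -
    have "(\<Prod>i\<in>#m. r i) = (\<Prod>i\<in>#a. r i) * (\<Prod>i\<in>#m - a. r i)"
      using that by (metis image_mset_union prod_mset_Un subset_mset.add_diff_inverse)
    thus ?thesis by simp
  qed
  thus ?thesis
    by (auto simp: mser_eq_iff mser_nth_rescale mser_nth_mult sum_distrib_left intro!: sum.cong)
qed

lemma mser_rescale_1 [simp]: "mser_rescale r 1 = 1"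
  by transfer auto

lemma mser_rescale_const [simp]: "mser_rescale r (mser_const c) = mser_const c"
  by transfer auto

lemma mser_rescale_var: "mser_rescale r (mser_var i) = mser_const (r i) * mser_var i"
  by (auto simp: mser_eq_iff mser_nth_rescale mser_var.rep_eq)

lemma mser_rescale_sum: "mser_rescale r (sum f A) = (\<Sum>x\<in>A. mser_rescale r (f x))"
  by (auto simp: mser_eq_iff mser_nth_rescale mser_nth_sum sum_distrib_left)

lemma mser_rescale_of_nat [simp]: "mser_rescale r (of_nat n) = of_nat n"
  by (simp flip: mser_const_of_nat)

text \<open>
  The weighted Euler operator \<open>\<Sum>\<^sub>i max 1 i * x\<^sub>i * d/dx\<^sub>i\<close>. On series that do not involve the variable
  with index \<open>0\<close> it multiplies the part of weighted degree \<open>n\<close> by \<open>n\<close>; giving that variable the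
  weight \<open>1\<close> instead of \<open>0\<close> makes the constants the only series annihilated by the operator.
\<close>

definition euler_weight :: "nat multiset \<Rightarrow> nat" where
  "euler_weight m = (\<Sum>i\<in>#m. max 1 i)"

lift_definition mser_euler :: "complex mser \<Rightarrow> complex mser"
  is "\<lambda>F m. of_nat (euler_weight m) * F m" .

lemma euler_weight_eq_0_iff [simp]: "euler_weight m = 0 \<longleftrightarrow> m = {#}"
  by (cases m) (auto simp: euler_weight_def)

lemma euler_weight_split: "a \<subseteq># m \<Longrightarrow> euler_weight m = euler_weight a + euler_weight (m - a)"
  unfolding euler_weight_def
  by (metis image_mset_union sum_mset.union subset_mset.add_diff_inverse)

lemma euler_weight_no_zero: "0 \<notin># m \<Longrightarrow> euler_weight m = sum_mset m"
  by (induction m) (auto simp: euler_weight_def max_def)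

lemma mser_euler_mult: "mser_euler (F * G) = mser_euler F * G + F * mser_euler G"
proof -
  have "of_nat (euler_weight m) * (mser_nth F a * mser_nth G (m - a))
      = of_nat (euler_weight a) * mser_nth F a * mser_nth G (m - a)
      + mser_nth F a * (of_nat (euler_weight (m - a)) * mser_nth G (m - a))"
    if "a \<subseteq># m" for a m
    by (simp add: euler_weight_split[OF that] algebra_simps)
  thus ?thesis
    by (auto simp: mser_eq_iff mser_nth_mult mser_euler.rep_eq plus_mser.rep_eq sum_distrib_left
        simp flip: sum.distrib intro!: sum.cong)
qed

lemma mser_euler_1 [simp]: "mser_euler 1 = 0"
  by transfer auto

lemma mser_euler_diff: "mser_euler (F - G) = mser_euler F - mser_euler G"
  by transfer (auto simp: algebra_simps)

lemma mser_euler_power: "mser_euler (F ^ Suc k) = of_nat (Suc k) * F ^ k * mser_euler F"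
  by (induction k) (auto simp: mser_euler_mult algebra_simps)

lemma mser_euler_const_mult: "mser_euler (mser_const c * F) = mser_const c * mser_euler F"
  by (auto simp: mser_eq_iff mser_euler.rep_eq)

lemma mser_euler_sum: "mser_euler (sum f A) = (\<Sum>x\<in>A. mser_euler (f x))"
  by (auto simp: mser_eq_iff mser_euler.rep_eq mser_nth_sum sum_distrib_left)

lemma mser_euler_eqD:
  assumes "mser_euler F = mser_euler G" "mser_nth F {#} = mser_nth G {#}"
  shows "F = G"
  unfolding mser_eq_iff
proof
  fix m :: "nat multiset"
  have "of_nat (euler_weight m) * mser_nth F m = of_nat (euler_weight m) * mser_nth G m"
    using assms(1) by (metis mser_euler.rep_eq)
  thus "mser_nth F m = mser_nth G m" using assms(2) by (cases "m = {#}") auto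
qed

lemma size_diff_less:
  assumes "a \<subseteq># m" "a \<noteq> {#}"
  shows "size (m - a) < size m"
proof -
  have "size (m - a) + size a = size m"
    using assms(1) by (metis size_union subset_mset.diff_add)
  thus ?thesis using assms(2) by (simp add: nonempty_has_size)
qed

text \<open>A first-order linear differential equation determines its solution up to the constant term.\<close>

lemma mser_euler_ode_zero:
  assumes ode: "mser_euler Y = H * Y" and H0: "mser_nth H {#} = 0" and Y0: "mser_nth Y {#} = 0"
  shows "Y = 0"
proof -
  have "mser_nth Y m = 0" for m
  proof (induction m rule: measure_induct_rule[of size])
    case (less m)
    have "of_nat (euler_weight m) * mser_nth Y m = mser_nth (H * Y) m"
      using ode by (metis mser_euler.rep_eq)
    also have "\<dots> = 0"
      unfolding mser_nth_mult
    proof (rule sum.neutral, safe)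
      fix a assume a: "a \<subseteq># m"
      show "mser_nth H a * mser_nth Y (m - a) = 0"
      proof (cases "a = {#}")
        case False
        thus ?thesis using less.IH size_diff_less[OF a] by simp
      qed (simp add: H0)
    qed
    finally show ?case using Y0 by (cases "m = {#}") auto
  qed
  thus ?thesis by (simp add: mser_eq_iff zero_mser.rep_eq)
qed

lemma mser_euler_ode_unique:
  assumes "mser_euler Y = H * Y" "mser_euler Z = H * Z" "mser_nth H {#} = 0"
    "mser_nth Y {#} = mser_nth Z {#}"
  shows "Y = Z"
proof -
  have "Y - Z = 0"
    by (rule mser_euler_ode_zero[of _ H])
       (use assms in \<open>auto simp: mser_euler_diff minus_mser.rep_eq algebra_simps\<close>)
  thus ?thesis by simp
qed

lemma mser_nth_power_eq_0:
  assumes "mser_nth F {#} = 0" "size m < k"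
  shows "mser_nth (F ^ k) m = 0"
  using assms(2)
proof (induction k arbitrary: m)
  case (Suc k)
  have "mser_nth F a * mser_nth (F ^ k) (m - a) = 0" if a: "a \<subseteq># m" for a
  proof (cases "a = {#}")
    case False
    hence "size (m - a) < k" using size_diff_less[OF a] Suc.prems by simp
    thus ?thesis using Suc.IH by simp
  qed (simp add: assms)
  thus ?case by (auto simp: mser_nth_mult intro: sum.neutral)
qed simp

lemma mser_nth_exp:
  assumes "mser_nth F {#} = 0" "size m \<le> n"
  shows "mser_nth (mser_exp F) m = mser_nth (\<Sum>k\<le>n. mser_const (1 / fact k) * F ^ k) m"
  unfolding mser_exp_def mser_nth_sum
  by (rule mser_nth_Sum_finite) (use assms in \<open>auto simp: mser_nth_power_eq_0\<close>)

lemma mser_nth_ln: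
  assumes "mser_nth (F - 1) {#} = 0" "size m \<le> n"
  shows "mser_nth (mser_ln F) m
    = mser_nth (\<Sum>k<n. mser_const ((- 1) ^ k / of_nat (Suc k)) * (F - 1) ^ Suc k) m"
proof -
  have "mser_nth (mser_ln F) m
      = (\<Sum>k\<in>Suc ` {..<n}. mser_nth (mser_const ((- 1) ^ (k + 1) / of_nat k) * (F - 1) ^ k) m)"
    unfolding mser_ln_def
  proof (rule mser_nth_Sum_finite)
    fix k assume "k \<in> {1..} - Suc ` {..<n}"
    hence "k > n" by (auto simp: image_iff) (metis Suc_le_D Suc_le_lessD lessThan_iff not_less_eq)
    thus "mser_nth (mser_const ((- 1) ^ (k + 1) / of_nat k) * (F - 1) ^ k) m = 0"
      using assms by (simp add: mser_nth_power_eq_0)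
  qed auto
  thus ?thesis by (simp add: sum.reindex mser_nth_sum)
qed

lemma mser_exp_const_term [simp]: "mser_nth F {#} = 0 \<Longrightarrow> mser_nth (mser_exp F) {#} = 1"
  using mser_nth_exp[of F "{#}" 0] by (simp add: one_mser.rep_eq)

lemma mser_nth_mult_cong:
  assumes "\<And>a. a \<subseteq># m \<Longrightarrow> mser_nth G a = mser_nth H a"
  shows "mser_nth (F * G) m = mser_nth (F * H) m"
  unfolding mser_nth_mult by (rule sum.cong) (use assms in auto)

lemma mser_euler_exp:
  assumes "mser_nth F {#} = 0"
  shows "mser_euler (mser_exp F) = mser_euler F * mser_exp F"
  unfolding mser_eq_iff
proof
  fix m :: "nat multiset"
  define n where "n = size m"
  have "mser_nth (mser_euler (mser_exp F)) m
      = mser_nth (mser_euler (\<Sum>k\<le>Suc n. mser_const (1 / fact k) * F ^ k)) m"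
    by (simp only: mser_euler.rep_eq mser_nth_exp[OF assms, of m "Suc n"] n_def le_SucI order_refl)
  also have "mser_euler (\<Sum>k\<le>Suc n. mser_const (1 / fact k) * F ^ k)
      = mser_euler F * (\<Sum>k\<le>n. mser_const (1 / fact k) * F ^ k)"
  proof -
    have "mser_euler (mser_const (1 / fact (Suc k)) * F ^ Suc k)
        = mser_euler F * (mser_const (1 / fact k) * F ^ k)" for k
    proof -
      have "1 / fact (Suc k) * of_nat (Suc k) = (1 / fact k :: complex)"
        by (simp add: field_simps del: of_nat_Suc)
      moreover have "mser_const (1 / fact (Suc k)) * of_nat (Suc k)
          = mser_const (1 / fact (Suc k) * of_nat (Suc k) :: complex)"
        by (simp only: mser_const_mult mser_const_of_nat)
      ultimately have c: "mser_const (1 / fact (Suc k)) * of_nat (Suc k) = mser_const (1 / fact k :: complex)"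
        by metis
      have "mser_const (1 / fact (Suc k)) * (of_nat (Suc k) * F ^ k * mser_euler F)
          = mser_const (1 / fact k) * F ^ k * mser_euler F"
        by (simp only: mult.assoc[symmetric] c)
      thus ?thesis
        unfolding mser_euler_const_mult mser_euler_power by (simp only: mult_ac)
    qed
    moreover have "mser_euler (mser_const (1 / fact 0) * F ^ 0) = 0" by simp
    ultimately show ?thesis
      by (simp only: mser_euler_sum sum.atMost_Suc_shift[of "\<lambda>k. mser_euler (mser_const (1 / fact k) * F ^ k)"]
          add_0_left sum_distrib_left)
  qed
  also have "mser_nth (mser_euler F * (\<Sum>k\<le>n. mser_const (1 / fact k) * F ^ k)) m
      = mser_nth (mser_euler F * mser_exp F) m"
  proof (rule mser_nth_mult_cong)
    fix a assume "a \<subseteq># m"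
    hence "size a \<le> n" by (simp add: n_def size_mset_mono)
    thus "mser_nth (\<Sum>k\<le>n. mser_const (1 / fact k) * F ^ k) a = mser_nth (mser_exp F) a"
      by (rule mser_nth_exp[OF assms, symmetric])
  qed
  finally show "mser_nth (mser_euler (mser_exp F)) m = mser_nth (mser_euler F * mser_exp F) m" .
qed

lemma mser_exp_eqI:
  assumes "mser_euler E = mser_euler F * E" "mser_nth F {#} = 0" "mser_nth E {#} = 1"
  shows "E = mser_exp F"
  by (rule mser_euler_ode_unique[of _ "mser_euler F"])
     (use assms in \<open>auto simp: mser_euler_exp mser_euler.rep_eq\<close>)

text \<open>
  The logarithmic derivative, obtained from the geometric series for \<open>1 / F\<close>; the equation is
  multiplied by \<open>F\<close> so that no inverses are needed.
\<close>

lemma mser_euler_ln: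
  assumes "mser_nth F {#} = 1"
  shows "F * mser_euler (mser_ln F) = mser_euler F"
  unfolding mser_eq_iff
proof
  fix m :: "nat multiset"
  define n where "n = size m"
  define X where "X = F - 1"
  have X0: "mser_nth X {#} = 0" using assms by (simp add: X_def minus_mser.rep_eq one_mser.rep_eq)
  have "mser_nth (F * mser_euler (mser_ln F)) m
      = mser_nth (F * mser_euler (\<Sum>k<n. mser_const ((- 1) ^ k / of_nat (Suc k)) * X ^ Suc k)) m"
  proof (rule mser_nth_mult_cong)
    fix a assume "a \<subseteq># m"
    hence "size a \<le> n" by (simp add: n_def size_mset_mono)
    thus "mser_nth (mser_euler (mser_ln F)) a
      = mser_nth (mser_euler (\<Sum>k<n. mser_const ((- 1) ^ k / of_nat (Suc k)) * X ^ Suc k)) a"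
      using mser_nth_ln[of F a n] X0 by (simp only: mser_euler.rep_eq X_def)
  qed
  also have "F * mser_euler (\<Sum>k<n. mser_const ((- 1) ^ k / of_nat (Suc k)) * X ^ Suc k)
      = (1 + X) * (\<Sum>k<n. (- X) ^ k) * mser_euler X"
  proof -
    have "mser_euler (mser_const ((- 1) ^ k / of_nat (Suc k)) * X ^ Suc k)
        = (- X) ^ k * mser_euler X" for k
    proof -
      have "mser_const ((- 1) ^ k / of_nat (Suc k)) * of_nat (Suc k) = mser_const ((- 1 :: complex) ^ k)"
        by (simp flip: mser_const_of_nat mser_const_mult del: of_nat_Suc)
      also have "\<dots> = (- 1) ^ k"
        by (cases "even k") (auto simp: mser_eq_iff mser_const.rep_eq one_mser.rep_eq uminus_mser.rep_eq)
      finally show ?thesis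
        unfolding mser_euler_const_mult mser_euler_power power_minus[of X] mult.assoc[symmetric] by simp
    qed
    thus ?thesis
      by (simp add: mser_euler_sum sum_distrib_right X_def mult.assoc del: power_Suc of_nat_Suc)
  qed
  also have "(1 + X) * (\<Sum>k<n. (- X) ^ k) = 1 - (- X) ^ n"
    using one_diff_power_eq[of "- X" n] by simp
  \<comment> \<open>Every monomial of \<open>X ^ n * mser_euler X\<close> has more than \<open>n = size m\<close> factors.\<close>
  also have "mser_nth ((1 - (- X) ^ n) * mser_euler X) m = mser_nth (mser_euler X) m"
  proof -
    have "mser_nth (mser_euler X * (- X) ^ n) m = 0"
      unfolding mser_nth_mult
    proof (rule sum.neutral, safe)
      fix a assume a: "a \<subseteq># m"
      show "mser_nth (mser_euler X) a * mser_nth ((- X) ^ n) (m - a) = 0"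
      proof (cases "a = {#}")
        case False
        hence "size (m - a) < n" using size_diff_less[OF a] by (simp add: n_def)
        thus ?thesis using X0 by (simp add: mser_nth_power_eq_0 uminus_mser.rep_eq)
      qed (simp add: mser_euler.rep_eq)
    qed
    thus ?thesis by (simp add: algebra_simps minus_mser.rep_eq)
  qed
  also have "mser_euler X = mser_euler F" by (simp add: X_def mser_euler_diff)
  finally show "mser_nth (F * mser_euler (mser_ln F)) m = mser_nth (mser_euler F) m" .
qed

text \<open>
  The difference of the derivatives of both sides is annihilated by \<open>mser_exp F\<close>, which is not a zero
  divisor because its constant term is \<open>1\<close>.
\<close>

lemma mser_ln_exp:
  assumes "mser_nth F {#} = 0"
  shows "mser_ln (mser_exp F) = F"
proof (rule mser_euler_eqD)
  let ?E = "mser_exp F" and ?L = "mser_ln (mser_exp F)"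
  let ?Y = "mser_euler ?L - mser_euler F"
  have EY: "?E * ?Y = 0"
    using mser_euler_ln[of ?E] mser_euler_exp[OF assms] assms by (simp add: algebra_simps)
  have "mser_nth ?Y m = 0" for m
  proof (induction m rule: measure_induct_rule[of size])
    case (less m)
    have "0 = (\<Sum>a | a \<subseteq># m. mser_nth ?E a * mser_nth ?Y (m - a))"
      using EY by (simp flip: mser_nth_mult add: zero_mser.rep_eq)
    also have "\<dots> = (\<Sum>a\<in>{{#}}. mser_nth ?E a * mser_nth ?Y (m - a))"
    proof (rule sum.mono_neutral_right, simp, simp, safe)
      fix a assume a: "a \<subseteq># m" "mser_nth ?E a * mser_nth ?Y (m - a) \<noteq> 0" "a \<notin> {}"
      show "a = {#}"
      proof (rule ccontr)
        assume "a \<noteq> {#}"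
        hence "mser_nth ?Y (m - a) = 0" using a size_diff_less less.IH by blast
        thus False using a by simp
      qed
    qed
    finally show ?case using assms by simp
  qed
  thus "mser_euler ?L = mser_euler F" by (simp add: mser_eq_iff zero_mser.rep_eq minus_mser.rep_eq)
  show "mser_nth ?L {#} = mser_nth F {#}"
    using mser_nth_ln[of ?E "{#}" 0] assms by (simp add: minus_mser.rep_eq one_mser.rep_eq zero_mser.rep_eq)
qed

lemma mser_rescale_exp:
  assumes "mser_nth F {#} = 0"
  shows "mser_rescale r (mser_exp F) = mser_exp (mser_rescale r F)"
proof (rule mser_exp_eqI)
  have euler: "mser_euler (mser_rescale r H) = mser_rescale r (mser_euler H)" for H
    by (auto simp: mser_eq_iff mser_nth_rescale mser_euler.rep_eq)
  show "mser_euler (mser_rescale r (mser_exp F)) = mser_euler (mser_rescale r F) * mser_rescale r (mser_exp F)"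
    by (simp add: euler mser_euler_exp[OF assms] mser_rescale_mult)
qed (use assms in \<open>simp_all add: mser_nth_rescale\<close>)


section \<open>Series assembled from their homogeneous parts\<close>

text \<open>Homogeneity of weighted degree \<open>n\<close>, for series that do not involve the variable with index \<open>0\<close>.\<close>

definition mser_homogeneous :: "nat \<Rightarrow> 'a :: comm_ring_1 mser \<Rightarrow> bool" where
  "mser_homogeneous n F \<longleftrightarrow> (\<forall>m. mser_nth F m \<noteq> 0 \<longrightarrow> sum_mset m = n \<and> 0 \<notin># m)"

lemma mser_homogeneous_1 [simp]: "mser_homogeneous 0 1"
  by (auto simp: mser_homogeneous_def one_mser.rep_eq)

lemma mser_homogeneous_0 [simp]: "mser_homogeneous n 0"
  by (auto simp: mser_homogeneous_def zero_mser.rep_eq)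

lemma mser_homogeneous_var [simp]: "n > 0 \<Longrightarrow> mser_homogeneous n (mser_var n)"
  by (auto simp: mser_homogeneous_def mser_var.rep_eq split: if_splits)

lemma mser_homogeneous_const_mult: "mser_homogeneous n F \<Longrightarrow> mser_homogeneous n (mser_const c * F)"
  unfolding mser_homogeneous_def mser_nth_const_mult by (metis mult_zero_right)

lemma mser_homogeneous_rescale: "mser_homogeneous n F \<Longrightarrow> mser_homogeneous n (mser_rescale r F)"
  unfolding mser_homogeneous_def mser_nth_rescale by (metis mult_zero_right)

lemma mser_homogeneous_sum:
  "(\<And>x. x \<in> A \<Longrightarrow> mser_homogeneous n (f x)) \<Longrightarrow> mser_homogeneous n (sum f A)"
  unfolding mser_homogeneous_def mser_nth_sum by (meson sum.not_neutral_contains_not_neutral)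

lemma mser_homogeneous_mult:
  assumes "mser_homogeneous k F" "mser_homogeneous l G"
  shows "mser_homogeneous (k + l) (F * G)"
  unfolding mser_homogeneous_def
proof (intro allI impI)
  fix m assume "mser_nth (F * G) m \<noteq> 0"
  then obtain a where a: "a \<subseteq># m" "mser_nth F a * mser_nth G (m - a) \<noteq> 0"
    unfolding mser_nth_mult by (metis (mono_tags, lifting) mem_Collect_eq sum.neutral)
  hence "sum_mset a = k \<and> 0 \<notin># a" "sum_mset (m - a) = l \<and> 0 \<notin># m - a"
    using assms unfolding mser_homogeneous_def by (metis mult_zero_left mult_zero_right)+
  moreover have "m = a + (m - a)" using a by simp
  ultimately show "sum_mset m = k + l \<and> 0 \<notin># m" by (metis sum_mset.union union_iff)
qed

lemma mser_homogeneous_prod: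
  assumes "finite A" "\<And>x. x \<in> A \<Longrightarrow> mser_homogeneous (d x) (f x)"
  shows "mser_homogeneous (sum d A) (prod f A)"
  using assms by (induction A rule: finite_induct) (auto intro: mser_homogeneous_mult)

text \<open>The series whose part of weighted degree \<open>n\<close> is that of \<open>F n\<close>, for every \<open>n\<close>.\<close>

lift_definition mser_graded :: "(nat \<Rightarrow> 'a :: comm_ring_1 mser) \<Rightarrow> 'a mser"
  is "\<lambda>F m. F (sum_mset m) m" .

lemma mser_graded_eqI:
  "(\<And>n. F n = G n) \<Longrightarrow> mser_graded F = mser_graded G"
  by (metis ext)

text \<open>
  The hypothesis is the differential equation of the exponential series, degree by degree.
\<close>

lemma mser_graded_exp:
  assumes hF: "\<And>n. mser_homogeneous n (F n)" and hG: "\<And>n. mser_homogeneous n (G n)"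
    and F0: "F 0 = 1" and G0: "G 0 = 0"
    and rec: "\<And>n. n > 0 \<Longrightarrow> of_nat n * F n = (\<Sum>k=1..n. of_nat k * G k * F (n - k))"
  shows "mser_graded F = mser_exp (mser_graded G)"
proof (rule mser_exp_eqI)
  have zero: "mser_nth (F n) m = 0" "mser_nth (G n) m = 0" if "sum_mset m \<noteq> n \<or> 0 \<in># m" for n m
    using hF hG that by (auto simp: mser_homogeneous_def)
  show "mser_euler (mser_graded F) = mser_euler (mser_graded G) * mser_graded F"
    unfolding mser_eq_iff
  proof
    fix m :: "nat multiset"
    define n where "n = sum_mset m"
    show "mser_nth (mser_euler (mser_graded F)) m
        = mser_nth (mser_euler (mser_graded G) * mser_graded F) m"
    proof (cases "0 \<in># m")
      case True
      have "mser_nth (mser_graded F) (m - a) = 0 \<or> mser_nth (mser_graded G) a = 0" if "a \<subseteq># m" for a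
      proof -
        have "0 \<in># a + (m - a)" using that True by simp
        hence "0 \<in># a \<or> 0 \<in># m - a" by (meson union_iff)
        thus ?thesis unfolding mser_graded.rep_eq by (metis zero)
      qed
      hence "mser_nth (mser_euler (mser_graded G) * mser_graded F) m = 0"
        unfolding mser_nth_mult mser_euler.rep_eq by (intro sum.neutral) fastforce
      moreover have "mser_nth (mser_graded F) m = 0"
        using True zero(1) by (simp add: mser_graded.rep_eq)
      ultimately show ?thesis by (simp add: mser_euler.rep_eq)
    next
      case False
      have "mser_nth (mser_euler (mser_graded F)) m = of_nat n * mser_nth (F n) m"
        using False by (simp add: mser_euler.rep_eq mser_graded.rep_eq euler_weight_no_zero n_def)
      also have "\<dots> = mser_nth (\<Sum>k\<le>n. of_nat k * G k * F (n - k)) m"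
      proof (cases "n = 0")
        case False
        have "(\<Sum>k\<le>n. of_nat k * G k * F (n - k)) = (\<Sum>k=1..n. of_nat k * G k * F (n - k))"
          by (rule sum.mono_neutral_right) (use G0 in \<open>auto simp: not_le\<close>)
        thus ?thesis using rec[of n] False by (metis mser_nth_of_nat_mult bot_nat_0.not_eq_extremum)
      qed (simp add: zero_mser.rep_eq)
      also have "\<dots> = (\<Sum>k\<le>n. \<Sum>a | a \<subseteq># m. of_nat k * mser_nth (G k) a * mser_nth (F (n - k)) (m - a))"
        by (simp only: mser_nth_sum mult.assoc mser_nth_of_nat_mult mser_nth_mult[of "G _"] sum_distrib_left)
      also have "\<dots> = (\<Sum>a | a \<subseteq># m. \<Sum>k\<le>n. of_nat k * mser_nth (G k) a * mser_nth (F (n - k)) (m - a))"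
        by (rule sum.swap)
      also have "\<dots> = (\<Sum>a | a \<subseteq># m. mser_nth (mser_euler (mser_graded G)) a * mser_nth (mser_graded F) (m - a))"
      proof (rule sum.cong[OF refl], safe)
        fix a assume a: "a \<subseteq># m"
        have na: "n = sum_mset a + sum_mset (m - a)"
          unfolding n_def using a by (metis subset_mset.add_diff_inverse sum_mset.union)
        have "0 \<notin># a" using False a by (meson mset_subset_eqD)
        hence wa: "euler_weight a = sum_mset a" by (rule euler_weight_no_zero)
        have "mser_nth (G k) a = 0" if "k \<noteq> sum_mset a" for k
          by (rule zero(2)) (use that in simp)
        hence "(\<Sum>k\<le>n. of_nat k * mser_nth (G k) a * mser_nth (F (n - k)) (m - a))
            = (\<Sum>k\<in>{sum_mset a}. of_nat k * mser_nth (G k) a * mser_nth (F (n - k)) (m - a))"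
          by (intro sum.mono_neutral_right) (auto simp: na)
        also have "n - sum_mset a = sum_mset (m - a)" by (simp add: na)
        hence "(\<Sum>k\<in>{sum_mset a}. of_nat k * mser_nth (G k) a * mser_nth (F (n - k)) (m - a))
            = mser_nth (mser_euler (mser_graded G)) a * mser_nth (mser_graded F) (m - a)"
          by (simp add: mser_euler.rep_eq mser_graded.rep_eq wa)
        finally show "(\<Sum>k\<le>n. of_nat k * mser_nth (G k) a * mser_nth (F (n - k)) (m - a))
            = mser_nth (mser_euler (mser_graded G)) a * mser_nth (mser_graded F) (m - a)" .
      qed
      finally show ?thesis by (simp add: mser_nth_mult)
    qed
  qed
qed (simp_all add: mser_graded.rep_eq F0 G0 one_mser.rep_eq zero_mser.rep_eq)


section \<open>Connected components\<close>

text \<open>The edges of the complete graph on \<open>V\<close>.\<close>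

definition complete_edges :: "'a set \<Rightarrow> 'a set set" where
  "complete_edges V = {e. e \<subseteq> V \<and> card e = 2}"

lemma simple_graph_iff: "simple_graph (V, E) \<longleftrightarrow> finite V \<and> E \<subseteq> complete_edges V"
  by (auto simp: simple_graph_def complete_edges_def)

lemma finite_complete_edges [simp]: "finite V \<Longrightarrow> finite (complete_edges V)"
  unfolding complete_edges_def by (rule finite_subset[of _ "Pow V"]) auto

lemma card_complete_edges: "finite V \<Longrightarrow> card (complete_edges V) = card V choose 2"
  unfolding complete_edges_def by (rule n_subsets)

lemma complete_edgesE:
  assumes "e \<in> complete_edges V"
  obtains u v where "e = {u, v}" "u \<noteq> v" "u \<in> V" "v \<in> V"
  using assms unfolding complete_edges_def by (auto simp: card_2_iff)

lemma complete_edges_mono: "B \<subseteq> V \<Longrightarrow> complete_edges B \<subseteq> complete_edges V"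
  by (auto simp: complete_edges_def)

lemma complete_edges_disjoint:
  "B \<inter> C = {} \<Longrightarrow> complete_edges B \<inter> complete_edges C = {}"
  by (auto simp: complete_edges_def card_2_iff)

lemma bij_betw_complete_edges:
  assumes "bij_betw f V W"
  shows "bij_betw ((`) f) (complete_edges V) (complete_edges W)"
proof -
  have inj: "inj_on ((`) f) (Pow V)" using assms by (auto simp: bij_betw_def inj_on_image_Pow)
  have "(`) f ` complete_edges V = complete_edges W"
  proof safe
    fix e assume "e \<in> complete_edges V"
    thus "f ` e \<in> complete_edges W"
      using assms unfolding complete_edges_def bij_betw_def
      by (auto simp: card_image inj_on_subset)
  next
    fix e assume e: "e \<in> complete_edges W"
    hence "e \<subseteq> f ` V" using assms by (auto simp: complete_edges_def bij_betw_def)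
    then obtain d where d: "d \<subseteq> V" "e = f ` d" by (meson subset_imageE)
    have "card d = 2"
      using e d assms unfolding complete_edges_def bij_betw_def
      by (metis (mono_tags, lifting) card_image inj_on_subset mem_Collect_eq)
    thus "e \<in> (`) f ` complete_edges V" using d by (auto simp: complete_edges_def)
  qed
  moreover have "inj_on ((`) f) (complete_edges V)"
    by (rule inj_on_subset[OF inj]) (auto simp: complete_edges_def)
  ultimately show ?thesis by (simp add: bij_betw_def)
qed

lemma reachable_refl [simp]: "reachable G u u"
  by (simp add: reachable_def)

lemma reachable_trans [trans]: "reachable G u v \<Longrightarrow> reachable G v w \<Longrightarrow> reachable G u w"
  unfolding reachable_def by (rule rtranclp_trans)

lemma reachable_sym: "reachable G u v \<Longrightarrow> reachable G v u"
  unfolding reachable_def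
  by (rule sympD[OF symp_rtranclp]) (auto simp: symp_def insert_commute)

lemma reachable_edge: "{u, v} \<in> edges G \<Longrightarrow> reachable G u v"
  by (auto simp: reachable_def)

lemma reachable_induct [consumes 1, case_names refl step]:
  assumes "reachable G u v" "P u"
    "\<And>x y. reachable G u x \<Longrightarrow> {x, y} \<in> edges G \<Longrightarrow> P x \<Longrightarrow> P y"
  shows "P v"
  using assms(1) unfolding reachable_def
  by (induction rule: rtranclp_induct) (use assms in \<open>auto simp: reachable_def\<close>)

lemma reachable_mono: "reachable (V, E) u v \<Longrightarrow> E \<subseteq> E' \<Longrightarrow> reachable (V', E') u v"
proof (induction rule: reachable_induct)
  case (step x y)
  hence "reachable (V', E') x y" by (intro reachable_edge) auto
  thus ?case using step by (meson reachable_trans)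
qed simp

lemma reachable_restrict:
  assumes "reachable (V, E) u v" "u \<in> W"
    and "\<And>x y. x \<in> W \<Longrightarrow> {x, y} \<in> E \<Longrightarrow> {x, y} \<in> E' \<and> y \<in> W"
  shows "reachable (V', E') u v \<and> v \<in> W"
  using assms(1)
proof (induction rule: reachable_induct)
  case (step x y)
  hence xy: "{x, y} \<in> E'" "y \<in> W" using assms(3)[of x y] by auto
  hence "reachable (V', E') x y" by (intro reachable_edge) simp
  thus ?case using step xy by (meson reachable_trans)
qed (use assms in simp)

lemma reachable_no_edges: "reachable (V, {}) u v \<longleftrightarrow> u = v"
proof
  assume "reachable (V, {}) u v"
  thus "u = v" by (induction rule: reachable_induct) auto
qed simp

lemma reachable_insert_edge:
  "reachable (V, insert {u, v} E) x y \<longleftrightarrow> reachable (V, E) x y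
     \<or> (reachable (V, E) x u \<and> reachable (V, E) v y) \<or> (reachable (V, E) x v \<and> reachable (V, E) u y)"
  (is "?L \<longleftrightarrow> ?R")
proof
  assume ?L
  thus ?R
  proof (induction rule: reachable_induct)
    case (step a b)
    show ?case
    proof (cases "{a, b} \<in> E")
      case True
      hence "reachable (V, E) a b" by (simp add: reachable_edge)
      thus ?thesis using step.IH by (meson reachable_trans)
    next
      case False
      hence "{a, b} = {u, v}" using step by auto
      hence "a = u \<and> b = v \<or> a = v \<and> b = u" by (auto simp: doubleton_eq_iff)
      thus ?thesis using step.IH by (auto intro: reachable_refl)
    qed
  qed simp
next
  assume ?R
  moreover have "reachable (V, insert {u, v} E) a b" if "reachable (V, E) a b" for a b
    using that by (rule reachable_mono) auto
  moreover have "reachable (V, insert {u, v} E) u v" by (simp add: reachable_edge)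
  ultimately show ?L by (meson reachable_sym reachable_trans)
qed

lemma componentsI: "u \<in> V \<Longrightarrow> {v \<in> V. reachable (V, E) u v} \<in> components (V, E)"
  by (auto simp: components_def)

lemma componentsE:
  assumes "T \<in> components (V, E)"
  obtains u where "u \<in> V" "T = {v \<in> V. reachable (V, E) u v}"
  using assms by (auto simp: components_def)

lemma component_eqI: "T \<in> components (V, E) \<Longrightarrow> u \<in> T \<Longrightarrow> T = {v \<in> V. reachable (V, E) u v}"
  by (elim componentsE) (auto intro: reachable_trans reachable_sym)

lemma component_eq_iff:
  assumes "u \<in> V" "v \<in> V"
  shows "{w \<in> V. reachable (V, E) u w} = {w \<in> V. reachable (V, E) v w} \<longleftrightarrow> reachable (V, E) u v"
  using assms by (auto intro: reachable_trans reachable_sym)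

lemma finite_components [simp]: "finite V \<Longrightarrow> finite (components (V, E))"
  by (simp add: components_def)

lemma component_subset: "T \<in> components (V, E) \<Longrightarrow> T \<subseteq> V"
  by (auto elim: componentsE)

lemma component_nonempty: "T \<in> components (V, E) \<Longrightarrow> T \<noteq> {}"
  by (auto elim!: componentsE)

lemma Union_components: "\<Union> (components (V, E)) = V"
  by (auto simp: components_def)

lemma components_disjoint: "pairwise disjnt (components (V, E))"
proof (rule pairwiseI)
  fix A B assume AB: "A \<in> components (V, E)" "B \<in> components (V, E)" "A \<noteq> B"
  have "A = B" if "w \<in> A" "w \<in> B" for w
    using component_eqI[OF AB(1) that(1)] component_eqI[OF AB(2) that(2)] by simp
  thus "disjnt A B" using AB(3) by (auto simp: disjnt_def)
qed

lemma component_card_pos: "finite V \<Longrightarrow> T \<in> components (V, E) \<Longrightarrow> card T > 0"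
  using component_subset component_nonempty by (metis card_gt_0_iff finite_subset)

lemma sum_card_components: "finite V \<Longrightarrow> (\<Sum>T\<in>components (V, E). card T) = card V"
  using card_Union_disjoint[of "components (V, E)"] components_disjoint[of V E]
    finite_subset[OF component_subset] by (metis Union_components)

lemma components_no_edges: "components (V, {}) = (\<lambda>v. {v}) ` V"
  by (auto simp: components_def reachable_no_edges)

lemma components_connected: "connected_graph (V, E) \<Longrightarrow> components (V, E) = {V}"
  by (auto simp: components_def connected_graph_def)

lemma components_card_1_connected:
  assumes "card (components (V, E)) = 1"
  shows "connected_graph (V, E)"
proof -
  obtain T where T: "components (V, E) = {T}" using assms by (auto simp: card_1_singleton_iff)
  hence "T = V" using Union_components[of V E] by simp
  hence "V \<noteq> {}" using T component_nonempty by blast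
  moreover have "reachable (V, E) u v" if "u \<in> V" "v \<in> V" for u v
    using componentsI[of u V E] that T \<open>T = V\<close> by auto
  ultimately show ?thesis by (simp add: connected_graph_def)
qed

lemma components_insert_edge_same:
  assumes "reachable (V, E) u v"
  shows "components (V, insert {u, v} E) = components (V, E)"
proof -
  have "reachable (V, insert {u, v} E) x y \<longleftrightarrow> reachable (V, E) x y" for x y
    unfolding reachable_insert_edge using assms by (meson reachable_sym reachable_trans)
  thus ?thesis by (simp add: components_def)
qed

text \<open>
  A new edge merges the components of its ends. The statement also covers ends in a common component
  (\<open>A = B\<close>), where nothing changes.
\<close>

lemma components_insert_edge_new:
  fixes u v V E
  defines "A \<equiv> {x \<in> V. reachable (V, E) u x}" and "B \<equiv> {x \<in> V. reachable (V, E) v x}"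
  assumes "u \<in> V" "v \<in> V"
  shows "components (V, insert {u, v} E) = insert (A \<union> B) (components (V, E) - {A, B})"
proof -
  let ?R = "reachable (V, E)" and ?R' = "reachable (V, insert {u, v} E)"
  have eq: "{y \<in> V. ?R' x y} = (if x \<in> A \<union> B then A \<union> B else {y \<in> V. ?R x y})" if "x \<in> V" for x
    unfolding reachable_insert_edge A_def B_def using that 
    by (auto intro: reachable_trans reachable_sym)
  have AB: "{y \<in> V. ?R x y} \<in> {A, B} \<longleftrightarrow> x \<in> A \<union> B" if "x \<in> V" for x
    using component_eq_iff[OF \<open>u \<in> V\<close> that, of E] component_eq_iff[OF \<open>v \<in> V\<close> that, of E] that
    unfolding A_def B_def by auto
  have uA: "u \<in> A" using assms by (simp add: A_def)
  show ?thesis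
  proof (intro equalityI subsetI)
    fix T assume "T \<in> components (V, insert {u, v} E)"
    then obtain x where x: "x \<in> V" "T = {y \<in> V. ?R' x y}" by (elim componentsE)
    thus "T \<in> insert (A \<union> B) (components (V, E) - {A, B})"
      using eq[OF x(1)] AB[OF x(1)] componentsI[OF x(1), of E] by (auto split: if_splits)
  next
    fix T assume T: "T \<in> insert (A \<union> B) (components (V, E) - {A, B})"
    show "T \<in> components (V, insert {u, v} E)"
    proof (cases "T = A \<union> B")
      case True
      have "{y \<in> V. ?R' u y} \<in> components (V, insert {u, v} E)" by (rule componentsI) fact
      thus ?thesis using eq[OF \<open>u \<in> V\<close>] uA True by simp
    next
      case False
      with T obtain x where x: "x \<in> V" "T = {y \<in> V. ?R x y}" "T \<notin> {A, B}"
        by (auto elim: componentsE)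
      have "{y \<in> V. ?R' x y} \<in> components (V, insert {u, v} E)" by (rule componentsI) fact
      thus ?thesis using eq[OF x(1)] AB[OF x(1)] x by simp
    qed
  qed
qed

lemma prod_components_insert_edge:
  fixes f :: "'a set \<Rightarrow> 'b :: comm_monoid_mult"
  assumes "finite V" "u \<in> V" "v \<in> V" "\<not> reachable (V, E) u v"
  defines "A \<equiv> {x \<in> V. reachable (V, E) u x}" and "B \<equiv> {x \<in> V. reachable (V, E) v x}"
  shows "(\<Prod>T\<in>components (V, insert {u, v} E). f T) * (f A * f B)
      = (\<Prod>T\<in>components (V, E). f T) * f (A \<union> B)"
    and "A \<inter> B = {}"
    and "Suc (card (components (V, insert {u, v} E))) = card (components (V, E))"
proof -
  have AB: "A \<in> components (V, E)" "B \<in> components (V, E)" "A \<noteq> B"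
    using assms component_eq_iff[of u V v E] by (auto intro: componentsI)
  show disj: "A \<inter> B = {}"
    using components_disjoint[of V E] AB by (auto simp: pairwise_def disjnt_def)
  have "A \<noteq> {}" "B \<noteq> {}" using AB component_nonempty by metis+
  let ?D = "components (V, E) - {A, B}"
  have new: "A \<union> B \<notin> ?D"
  proof
    assume U: "A \<union> B \<in> ?D"
    hence "A \<union> B \<in> components (V, E)" "A \<union> B \<noteq> A" by auto
    hence "disjnt (A \<union> B) A" by (rule pairwiseD[OF components_disjoint _ AB(1)])
    thus False using \<open>A \<noteq> {}\<close> by (auto simp: disjnt_def)
  qed
  have fin: "finite ?D" using assms by simp
  have c: "components (V, insert {u, v} E) = insert (A \<union> B) ?D"
    unfolding A_def B_def by (rule components_insert_edge_new) fact+
  have c': "components (V, E) = insert A (insert B ?D)" using AB by auto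
  have "(\<Prod>T\<in>components (V, E). f T) = f A * (f B * prod f ?D)"
    using fin AB(3) by (subst c') simp
  thus "(\<Prod>T\<in>components (V, insert {u, v} E). f T) * (f A * f B)
      = (\<Prod>T\<in>components (V, E). f T) * f (A \<union> B)"
    using fin new by (simp add: c mult_ac)
  have "card (components (V, E)) = Suc (Suc (card ?D))"
    using fin AB(3) by (subst c') simp
  thus "Suc (card (components (V, insert {u, v} E))) = card (components (V, E))"
    using fin new by (simp add: c)
qed


section \<open>Acyclic graphs\<close>

lemma is_cycle_rotate:
  assumes "is_cycle G vs"
  shows "is_cycle G (rotate k vs)"
proof -
  have "vs \<noteq> []" using assms by (auto simp: is_cycle_def)
  have "{rotate k vs ! i, rotate k vs ! (Suc i mod length vs)} \<in> edges G" if i: "i < length vs" for i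
  proof -
    let ?n = "length vs" and ?j = "(k + i) mod length vs"
    have "?j < ?n" using \<open>vs \<noteq> []\<close> by simp
    hence "{vs ! ?j, vs ! (Suc ?j mod ?n)} \<in> edges G" using assms by (auto simp: is_cycle_def)
    moreover have "rotate k vs ! i = vs ! ?j" using i by (simp add: nth_rotate)
    moreover have "rotate k vs ! (Suc i mod ?n) = vs ! ((k + Suc i mod ?n) mod ?n)"
      using \<open>vs \<noteq> []\<close> by (intro nth_rotate) simp
    moreover have "(k + Suc i mod ?n) mod ?n = Suc ?j mod ?n"
      by (simp add: mod_add_right_eq mod_Suc_eq)
    ultimately show ?thesis by simp
  qed
  thus ?thesis using assms by (auto simp: is_cycle_def)
qed

lemma reachable_nth:
  assumes "\<And>i. i < n \<Longrightarrow> {f i, f (Suc i)} \<in> edges G"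
  shows "reachable G (f 0) (f n)"
  using assms by (induction n) (auto intro: reachable_trans reachable_edge)

lemma reachable_distinct_path:
  assumes "reachable G u v"
  obtains vs where "vs \<noteq> []" "hd vs = u" "last vs = v" "distinct vs"
    "\<And>i. Suc i < length vs \<Longrightarrow> {vs ! i, vs ! Suc i} \<in> edges G"
proof -
  have "\<exists>vs. vs \<noteq> [] \<and> hd vs = u \<and> last vs = v \<and> distinct vs
      \<and> (\<forall>i. Suc i < length vs \<longrightarrow> {vs ! i, vs ! Suc i} \<in> edges G)"
    using assms
  proof (induction rule: reachable_induct)
    case refl
    show ?case by (rule exI[of _ "[u]"]) simp
  next
    case (step x y)
    then obtain vs where vs: "vs \<noteq> []" "hd vs = u" "last vs = x" "distinct vs"
      "\<And>i. Suc i < length vs \<Longrightarrow> {vs ! i, vs ! Suc i} \<in> edges G" by blast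
    show ?case
    proof (cases "y \<in> set vs")
      case True
      then obtain k where k: "k < length vs" "vs ! k = y" by (auto simp: in_set_conv_nth)
      have "take (Suc k) vs \<noteq> []" "distinct (take (Suc k) vs)" using vs by auto
      moreover have "hd (take (Suc k) vs) = u" using vs by (simp add: hd_conv_nth)
      moreover have "last (take (Suc k) vs) = y" using k by (simp add: take_Suc_conv_app_nth)
      moreover have "{take (Suc k) vs ! i, take (Suc k) vs ! Suc i} \<in> edges G"
        if "Suc i < length (take (Suc k) vs)" for i using vs(5)[of i] that by simp
      ultimately show ?thesis by blast
    next
      case False
      show ?thesis
      proof (rule exI[of _ "vs @ [y]"], intro conjI allI impI)
        fix i assume i: "Suc i < length (vs @ [y])"
        show "{(vs @ [y]) ! i, (vs @ [y]) ! Suc i} \<in> edges G"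
        proof (cases "Suc i < length vs")
          case False
          hence "i = length vs - 1" using i by simp
          thus ?thesis using vs step i by (simp add: nth_append last_conv_nth)
        qed (use vs in \<open>simp add: nth_append\<close>)
      qed (use vs False in auto)
    qed
  qed
  thus ?thesis using that by blast
qed

lemma acyclic_insert_edge:
  assumes "{u, v} \<notin> E" "u \<noteq> v"
  shows "acyclic_graph (V, insert {u, v} E) \<longleftrightarrow> acyclic_graph (V, E) \<and> \<not> reachable (V, E) u v"
proof (intro iffI conjI notI)
  assume ac: "acyclic_graph (V, insert {u, v} E)"
  show "acyclic_graph (V, E)"
    using ac unfolding acyclic_graph_def is_cycle_def by auto
  assume "reachable (V, E) u v"
  then obtain vs where vs: "vs \<noteq> []" "hd vs = u" "last vs = v" "distinct vs"
    "\<And>i. Suc i < length vs \<Longrightarrow> {vs ! i, vs ! Suc i} \<in> E" by (auto elim: reachable_distinct_path)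
  have "length vs \<noteq> 1" using vs assms by (auto simp: length_Suc_conv)
  moreover have "length vs \<noteq> 2"
  proof
    assume "length vs = 2"
    hence "vs = [u, v]" using vs by (auto simp: numeral_2_eq_2 length_Suc_conv)
    thus False using vs(5)[of 0] assms by simp
  qed
  moreover have "length vs \<noteq> 0" using vs by simp
  ultimately have "length vs \<ge> 3" by linarith
  moreover have "{vs ! i, vs ! (Suc i mod length vs)} \<in> insert {u, v} E" if "i < length vs" for i
  proof (cases "Suc i < length vs")
    case False
    hence "Suc i = length vs" using that by simp
    hence "i = length vs - 1" "Suc i mod length vs = 0" by (auto simp flip: \<open>Suc i = length vs\<close>)
    thus ?thesis using vs by (simp add: hd_conv_nth last_conv_nth insert_commute)
  qed (use vs in simp)
  ultimately have "is_cycle (V, insert {u, v} E) vs" using vs by (simp add: is_cycle_def)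
  thus False using ac by (auto simp: acyclic_graph_def)
next
  assume A: "acyclic_graph (V, E) \<and> \<not> reachable (V, E) u v"
  show "acyclic_graph (V, insert {u, v} E)"
    unfolding acyclic_graph_def
  proof (intro notI, elim exE)
    fix vs assume vs: "is_cycle (V, insert {u, v} E) vs"
    then obtain i where i: "i < length vs" "{vs ! i, vs ! (Suc i mod length vs)} \<notin> E"
      using A by (auto simp: acyclic_graph_def is_cycle_def)
    hence e: "{vs ! i, vs ! (Suc i mod length vs)} = {u, v}" using vs by (auto simp: is_cycle_def)
    \<comment> \<open>Rotate the cycle so that the new edge joins its last vertex to its first one.\<close>
    define ws where "ws = rotate (Suc i) vs"
    define n where "n = length vs - 1"
    have len: "length vs = Suc n" "n \<ge> 2" "length ws = Suc n" using vs by (auto simp: n_def ws_def is_cycle_def)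
    have ws: "is_cycle (V, insert {u, v} E) ws" unfolding ws_def by (rule is_cycle_rotate) fact
    have w0: "ws ! 0 = vs ! (Suc i mod length vs)"
      using nth_rotate[of 0 vs "Suc i"] len by (simp add: ws_def del: rotate_Suc)
    have "ws ! n = vs ! ((Suc i + n) mod length vs)"
      using len nth_rotate[of n vs "Suc i"] by (simp add: ws_def del: rotate_Suc)
    also have "Suc i + n = i + length vs" using len by simp
    also have "\<dots> mod length vs = i" using i by simp
    finally have wn: "ws ! n = vs ! i" .
    have "{ws ! j, ws ! Suc j} \<in> E" if j: "j < n" for j
    proof -
      have "{ws ! j, ws ! Suc j} \<in> insert {u, v} E"
        using ws j len unfolding is_cycle_def by (metis Suc_less_eq mod_less less_SucI snd_conv)
      \<comment> \<open>The vertices are distinct and \<open>n \<ge> 2\<close>, so the new edge is used only once on the cycle.\<close>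
      moreover have "{ws ! j, ws ! Suc j} \<noteq> {ws ! 0, ws ! n}"
        using ws j len by (auto simp: is_cycle_def doubleton_eq_iff nth_eq_iff_index_eq)
      ultimately show ?thesis using e w0 wn by (auto simp: insert_commute)
    qed
    hence "reachable (V, E) (ws ! 0) (ws ! n)" by (intro reachable_nth) simp
    hence "reachable (V, E) (vs ! (Suc i mod length vs)) (vs ! i)" by (simp add: w0 wn)
    thus False using e A by (auto simp: doubleton_eq_iff dest: reachable_sym)
  qed
qed

text \<open>
  The dimension of the cycle space. For a simple graph the natural subtraction does not truncate, and
  the nullity is \<open>0\<close> precisely for forests, by \<open>card_verts_le\<close> below.
\<close>

definition nullity :: "'a graph \<Rightarrow> nat" where
  "nullity G = card (edges G) + card (components G) - card (verts G)"

lemma card_verts_le: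
  assumes "finite V" "E \<subseteq> complete_edges V"
  shows "card V \<le> card E + card (components (V, E))
    \<and> (acyclic_graph (V, E) \<longleftrightarrow> card V = card E + card (components (V, E)))"
proof -
  have "finite E" using assms by (meson finite_complete_edges finite_subset)
  thus ?thesis using assms(2)
  proof (induction rule: finite_induct)
    case empty
    have "acyclic_graph (V, {})"
      unfolding acyclic_graph_def is_cycle_def by (auto simp: exI[of _ 0] Suc_le_eq intro!: exI[of _ 0])
    moreover have "card ((\<lambda>v. {v}) ` V) = card V" by (rule card_image) auto
    ultimately show ?case by (simp add: components_no_edges)
  next
    case (insert e E)
    obtain u v where e: "e = {u, v}" "u \<noteq> v" "u \<in> V" "v \<in> V"
      using insert.prems by (auto elim: complete_edgesE)
    have ac: "acyclic_graph (V, insert e E) \<longleftrightarrow> acyclic_graph (V, E) \<and> \<not> reachable (V, E) u v"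
      using acyclic_insert_edge[of u v E V] e insert.hyps by simp
    show ?case
    proof (cases "reachable (V, E) u v")
      case True
      thus ?thesis using components_insert_edge_same[OF True] insert ac e by auto
    next
      case False
      thus ?thesis using prod_components_insert_edge(3)[OF assms(1) e(3,4) False] insert ac e by auto
    qed
  qed
qed

lemma nullity_eq_0_iff:
  assumes "simple_graph (V, E)"
  shows "nullity (V, E) = 0 \<longleftrightarrow> acyclic_graph (V, E)"
  using card_verts_le[of V E] assms by (auto simp: simple_graph_iff nullity_def)


section \<open>Multiplicative functions of graphs\<close>

lemma components_disjoint_union:
  assumes "B \<inter> C = {}" "E1 \<subseteq> complete_edges B" "E2 \<subseteq> complete_edges C"
  shows "components (B \<union> C, E1 \<union> E2) = components (B, E1) \<union> components (C, E2)"
proof -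
  have "{v \<in> B \<union> C. reachable (B \<union> C, E1 \<union> E2) u v} = {v \<in> B. reachable (B, E1) u v}"
    if "u \<in> B" "B \<inter> C = {}" "E1 \<subseteq> complete_edges B" "E2 \<subseteq> complete_edges C"
    for u :: 'a and B C E1 E2
  proof (intro equalityI subsetI)
    fix v assume "v \<in> {v \<in> B \<union> C. reachable (B \<union> C, E1 \<union> E2) u v}"
    hence "reachable (B \<union> C, E1 \<union> E2) u v" by simp
    hence "reachable (B, E1) u v \<and> v \<in> B"
    proof (rule reachable_restrict)
      fix x y assume xy: "x \<in> B" "{x, y} \<in> E1 \<union> E2"
      hence "{x, y} \<notin> E2" using that(2,4) by (auto simp: complete_edges_def)
      hence "{x, y} \<in> E1" using xy by simp
      thus "{x, y} \<in> E1 \<and> y \<in> B" using that by (auto simp: complete_edges_def)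
    qed fact
    thus "v \<in> {v \<in> B. reachable (B, E1) u v}" by simp
  next
    fix v assume "v \<in> {v \<in> B. reachable (B, E1) u v}"
    thus "v \<in> {v \<in> B \<union> C. reachable (B \<union> C, E1 \<union> E2) u v}" by (auto intro: reachable_mono)
  qed
  note * = this
  have "(\<lambda>u. {v \<in> B \<union> C. reachable (B \<union> C, E1 \<union> E2) u v}) ` B
      = (\<lambda>u. {v \<in> B. reachable (B, E1) u v}) ` B"
    using *[OF _ assms] by auto
  moreover have "(\<lambda>u. {v \<in> B \<union> C. reachable (B \<union> C, E1 \<union> E2) u v}) ` C
      = (\<lambda>u. {v \<in> C. reachable (C, E2) u v}) ` C"
    using *[of _ C B E2 E1] assms by (auto simp: Un_commute Int_commute)
  ultimately show ?thesis by (simp add: components_def image_Un)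
qed

lemma components_Int_disjoint: "B \<inter> C = {} \<Longrightarrow> components (B, E1) \<inter> components (C, E2) = {}"
  using component_subset component_nonempty by (metis Int_emptyI Int_subset_iff subset_empty)

text \<open>A graph function that is multiplicative under disjoint unions of simple graphs.\<close>

definition multiplicative :: "('a graph \<Rightarrow> 'b :: comm_ring_1) \<Rightarrow> bool" where
  "multiplicative \<phi> \<longleftrightarrow> (\<forall>B C E1 E2. finite B \<longrightarrow> finite C \<longrightarrow> B \<inter> C = {} \<longrightarrow>
     E1 \<subseteq> complete_edges B \<longrightarrow> E2 \<subseteq> complete_edges C \<longrightarrow>
     \<phi> (B \<union> C, E1 \<union> E2) = \<phi> (B, E1) * \<phi> (C, E2))"

text \<open>
  Invariance under isomorphisms of simple graphs within one vertex type; predicates are included as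
  functions with boolean values.
\<close>

definition isomorphism_invariant :: "('a graph \<Rightarrow> 'b) \<Rightarrow> bool" where
  "isomorphism_invariant \<phi> \<longleftrightarrow> (\<forall>V E f. finite V \<longrightarrow> E \<subseteq> complete_edges V \<longrightarrow> inj_on f V \<longrightarrow>
     \<phi> (f ` V, (`) f ` E) = \<phi> (V, E))"

text \<open>
  Every graph on \<open>V\<close> decomposes uniquely into the connected component of the vertex \<open>x\<close> and a graph
  on the remaining vertices.
\<close>

lemma sum_graphs_split_component:
  fixes \<phi> :: "'a graph \<Rightarrow> 'b :: comm_ring_1"
  assumes "finite V" "x \<in> V" "multiplicative \<phi>"
  shows "(\<Sum>E\<in>Pow (complete_edges V). \<phi> (V, E))
    = (\<Sum>B | B \<subseteq> V \<and> x \<in> B.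
        (\<Sum>E | E \<in> Pow (complete_edges B) \<and> connected_graph (B, E). \<phi> (B, E))
        * (\<Sum>E\<in>Pow (complete_edges (V - B)). \<phi> (V - B, E)))"
proof -
  let ?conn = "\<lambda>B. {E. E \<in> Pow (complete_edges B) \<and> connected_graph (B, E)}"
  let ?rest = "\<lambda>B. Pow (complete_edges (V - B))"
  define comp where "comp = (\<lambda>E. {v \<in> V. reachable (V, E) x v})"
  have split: "E \<inter> complete_edges (comp E) \<union> E \<inter> complete_edges (V - comp E) = E"
    if E: "E \<subseteq> complete_edges V" for E
  proof (intro equalityI subsetI)
    fix e assume e: "e \<in> E"
    then obtain u v where uv: "e = {u, v}" "u \<noteq> v" "u \<in> V" "v \<in> V"
      using E complete_edgesE by (metis subsetD)
    have "reachable (V, E) u v" using e uv by (simp add: reachable_edge)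
    hence "u \<in> comp E \<longleftrightarrow> v \<in> comp E"
      using uv unfolding comp_def by (auto intro: reachable_trans reachable_sym)
    thus "e \<in> E \<inter> complete_edges (comp E) \<union> E \<inter> complete_edges (V - comp E)"
      using e uv by (auto simp: complete_edges_def)
  qed auto
  have conn: "connected_graph (comp E, E \<inter> complete_edges (comp E))"
    if E: "E \<subseteq> complete_edges V" for E
  proof -
    have "reachable (comp E, E \<inter> complete_edges (comp E)) x v" if "v \<in> comp E" for v
    proof -
      have "reachable (V, E) x v" using that by (simp add: comp_def)
      hence "reachable (comp E, E \<inter> complete_edges (comp E)) x v \<and> v \<in> comp E"
      proof (rule reachable_restrict)
        show "x \<in> comp E" using assms by (simp add: comp_def)
        fix a b assume ab: "a \<in> comp E" "{a, b} \<in> E"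
        hence "{a, b} \<in> complete_edges V" using E by auto
        moreover have "b \<in> comp E"
          using ab calculation reachable_edge[of a b "(V, E)"] unfolding comp_def complete_edges_def
          by (auto intro: reachable_trans)
        ultimately show "{a, b} \<in> E \<inter> complete_edges (comp E) \<and> b \<in> comp E"
          using ab by (auto simp: complete_edges_def)
      qed
      thus ?thesis by simp
    qed
    moreover have "x \<in> comp E" using assms by (simp add: comp_def)
    ultimately show ?thesis
      unfolding connected_graph_def by (metis empty_iff fst_conv reachable_sym reachable_trans)
  qed
  have comp: "comp (E1 \<union> E2) = B"
    if "B \<subseteq> V" "x \<in> B" "E1 \<subseteq> complete_edges B" "connected_graph (B, E1)"
      "E2 \<subseteq> complete_edges (V - B)" for B E1 E2
  proof (intro equalityI subsetI)
    fix v assume "v \<in> comp (E1 \<union> E2)"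
    hence "reachable (V, E1 \<union> E2) x v" by (simp add: comp_def)
    hence "reachable (V, E1) x v \<and> v \<in> B"
    proof (rule reachable_restrict)
      fix a b assume ab: "a \<in> B" "{a, b} \<in> E1 \<union> E2"
      hence "{a, b} \<notin> E2" using that(5) by (auto simp: complete_edges_def)
      hence "{a, b} \<in> E1" using ab by simp
      thus "{a, b} \<in> E1 \<and> b \<in> B" using that by (auto simp: complete_edges_def)
    qed fact
    thus "v \<in> B" by simp
  next
    fix v assume "v \<in> B"
    hence "reachable (B, E1) x v" using that by (simp add: connected_graph_def)
    hence "reachable (V, E1 \<union> E2) x v" by (rule reachable_mono) simp
    thus "v \<in> comp (E1 \<union> E2)" using \<open>v \<in> B\<close> that by (auto simp: comp_def)
  qed
  have "(\<Sum>E\<in>Pow (complete_edges V). \<phi> (V, E))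
      = (\<Sum>(B, E1, E2)\<in>(SIGMA B:{B. B \<subseteq> V \<and> x \<in> B}. ?conn B \<times> ?rest B). \<phi> (B, E1) * \<phi> (V - B, E2))"
  proof (rule sum.reindex_bij_witness[where
        i = "\<lambda>(B, E1, E2). E1 \<union> E2" and
        j = "\<lambda>E. (comp E, E \<inter> complete_edges (comp E), E \<inter> complete_edges (V - comp E))"])
    fix p assume "p \<in> (SIGMA B:{B. B \<subseteq> V \<and> x \<in> B}. ?conn B \<times> ?rest B)"
    then obtain B E1 E2 where p: "p = (B, E1, E2)" "B \<subseteq> V" "x \<in> B" "E1 \<subseteq> complete_edges B"
      "connected_graph (B, E1)" "E2 \<subseteq> complete_edges (V - B)" by auto
    have "E1 \<inter> complete_edges (V - B) = {}" "E2 \<inter> complete_edges B = {}"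
      using p complete_edges_disjoint[of B "V - B"] by auto
    thus "(\<lambda>E. (comp E, E \<inter> complete_edges (comp E), E \<inter> complete_edges (V - comp E)))
        ((\<lambda>(B, E1, E2). E1 \<union> E2) p) = p"
      using comp[OF p(2-6)] p by auto
    show "(\<lambda>(B, E1, E2). E1 \<union> E2) p \<in> Pow (complete_edges V)"
      using p complete_edges_mono[of B V] complete_edges_mono[of "V - B" V] by auto
  next
    fix E assume E: "E \<in> Pow (complete_edges V)"
    show "(\<lambda>(B, E1, E2). E1 \<union> E2)
        (comp E, E \<inter> complete_edges (comp E), E \<inter> complete_edges (V - comp E)) = E"
      using split[of E] E by simp
    show "(comp E, E \<inter> complete_edges (comp E), E \<inter> complete_edges (V - comp E))
        \<in> (SIGMA B:{B. B \<subseteq> V \<and> x \<in> B}. ?conn B \<times> ?rest B)"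
      using conn[of E] E assms by (auto simp: comp_def)
    have "comp E \<union> (V - comp E) = V" by (auto simp: comp_def)
    moreover have "finite (comp E)" "finite (V - comp E)" using assms by (auto simp: comp_def)
    ultimately have "\<phi> (V, E)
        = \<phi> (comp E, E \<inter> complete_edges (comp E)) * \<phi> (V - comp E, E \<inter> complete_edges (V - comp E))"
      using assms(3) split[of E] E unfolding multiplicative_def
      by (metis Diff_disjoint Int_lower2 PowD)
    thus "(case (comp E, E \<inter> complete_edges (comp E), E \<inter> complete_edges (V - comp E)) of
        (B, E1, E2) \<Rightarrow> \<phi> (B, E1) * \<phi> (V - B, E2)) = \<phi> (V, E)" by simp
  qed
  also have "\<dots> = (\<Sum>B | B \<subseteq> V \<and> x \<in> B. \<Sum>(E1, E2)\<in>?conn B \<times> ?rest B. \<phi> (B, E1) * \<phi> (V - B, E2))"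
  proof (intro sum.Sigma[symmetric] ballI)
    fix B assume "B \<in> {B. B \<subseteq> V \<and> x \<in> B}"
    hence "finite B" using assms(1) by (auto intro: finite_subset)
    thus "finite (?conn B \<times> ?rest B)" using assms(1) by auto
  qed (use assms(1) in simp)
  also have "\<dots> = (\<Sum>B | B \<subseteq> V \<and> x \<in> B. sum (\<lambda>E. \<phi> (B, E)) (?conn B) * sum (\<lambda>E. \<phi> (V - B, E)) (?rest B))"
    by (simp add: sum_product sum.cartesian_product)
  finally show ?thesis .
qed

lemma reachable_map:
  assumes "inj_on f V" "E \<subseteq> complete_edges V" "u \<in> V" "v \<in> V"
  shows "reachable (f ` V, (`) f ` E) (f u) (f v) \<longleftrightarrow> reachable (V, E) u v"
proof
  assume "reachable (V, E) u v"
  thus "reachable (f ` V, (`) f ` E) (f u) (f v)"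
  proof (induction rule: reachable_induct)
    case (step x y)
    hence "f ` {x, y} \<in> (`) f ` E" by (metis imageI snd_conv)
    hence "reachable (f ` V, (`) f ` E) (f x) (f y)" by (intro reachable_edge) simp
    thus ?case using step by (meson reachable_trans)
  qed simp
next
  assume "reachable (f ` V, (`) f ` E) (f u) (f v)"
  hence "\<exists>y\<in>V. f v = f y \<and> reachable (V, E) u y"
  proof (induction rule: reachable_induct)
    case refl
    show ?case using assms by auto
  next
    case (step w z)
    then obtain y e where y: "y \<in> V" "w = f y" "reachable (V, E) u y" "e \<in> E" "{w, z} = f ` e" by auto
    obtain a b where ab: "e = {a, b}" "a \<in> V" "b \<in> V"
      using y(4) assms(2) complete_edgesE by (metis subsetD)
    have "f y = f a \<and> z = f b \<or> f y = f b \<and> z = f a"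
      using y ab by (auto simp: doubleton_eq_iff)
    hence "y = a \<and> z = f b \<or> y = b \<and> z = f a"
      using assms(1) y(1) ab by (auto dest: inj_onD)
    moreover have "reachable (V, E) a b" "reachable (V, E) b a"
      using y(4) ab by (auto intro!: reachable_edge simp: insert_commute)
    ultimately show ?case using y(3) ab reachable_trans by metis
  qed
  thus "reachable (V, E) u v" using assms by (auto dest: inj_onD)
qed

lemma components_map:
  assumes "inj_on f V" "E \<subseteq> complete_edges V"
  shows "components (f ` V, (`) f ` E) = (`) f ` components (V, E)"
proof -
  have "{w \<in> f ` V. reachable (f ` V, (`) f ` E) (f u) w} = f ` {v \<in> V. reachable (V, E) u v}"
    if "u \<in> V" for u
    using reachable_map[OF assms that] by auto
  thus ?thesis by (simp add: components_def image_image)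
qed

lemma connected_map:
  assumes "inj_on f V" "E \<subseteq> complete_edges V"
  shows "connected_graph (f ` V, (`) f ` E) \<longleftrightarrow> connected_graph (V, E)"
  using reachable_map[OF assms] by (simp add: connected_graph_def)

lemma bij_betw_subset_Collect:
  assumes "bij_betw f A B" "\<And>a. a \<in> A \<Longrightarrow> Q (f a) \<longleftrightarrow> P a"
  shows "bij_betw f {a. a \<in> A \<and> P a} {b. b \<in> B \<and> Q b}"
  unfolding bij_betw_def
proof
  show "inj_on f {a. a \<in> A \<and> P a}"
    using assms(1) by (auto simp: bij_betw_def intro: inj_on_subset)
  show "f ` {a. a \<in> A \<and> P a} = {b. b \<in> B \<and> Q b}"
    using assms by (auto simp: bij_betw_def)
qed

lemma sum_graphs_transfer:
  assumes "isomorphism_invariant \<phi>" "finite V" "finite W" "card V = card W"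
    and P: "isomorphism_invariant P"
  shows "(\<Sum>E | E \<in> Pow (complete_edges V) \<and> P (V, E). \<phi> (V, E))
    = (\<Sum>E | E \<in> Pow (complete_edges W) \<and> P (W, E). \<phi> (W, E))"
proof -
  obtain f where f: "bij_betw f V W" using assms finite_same_card_bij by blast
  have "bij_betw ((`) ((`) f)) (Pow (complete_edges V)) (Pow (complete_edges W))"
    using f by (intro bij_betw_Pow bij_betw_complete_edges)
  moreover have inv: "\<phi> (W, (`) f ` E) = \<phi> (V, E)" "P (W, (`) f ` E) = P (V, E)"
    if "E \<in> Pow (complete_edges V)" for E
    using that assms f unfolding isomorphism_invariant_def bij_betw_def by auto
  ultimately have "bij_betw ((`) ((`) f)) {E. E \<in> Pow (complete_edges V) \<and> P (V, E)}
      {E. E \<in> Pow (complete_edges W) \<and> P (W, E)}"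
    by (intro bij_betw_subset_Collect) auto
  from sum.reindex_bij_betw[OF this, of "\<lambda>E. \<phi> (W, E)"] show ?thesis
    by (simp add: inv)
qed

text \<open>The sum of \<open>\<phi>\<close> over the simple graphs on the vertices \<open>0, \<dots>, n - 1\<close> that satisfy \<open>P\<close>.\<close>

definition graph_sum :: "(nat graph \<Rightarrow> bool) \<Rightarrow> (nat graph \<Rightarrow> 'b :: comm_ring_1) \<Rightarrow> nat \<Rightarrow> 'b" where
  "graph_sum P \<phi> n
    = (\<Sum>E | E \<in> Pow (complete_edges {..<n}) \<and> P ({..<n}, E). \<phi> ({..<n}, E))"

lemma invariant_True: "isomorphism_invariant (\<lambda>_. True)"
  by (simp add: isomorphism_invariant_def)

lemma invariant_connected: "isomorphism_invariant connected_graph"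
  by (simp add: isomorphism_invariant_def connected_map)

lemma graph_sum_eq:
  assumes "isomorphism_invariant \<phi>" "isomorphism_invariant P" "finite V" 
  shows "(\<Sum>E | E \<in> Pow (complete_edges V) \<and> P (V, E). \<phi> (V, E)) = graph_sum P \<phi> (card V)"
  unfolding graph_sum_def by (rule sum_graphs_transfer) (use assms in auto)

text \<open>
  The exponential formula in recursive form: \<open>k\<close> is the size of the connected component of the
  vertex \<open>0\<close>, and the binomial coefficient counts the possible vertex sets of this component.
\<close>

lemma graph_sum_recurrence:
  fixes \<phi> :: "nat graph \<Rightarrow> 'b :: comm_ring_1"
  assumes mult: "multiplicative \<phi>" and inv: "isomorphism_invariant \<phi>" and "n > 0"
  shows "graph_sum (\<lambda>_. True) \<phi> n
    = (\<Sum>k=1..n. of_nat ((n - 1) choose (k - 1)) * graph_sum connected_graph \<phi> k * graph_sum (\<lambda>_. True) \<phi> (n - k))"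
proof -
  let ?f = "graph_sum (\<lambda>_. True) \<phi>" and ?g = "graph_sum connected_graph \<phi>" and ?V = "{..<n}"
  let ?S = "{B. B \<subseteq> ?V \<and> 0 \<in> B}"
  have "?f n = (\<Sum>E\<in>Pow (complete_edges ?V). \<phi> (?V, E))"
    by (simp add: graph_sum_def Pow_def)
  also have "\<dots> = (\<Sum>B\<in>?S. ?g (card B) * ?f (n - card B))"
  proof -
    have f: "(\<Sum>E\<in>Pow (complete_edges V). \<phi> (V, E)) = ?f (card V)" if "finite V" for V
      using graph_sum_eq[OF inv invariant_True that] by (simp add: Pow_def)
    have g: "(\<Sum>E | E \<in> Pow (complete_edges V) \<and> connected_graph (V, E). \<phi> (V, E)) = ?g (card V)"
      if "finite V" for V
      by (rule graph_sum_eq[OF inv invariant_connected that])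
    have "0 \<in> ?V" using \<open>n > 0\<close> by simp
    show ?thesis
      unfolding sum_graphs_split_component[OF finite_lessThan \<open>0 \<in> ?V\<close> mult]
    proof (rule sum.cong[OF refl])
      fix B assume "B \<in> ?S"
      hence B: "finite B" "card (?V - B) = n - card B"
        by (auto intro: finite_subset simp: card_Diff_subset finite_subset[of B ?V])
      show "(\<Sum>E | E \<in> Pow (complete_edges B) \<and> connected_graph (B, E). \<phi> (B, E))
          * (\<Sum>E\<in>Pow (complete_edges (?V - B)). \<phi> (?V - B, E)) = ?g (card B) * ?f (n - card B)"
        using f[of "?V - B"] g[OF B(1)] B by simp
    qed
  qed
  also have "\<dots> = (\<Sum>k=1..n. \<Sum>B | B \<in> ?S \<and> card B = k. ?g (card B) * ?f (n - card B))"
  proof (rule sum.group[symmetric])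
    show "card ` ?S \<subseteq> {1..n}"
    proof safe
      fix B assume B: "B \<subseteq> ?V" "0 \<in> B"
      hence "finite B" by (meson finite_lessThan finite_subset)
      moreover have "card B \<le> n" using card_mono[OF _ B(1)] by simp
      ultimately show "card B \<in> {1..n}" using B by (auto simp: Suc_le_eq card_gt_0_iff)
    qed
  qed auto
  also have "\<dots> = (\<Sum>k=1..n. of_nat ((n - 1) choose (k - 1)) * ?g k * ?f (n - k))"
  proof (rule sum.cong[OF refl])
    fix k assume k: "k \<in> {1..n}"
    have "card {B. B \<in> ?S \<and> card B = k} = card {B. B \<subseteq> {1..<n} \<and> card B = k - 1}"
    proof (rule bij_betw_same_card[of "\<lambda>B. B - {0}"])
      have ins: "card (insert 0 B) = k" "0 \<notin> B" if "B \<subseteq> {1..<n}" "card B = k - 1" for B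
      proof -
        show "0 \<notin> B" using that(1) by auto
        moreover have "finite B" using that(1) by (rule finite_subset) simp
        ultimately show "card (insert 0 B) = k" using that k by simp
      qed
      show "bij_betw (\<lambda>B. B - {0}) {B. B \<in> ?S \<and> card B = k} {B. B \<subseteq> {1..<n} \<and> card B = k - 1}"
        by (rule bij_betw_byWitness[of _ "insert 0"])
           (use k \<open>n > 0\<close> in \<open>auto simp: ins finite_subset[of _ "{..<n}"] Suc_le_eq\<close>)
    qed
    also have "\<dots> = (n - 1) choose (k - 1)" by (subst n_subsets) auto
    finally have "card {B. B \<in> ?S \<and> card B = k} = (n - 1) choose (k - 1)" .
    thus "(\<Sum>B | B \<in> ?S \<and> card B = k. ?g (card B) * ?f (n - card B))
        = of_nat ((n - 1) choose (k - 1)) * ?g k * ?f (n - k)" by (simp add: mult.assoc)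
  qed
  finally show ?thesis .
qed


section \<open>Sums over isomorphism classes\<close>

lemma graph_isomorphic_refl: "graph_isomorphic G G"
  unfolding graph_isomorphic_def by (rule exI[of _ id]) auto

lemma graph_isomorphic_sym:
  assumes "simple_graph G" "graph_isomorphic G H"
  shows "graph_isomorphic H G"
proof -
  obtain f where f: "bij_betw f (verts G) (verts H)" "(`) f ` edges G = edges H"
    using assms(2) by (auto simp: graph_isomorphic_def)
  have "inv_into (verts G) f ` f ` e = e" if "e \<in> edges G" for e
    using that assms(1) f(1) by (intro inv_into_image_cancel) (auto simp: simple_graph_def bij_betw_def)
  hence "(`) (inv_into (verts G) f) ` edges H = edges G"
    unfolding f(2)[symmetric] by (simp add: image_image)
  thus ?thesis using bij_betw_inv_into[OF f(1)] unfolding graph_isomorphic_def by blast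
qed

lemma graph_isomorphic_trans:
  assumes "graph_isomorphic G H" "graph_isomorphic H K"
  shows "graph_isomorphic G K"
proof -
  obtain f g where f: "bij_betw f (verts G) (verts H)" "(`) f ` edges G = edges H"
    and g: "bij_betw g (verts H) (verts K)" "(`) g ` edges H = edges K"
    using assms by (auto simp: graph_isomorphic_def)
  have "(`) (g \<circ> f) ` edges G = edges K"
    unfolding g(2)[symmetric] f(2)[symmetric] by (simp add: image_comp image_image)
  thus ?thesis using bij_betw_trans[OF f(1) g(1)] unfolding graph_isomorphic_def by blast
qed

lemma invariantD:
  assumes "isomorphism_invariant \<phi>" "simple_graph G" "graph_isomorphic G H"
  shows "\<phi> H = \<phi> G"
proof -
  obtain f where f: "bij_betw f (verts G) (verts H)" "(`) f ` edges G = edges H"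
    using assms(3) by (auto simp: graph_isomorphic_def)
  have "\<phi> (f ` verts G, (`) f ` edges G) = \<phi> (verts G, edges G)"
  proof (rule assms(1)[unfolded isomorphism_invariant_def, rule_format])
    show "inj_on f (verts G)" using f(1) by (simp add: bij_betw_def)
  qed (use assms(2) simple_graph_iff[of "verts G" "edges G"] in auto)
  moreover have "(f ` verts G, (`) f ` edges G) = H" using f by (simp add: bij_betw_def prod_eq_iff)
  ultimately show ?thesis by simp
qed

lemma finite_automorphisms: "finite (verts G) \<Longrightarrow> finite (automorphisms G)"
  unfolding automorphisms_def by (rule finite_subset[OF _ finite_permutations]) auto

text \<open>Conjugation by an isomorphism carries automorphisms to automorphisms.\<close>

lemma card_automorphisms_le:
  assumes "simple_graph G" "simple_graph H" "graph_isomorphic G H"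
  shows "card (automorphisms G) \<le> card (automorphisms H)"
proof -
  obtain f where f: "bij_betw f (verts G) (verts H)" "(`) f ` edges G = edges H"
    using assms(3) by (auto simp: graph_isomorphic_def)
  define conj where
    "conj = (\<lambda>p x. if x \<in> verts H then f (p (inv_into (verts G) f x)) else x)"
  have conj_f: "conj p (f v) = f (p v)" if "v \<in> verts G" for p v
    using that f(1) by (auto simp: conj_def bij_betw_def)
  show ?thesis
  proof (rule card_inj_on_le)
    show "inj_on conj (automorphisms G)"
    proof (rule inj_onI, rule ext)
      fix p q v assume pq: "p \<in> automorphisms G" "q \<in> automorphisms G" "conj p = conj q"
      hence perm: "p permutes verts G" "q permutes verts G" by (auto simp: automorphisms_def)
      show "p v = q v"
      proof (cases "v \<in> verts G")
        case True
        hence "f (p v) = f (q v)" using conj_f[OF True] pq(3) by metis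
        moreover have "p v \<in> verts G" "q v \<in> verts G" using perm True by (simp_all add: permutes_in_image)
        ultimately show ?thesis using f(1) by (auto simp: bij_betw_def dest: inj_onD)
      next
        case False
        thus ?thesis using perm by (simp add: permutes_def)
      qed
    qed
    show "conj ` automorphisms G \<subseteq> automorphisms H"
    proof safe
      fix p assume p: "p \<in> automorphisms G"
      have "conj p permutes verts H"
        unfolding conj_def using p f(1) by (intro permutes_bij_inv_into) (auto simp: automorphisms_def)
      moreover have "conj p ` f ` e = f ` p ` e" if "e \<in> edges G" for e
      proof -
        have "e \<subseteq> verts G" using that assms(1) by (simp add: simple_graph_def)
        thus ?thesis using conj_f unfolding image_image by (intro image_cong) auto
      qed
      hence "(`) (conj p) ` (`) f ` edges G = (`) f ` (`) p ` edges G"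
        unfolding image_image[of "(`) _"] by (intro image_cong) auto
      moreover have "(`) p ` edges G = edges G" using p by (simp add: automorphisms_def)
      ultimately show "conj p \<in> automorphisms H" using f(2) by (simp add: automorphisms_def)
    qed
    show "finite (automorphisms H)" using assms(2) by (simp add: simple_graph_def finite_automorphisms)
  qed
qed

lemma card_automorphisms_eq:
  assumes "simple_graph G" "simple_graph H" "graph_isomorphic G H"
  shows "card (automorphisms G) = card (automorphisms H)"
  using card_automorphisms_le[OF assms]
    card_automorphisms_le[OF assms(2,1) graph_isomorphic_sym[OF assms(1,3)]] by simp

lemma graph_isomorphic_same_verts_iff:
  "graph_isomorphic (V, E) (V, F) \<longleftrightarrow> (\<exists>p. p permutes V \<and> (`) p ` E = F)" if "E \<subseteq> complete_edges V"
proof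
  assume "graph_isomorphic (V, E) (V, F)"
  then obtain f where f: "bij_betw f V V" "(`) f ` E = F" by (auto simp: graph_isomorphic_def)
  define p where "p = (\<lambda>x. if x \<in> V then f x else x)"
  have "bij_betw p V V" using f(1) by (simp add: p_def cong: bij_betw_cong)
  hence "p permutes V" by (rule bij_imp_permutes) (simp add: p_def)
  moreover have "p ` e = f ` e" if "e \<in> E" for e
    using that \<open>E \<subseteq> complete_edges V\<close> by (intro image_cong) (auto simp: p_def complete_edges_def)
  ultimately show "\<exists>p. p permutes V \<and> (`) p ` E = F" using f(2) by (auto intro!: exI[of _ p])
next
  assume "\<exists>p. p permutes V \<and> (`) p ` E = F"
  thus "graph_isomorphic (V, E) (V, F)"
    unfolding graph_isomorphic_def using permutes_imp_bij by auto
qed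

text \<open>The orbit-stabilizer theorem for the action of the permutations of \<open>V\<close> on the graphs on \<open>V\<close>.\<close>

lemma card_isomorphic_copies:
  assumes "finite V" "E \<subseteq> complete_edges V"
  shows "card {F. graph_isomorphic (V, E) (V, F)} * card (automorphisms (V, E)) = fact (card V)"
proof -
  let ?perms = "{p. p permutes V}" and ?act = "\<lambda>p. (`) p ` E"
  have fin: "finite ?perms" using assms(1) by (rule finite_permutations)
  have fibre: "card {p \<in> ?perms. ?act p = F} = card (automorphisms (V, E))" if F: "F \<in> ?act ` ?perms" for F
  proof -
    obtain q where q: "q permutes V" "F = ?act q" using F by blast
    have "{p \<in> ?perms. ?act p = F} = (\<circ>) q ` automorphisms (V, E)"
    proof (intro equalityI subsetI)
      fix p assume "p \<in> {p \<in> ?perms. ?act p = F}"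
      hence p: "p permutes V" "?act p = F" by auto
      have "?act (inv_into UNIV q \<circ> p) = (`) (inv_into UNIV q) ` ?act p" by (simp add: image_image image_comp)
      also have "\<dots> = ?act (inv_into UNIV q \<circ> q)" by (simp add: p(2) q(2) image_image image_comp)
      also have "\<dots> = E" using q(1) by (simp add: permutes_inv_o)
      finally have "inv_into UNIV q \<circ> p \<in> automorphisms (V, E)"
        using p(1) q(1) by (simp add: automorphisms_def permutes_compose permutes_inv)
      moreover have "p = q \<circ> (inv_into UNIV q \<circ> p)"
        using q(1) by (simp add: comp_assoc[symmetric] permutes_inv_o)
      ultimately show "p \<in> (\<circ>) q ` automorphisms (V, E)" by blast
    next
      fix p assume "p \<in> (\<circ>) q ` automorphisms (V, E)"
      then obtain s where s: "p = q \<circ> s" "s permutes V" "?act s = E" by (auto simp: automorphisms_def)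
      have "?act p = (`) q ` ?act s" unfolding s(1) by (simp add: image_image image_comp)
      thus "p \<in> {p \<in> ?perms. ?act p = F}" using s q by (simp add: permutes_compose)
    qed
    moreover have "inj ((\<circ>) q)" using permutes_inj[OF q(1)] by (auto simp: inj_def fun_eq_iff)
    ultimately show ?thesis by (metis card_image inj_on_subset subset_UNIV)
  qed
  have "fact (card V) = card ?perms" using assms(1) by (simp add: card_permutations)
  also have "\<dots> = (\<Sum>F\<in>?act ` ?perms. card {p \<in> ?perms. ?act p = F})"
    using sum.image_gen[OF fin, of "\<lambda>_. 1 :: nat" ?act] by simp
  also have "\<dots> = (\<Sum>F\<in>?act ` ?perms. card (automorphisms (V, E)))"
    by (rule sum.cong[OF refl fibre])
  also have "\<dots> = card (?act ` ?perms) * card (automorphisms (V, E))"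
    by simp
  also have "?act ` ?perms = {F. graph_isomorphic (V, E) (V, F)}"
    using graph_isomorphic_same_verts_iff[OF assms(2)] by auto
  finally show ?thesis by simp
qed

lemma complete_edges_map:
  "inj_on f V \<Longrightarrow> E \<subseteq> complete_edges V \<Longrightarrow> (`) f ` E \<subseteq> complete_edges (f ` V)"
  using bij_betw_complete_edges[of f V "f ` V"] by (auto simp: bij_betw_def)

text \<open>
  Among the graphs on \<open>{..<n}\<close>, an isomorphism class of graphs with \<open>n\<close> vertices has \<open>n!\<close> divided by
  the order of the automorphism group many members. Homogeneity ensures that only the classes with
  \<open>n\<close> vertices contribute to the coefficients of weighted degree \<open>n\<close>.
\<close>

lemma class_sum_eq_graded:
  assumes inv: "isomorphism_invariant \<Phi>" and invP: "isomorphism_invariant P"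
    and hom: "\<And>V E. finite V \<Longrightarrow> E \<subseteq> complete_edges V \<Longrightarrow> mser_homogeneous (card V) (\<Phi> (V, E))"
  shows "class_sum P \<Phi> = mser_graded (\<lambda>n. mser_const (1 / fact n) * graph_sum P \<Phi> n)"
  unfolding mser_eq_iff
proof
  fix m :: "nat multiset"
  define n where "n = sum_mset m"
  define R where "R = {(G :: nat graph, H :: nat graph). simple_graph G \<and> simple_graph H \<and> graph_isomorphic G H}"
  define I where "I = {C \<in> graph_classes. \<forall>G\<in>C. P G}"
  define F where "F = (\<lambda>C. let G = (SOME G. G \<in> C)
    in mser_const (1 / of_nat (card (automorphisms G))) * \<Phi> G)"
  \<comment> \<open>\<open>S\<close> consists of the edge sets of the labelled graphs that contribute to the monomial \<open>m\<close>.\<close>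
  define S where "S = {E. E \<in> Pow (complete_edges {..<n}) \<and> P ({..<n}, E)}"
  define cls where "cls = (\<lambda>E. R `` {({..<n}, E)})"
  have gc: "graph_classes = {G. simple_graph G} // R" by (simp add: graph_classes_def R_def)
  have equiv: "equiv {G. simple_graph G} R"
  proof (rule equivI)
    show "R \<subseteq> {G. simple_graph G} \<times> {G. simple_graph G}" by (auto simp: R_def)
    show "refl_on {G. simple_graph G} R" by (auto simp: refl_on_def R_def graph_isomorphic_refl)
    show "sym R" by (auto simp: sym_def R_def intro: graph_isomorphic_sym)
    show "trans R" by (auto simp: trans_def R_def intro: graph_isomorphic_trans)
  qed
  have finS: "finite S" unfolding S_def by (rule finite_subset[of _ "Pow (complete_edges {..<n})"]) auto
  have simpS: "simple_graph ({..<n}, E)" if "E \<in> S" for E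
    using that by (auto simp: S_def simple_graph_iff)
  have rep: "(SOME G. G \<in> C) \<in> C" if "C \<in> graph_classes" for C
    using that equiv unfolding gc by (metis in_quotient_imp_non_empty some_in_eq)
  have cls_I: "cls E \<in> I" if "E \<in> S" for E
  proof -
    have "cls E \<in> graph_classes"
      unfolding gc cls_def using simpS[OF that] by (intro quotientI) simp
    moreover have "P G" if G: "G \<in> cls E" for G
      using invariantD[OF invP, of "({..<n}, E)" G] G that \<open>E \<in> S\<close> by (auto simp: cls_def R_def S_def)
    ultimately show ?thesis by (simp add: I_def)
  qed
  have vanish: "mser_nth (F C) m = 0" if C: "C \<in> I - cls ` S" for C
  proof (rule ccontr)
    define G where "G = (SOME G. G \<in> C)"
    have CI: "C \<in> graph_classes" "\<forall>G\<in>C. P G" using C by (auto simp: I_def)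
    have "G \<in> C" unfolding G_def by (rule rep) fact
    hence G: "simple_graph G" "P G" using CI equiv unfolding gc by (auto dest: in_quotient_imp_subset)
    hence G': "finite (verts G)" "edges G \<subseteq> complete_edges (verts G)"
      using simple_graph_iff[of "verts G" "edges G"] by auto
    assume "mser_nth (F C) m \<noteq> 0"
    hence "mser_nth (\<Phi> (verts G, edges G)) m \<noteq> 0" by (auto simp: F_def Let_def G_def)
    hence "card (verts G) = n" using hom[OF G'] by (auto simp: n_def mser_homogeneous_def)
    then obtain f where f: "bij_betw f (verts G) {..<n}"
      using G'(1) finite_same_card_bij[of "verts G" "{..<n}"] by auto
    define E where "E = (`) f ` edges G"
    have iso: "graph_isomorphic G ({..<n}, E)"
      unfolding graph_isomorphic_def E_def using f by auto
    have E: "E \<subseteq> complete_edges {..<n}"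
      using complete_edges_map[of f "verts G" "edges G"] f G' by (simp add: E_def bij_betw_def)
    have "P ({..<n}, E)" using invariantD[OF invP G(1) iso] G(2) by simp
    hence "E \<in> S" using E by (simp add: S_def)
    have "(G, ({..<n}, E)) \<in> R" using iso G(1) E by (simp add: R_def simple_graph_iff)
    hence "({..<n}, E) \<in> C"
      by (rule in_quotient_imp_closed[OF equiv CI(1)[unfolded gc] \<open>G \<in> C\<close>])
    moreover have refl: "(({..<n}, E), ({..<n}, E)) \<in> R"
      using E by (simp add: R_def simple_graph_iff graph_isomorphic_refl)
    hence "({..<n}, E) \<in> cls E" by (simp add: cls_def)
    moreover have "cls E \<in> {G. simple_graph G} // R"
      using cls_I[OF \<open>E \<in> S\<close>] by (simp add: I_def gc)
    ultimately have "cls E = C"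
      using quotient_eq_iff[OF equiv _ CI(1)[unfolded gc]] refl by blast
    thus False using C \<open>E \<in> S\<close> by auto
  qed
  have "mser_nth (class_sum P \<Phi>) m = mser_nth (mser_Sum I F) m"
    by (simp add: class_sum_def I_def F_def)
  also have "\<dots> = (\<Sum>C\<in>cls ` S. mser_nth (F C) m)"
    by (rule mser_nth_Sum_finite) (use finS cls_I vanish in auto)
  also have "\<dots> = (\<Sum>C\<in>cls ` S. \<Sum>E | E \<in> S \<and> cls E = C. 1 / fact n * mser_nth (\<Phi> ({..<n}, E)) m)"
  proof (rule sum.cong[OF refl])
    fix C assume "C \<in> cls ` S"
    then obtain E where E: "E \<in> S" "C = cls E" by blast
    define G where "G = (SOME G. G \<in> C)"
    have "G \<in> C" unfolding G_def using cls_I E by (intro rep) (auto simp: I_def)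
    hence G: "simple_graph G" "graph_isomorphic ({..<n}, E) G" by (auto simp: E cls_def R_def)
    have aut: "card (automorphisms G) = card (automorphisms ({..<n}, E))"
      using card_automorphisms_eq[OF simpS[OF E(1)] G] by simp
    have \<Phi>G: "\<Phi> G = \<Phi> ({..<n}, E)" using invariantD[OF inv simpS[OF E(1)] G(2)] .
    have EK: "E \<subseteq> complete_edges {..<n}" using E by (simp add: S_def)
    have same: "cls E' = C \<longleftrightarrow> graph_isomorphic ({..<n}, E) ({..<n}, E')" if "E' \<in> S" for E'
      unfolding E(2) cls_def using eq_equiv_class_iff[OF equiv, of "({..<n}, E')" "({..<n}, E)"]
        simpS[OF that] simpS[OF E(1)] by (auto simp: R_def intro: graph_isomorphic_sym)
    have "{E'. E' \<in> S \<and> cls E' = C} = {E'. graph_isomorphic ({..<n}, E) ({..<n}, E')}"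
    proof (intro equalityI subsetI)
      fix E' assume "E' \<in> {E'. graph_isomorphic ({..<n}, E) ({..<n}, E')}"
      hence iso: "graph_isomorphic ({..<n}, E) ({..<n}, E')" by simp
      then obtain p where p: "p permutes {..<n}" "(`) p ` E = E'"
        using graph_isomorphic_same_verts_iff[OF EK] by auto
      have "E' \<subseteq> complete_edges {..<n}"
        using complete_edges_map[of p "{..<n}" E] EK p by (simp add: permutes_inj_on permutes_image)
      moreover have "P ({..<n}, E')"
        using invariantD[OF invP simpS[OF E(1)] iso] E(1) by (simp add: S_def)
      ultimately have "E' \<in> S" by (simp add: S_def)
      thus "E' \<in> {E'. E' \<in> S \<and> cls E' = C}" using same iso by simp
    qed (use same in auto)
    hence copies: "card {E'. E' \<in> S \<and> cls E' = C} * card (automorphisms G) = fact n"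
      using card_isomorphic_copies[OF _ EK] by (simp add: aut)
    have "(\<Sum>E' | E' \<in> S \<and> cls E' = C. 1 / fact n * mser_nth (\<Phi> ({..<n}, E')) m)
        = (\<Sum>E' | E' \<in> S \<and> cls E' = C. 1 / fact n * mser_nth (\<Phi> G) m)"
    proof (rule sum.cong[OF refl])
      fix E' assume E': "E' \<in> {E'. E' \<in> S \<and> cls E' = C}"
      hence "graph_isomorphic ({..<n}, E) ({..<n}, E')" using same by blast
      thus "1 / fact n * mser_nth (\<Phi> ({..<n}, E')) m = 1 / fact n * mser_nth (\<Phi> G) m"
        using invariantD[OF inv simpS[OF E(1)]] by (simp add: \<Phi>G)
    qed
    also have "\<dots> = of_nat (card {E'. E' \<in> S \<and> cls E' = C}) * (1 / fact n) * mser_nth (\<Phi> G) m"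
      by simp
    also have "of_nat (card {E'. E' \<in> S \<and> cls E' = C}) * (1 / fact n :: complex)
        = 1 / of_nat (card (automorphisms G))"
    proof -
      have "of_nat (card {E'. E' \<in> S \<and> cls E' = C}) * of_nat (card (automorphisms G)) = (fact n :: complex)"
        unfolding of_nat_mult[symmetric] copies by simp
      moreover have "card (automorphisms G) \<noteq> 0"
      proof
        assume "card (automorphisms G) = 0"
        thus False using copies by simp
      qed
      ultimately show ?thesis by (simp add: field_simps)
    qed
    finally show "mser_nth (F C) m
        = (\<Sum>E' | E' \<in> S \<and> cls E' = C. 1 / fact n * mser_nth (\<Phi> ({..<n}, E')) m)"
      by (simp add: F_def Let_def G_def)
  qed
  also have "\<dots> = (\<Sum>E\<in>S. 1 / fact n * mser_nth (\<Phi> ({..<n}, E)) m)"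
    by (rule sum.image_gen[symmetric]) fact
  also have "\<dots> = mser_nth (mser_graded (\<lambda>n. mser_const (1 / fact n) * graph_sum P \<Phi> n)) m"
    by (simp add: mser_graded.rep_eq graph_sum_def mser_nth_sum sum_distrib_left S_def flip: n_def)
  finally show "mser_nth (class_sum P \<Phi>) m
      = mser_nth (mser_graded (\<lambda>n. mser_const (1 / fact n) * graph_sum P \<Phi> n)) m" .
qed


section \<open>Cayley's formula\<close>

text \<open>The edge sets of the forests on \<open>V\<close> with \<open>j\<close> edges.\<close>

definition forests :: "'a set \<Rightarrow> nat \<Rightarrow> 'a set set set" where
  "forests V j = {F. F \<subseteq> complete_edges V \<and> acyclic_graph (V, F) \<and> card F = j}"

text \<open>The number of ways to choose a root in every connected component.\<close>

definition rootings :: "'a set \<Rightarrow> 'a set set \<Rightarrow> real" where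
  "rootings V F = (\<Prod>T\<in>components (V, F). real (card T))"

lemma finite_forests [simp]: "finite V \<Longrightarrow> finite (forests V j)"
  by (rule finite_subset[of _ "Pow (complete_edges V)"]) (auto simp: forests_def)

lemma sum_ordered_pairs:
  fixes g :: "'a set \<Rightarrow> real"
  assumes "finite V"
  shows "(\<Sum>(u, v) | u \<in> V \<and> v \<in> V \<and> u \<noteq> v \<and> Q {u, v}. g {u, v}) = 2 * (\<Sum>e | e \<in> complete_edges V \<and> Q e. g e)"
proof -
  let ?S = "{(u, v). u \<in> V \<and> v \<in> V \<and> u \<noteq> v \<and> Q {u, v}}" and ?T = "{e. e \<in> complete_edges V \<and> Q e}"
  let ?f = "\<lambda>(u, v). {u, v}"
  have "finite ?S" by (rule finite_subset[of _ "V \<times> V"]) (use assms in auto)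
  hence "sum (\<lambda>p. g (?f p)) ?S = (\<Sum>e\<in>?T. \<Sum>p | p \<in> ?S \<and> ?f p = e. g (?f p))"
    by (intro sum.group[symmetric]) (use assms in \<open>auto simp: complete_edges_def\<close>)
  also have "\<dots> = (\<Sum>e\<in>?T. 2 * g e)"
  proof (rule sum.cong[OF refl])
    fix e assume e: "e \<in> ?T"
    then obtain u v where uv: "e = {u, v}" "u \<noteq> v" "u \<in> V" "v \<in> V" by (auto elim: complete_edgesE)
    have "{p. p \<in> ?S \<and> ?f p = e} = {(u, v), (v, u)}"
      using uv e by (auto simp: doubleton_eq_iff insert_commute)
    thus "(\<Sum>p | p \<in> ?S \<and> ?f p = e. g (?f p)) = 2 * g e" using uv by (simp add: insert_commute)
  qed
  finally show ?thesis by (simp add: sum_distrib_left case_prod_unfold)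
qed

lemma sum_inverse_component_size:
  assumes "finite V"
  shows "(\<Sum>u\<in>V. 1 / real (card {w \<in> V. reachable (V, E) u w})) = real (card (components (V, E)))"
proof -
  let ?C = "\<lambda>u. {w \<in> V. reachable (V, E) u w}"
  have "(\<Sum>u\<in>V. 1 / real (card (?C u)))
      = (\<Sum>T\<in>?C ` V. \<Sum>u | u \<in> V \<and> ?C u = T. 1 / real (card (?C u)))"
    using assms by (rule sum.image_gen)
  also have "\<dots> = (\<Sum>T\<in>?C ` V. 1)"
  proof (rule sum.cong[OF refl])
    fix T assume "T \<in> ?C ` V"
    hence T: "T \<in> components (V, E)" by (simp add: components_def)
    have "{u. u \<in> V \<and> ?C u = T} = T"
    proof (intro equalityI subsetI)
      fix u assume "u \<in> {u. u \<in> V \<and> ?C u = T}"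
      thus "u \<in> T" using reachable_refl[of "(V, E)" u] by auto
    next
      fix u assume "u \<in> T"
      thus "u \<in> {u. u \<in> V \<and> ?C u = T}"
        using component_eqI[OF T] component_subset[OF T] by auto
    qed
    hence "(\<Sum>u | u \<in> V \<and> ?C u = T. 1 / real (card (?C u))) = (\<Sum>u\<in>T. 1 / real (card T))"
      by (intro sum.cong) auto
    also have "\<dots> = 1" using component_card_pos[OF assms T] by simp
    finally show "(\<Sum>u | u \<in> V \<and> ?C u = T. 1 / real (card (?C u))) = 1" .
  qed
  finally show ?thesis by (simp add: components_def)
qed

text \<open>
  Joining two distinct components \<open>A\<close> and \<open>B\<close> by an edge replaces the factor \<open>|A| * |B|\<close> by
  \<open>|A| + |B|\<close>, which multiplies the number of rootings by \<open>1 / |A| + 1 / |B|\<close>.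
\<close>

lemma rootings_insert_edge:
  assumes "finite V" "u \<in> V" "v \<in> V" "\<not> reachable (V, F) u v"
  shows "rootings V (insert {u, v} F) = rootings V F *
    (1 / real (card {w \<in> V. reachable (V, F) u w}) + 1 / real (card {w \<in> V. reachable (V, F) v w}))"
proof -
  let ?A = "{w \<in> V. reachable (V, F) u w}" and ?B = "{w \<in> V. reachable (V, F) v w}"
  have pos: "card ?A > 0" "card ?B > 0"
    using assms by (auto intro!: component_card_pos componentsI)
  have "card (?A \<union> ?B) = card ?A + card ?B"
    using assms(1) prod_components_insert_edge(2)[OF assms] by (intro card_Un_disjoint) auto
  hence "rootings V (insert {u, v} F) * (real (card ?A) * real (card ?B))
      = rootings V F * (real (card ?A) + real (card ?B))"
    using prod_components_insert_edge(1)[OF assms, of "\<lambda>T. real (card T)"]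
    by (simp add: rootings_def)
  hence "rootings V (insert {u, v} F)
      = rootings V F * (real (card ?A) + real (card ?B)) / (real (card ?A) * real (card ?B))"
    using pos by (subst eq_divide_eq) auto
  also have "\<dots> = rootings V F * (1 / real (card ?A) + 1 / real (card ?B))"
    using pos by (simp add: field_simps)
  finally show ?thesis .
qed

text \<open>
  Summed over the ordered pairs of vertices in distinct components, the factors of the preceding lemma
  give \<open>2 * n * (k - 1)\<close> for \<open>n\<close> vertices and \<open>k = n - j\<close> trees, because \<open>1 / |C(u)|\<close> summed over all
  vertices \<open>u\<close> yields the number of trees.
\<close>

lemma sum_rootings_insert_edge:
  assumes "finite V" "F \<in> forests V j"
  shows "(\<Sum>e | e \<in> complete_edges V \<and> e \<notin> F \<and> acyclic_graph (V, insert e F). rootings V (insert e F))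
    = real (card V) * (real (card V) - real (Suc j)) * rootings V F"
proof -
  let ?C = "\<lambda>u. {w \<in> V. reachable (V, F) u w}" and ?n = "real (card V)"
  let ?P = "{(u, v). u \<in> V \<and> v \<in> V \<and> \<not> reachable (V, F) u v}"
  have F: "F \<subseteq> complete_edges V" "acyclic_graph (V, F)" "card F = j"
    using assms(2) by (auto simp: forests_def)
  have k: "real (card (components (V, F))) = ?n - real j"
    using card_verts_le[OF assms(1) F(1)] F by simp
  have pairs: "?P = {(u, v). u \<in> V \<and> v \<in> V \<and> u \<noteq> v \<and> {u, v} \<notin> F \<and> acyclic_graph (V, insert {u, v} F)}"
  proof -
    have "\<not> reachable (V, F) u v \<longleftrightarrow> u \<noteq> v \<and> {u, v} \<notin> F \<and> acyclic_graph (V, insert {u, v} F)" for u v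
    proof (cases "u = v \<or> {u, v} \<in> F")
      case True
      thus ?thesis by (auto simp: reachable_edge)
    next
      case False
      thus ?thesis using acyclic_insert_edge[of u v F V] F by simp
    qed
    thus ?thesis by simp
  qed
  have half: "(\<Sum>(u, v)\<in>?P. 1 / real (card (?C u))) = ?n * (?n - real (Suc j))"
  proof -
    have "?P = (SIGMA u:V. {v \<in> V. \<not> reachable (V, F) u v})" by auto
    hence "(\<Sum>(u, v)\<in>?P. 1 / real (card (?C u))) = (\<Sum>u\<in>V. \<Sum>v\<in>{v \<in> V. \<not> reachable (V, F) u v}. 1 / real (card (?C u)))"
      using assms(1) by (simp only:) (rule sum.Sigma[symmetric], auto)
    also have "\<dots> = (\<Sum>u\<in>V. ?n * (1 / real (card (?C u))) - 1)"
    proof (rule sum.cong[OF refl])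
      fix u assume u: "u \<in> V"
      have "{v \<in> V. \<not> reachable (V, F) u v} = V - ?C u" by auto
      hence "real (card {v \<in> V. \<not> reachable (V, F) u v}) = ?n - real (card (?C u))"
        using assms(1) by (simp add: card_Diff_subset of_nat_diff card_mono)
      moreover have "card (?C u) > 0" by (rule component_card_pos[OF assms(1) componentsI[OF u]])
      ultimately show "(\<Sum>v\<in>{v \<in> V. \<not> reachable (V, F) u v}. 1 / real (card (?C u))) = ?n * (1 / real (card (?C u))) - 1"
        by (simp add: field_simps)
    qed
    also have "\<dots> = ?n * (\<Sum>u\<in>V. 1 / real (card (?C u))) - ?n"
      by (simp only: sum_subtractf sum_distrib_left) simp
    also have "\<dots> = ?n * (?n - real (Suc j))"
      unfolding sum_inverse_component_size[OF assms(1)] k by (simp add: algebra_simps)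
    finally show ?thesis .
  qed
  have swap: "(\<Sum>(u, v)\<in>?P. 1 / real (card (?C v))) = (\<Sum>(u, v)\<in>?P. 1 / real (card (?C u)))"
    by (rule sum.reindex_bij_witness[of _ prod.swap prod.swap]) (auto dest: reachable_sym)
  have "2 * (\<Sum>e | e \<in> complete_edges V \<and> e \<notin> F \<and> acyclic_graph (V, insert e F). rootings V (insert e F))
      = (\<Sum>(u, v)\<in>?P. rootings V (insert {u, v} F))"
    unfolding pairs by (rule sum_ordered_pairs[OF assms(1), symmetric])
  also have "\<dots> = (\<Sum>(u, v)\<in>?P. rootings V F * (1 / real (card (?C u)) + 1 / real (card (?C v))))"
    using assms(1) by (intro sum.cong refl) (auto simp: rootings_insert_edge)
  also have "\<dots> = rootings V F * ((\<Sum>(u, v)\<in>?P. 1 / real (card (?C u))) + (\<Sum>(u, v)\<in>?P. 1 / real (card (?C v))))"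
    by (simp only: sum_distrib_left sum.distrib[symmetric] case_prod_unfold)
  also have "\<dots> = 2 * (?n * (?n - real (Suc j)) * rootings V F)"
    unfolding swap half by simp
  finally show ?thesis by simp
qed

text \<open>
  Double counting, as in Pitman's proof of Cayley's formula: in a forest with \<open>j + 1\<close> edges and a root
  in every component, distinguish one edge, and then delete it.
\<close>

lemma sum_rootings_Suc:
  assumes "finite V"
  shows "real (Suc j) * (\<Sum>F\<in>forests V (Suc j). rootings V F)
    = real (card V) * (real (card V) - real (Suc j)) * (\<Sum>F\<in>forests V j. rootings V F)"
proof -
  let ?N = "\<lambda>F. {e. e \<in> complete_edges V \<and> e \<notin> F \<and> acyclic_graph (V, insert e F)}"
  have fin: "finite F" if "F \<in> forests V i" for F i
    using that assms by (auto simp: forests_def intro: finite_subset[of _ "complete_edges V"])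
  have "real (Suc j) * (\<Sum>F\<in>forests V (Suc j). rootings V F)
      = (\<Sum>F\<in>forests V (Suc j). \<Sum>e\<in>F. rootings V F)"
    unfolding sum_distrib_left by (rule sum.cong) (auto simp: forests_def)
  also have "\<dots> = (\<Sum>(F, e)\<in>(SIGMA F:forests V (Suc j). F). rootings V F)"
    using assms fin by (subst sum.Sigma) auto
  also have "\<dots> = (\<Sum>(F, e)\<in>(SIGMA F:forests V j. ?N F). rootings V (insert e F))"
  proof (rule sum.reindex_bij_witness[where i = "\<lambda>(F, e). (insert e F, e)" and j = "\<lambda>(F, e). (F - {e}, e)"])
    fix p assume "p \<in> (SIGMA F:forests V (Suc j). F)"
    then obtain F e where p: "p = (F, e)" "F \<in> forests V (Suc j)" "e \<in> F" by auto
    have ins: "insert e (F - {e}) = F" using p by auto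
    have F: "F \<subseteq> complete_edges V" "acyclic_graph (V, F)" "card F = Suc j"
      using p by (auto simp: forests_def)
    have "acyclic_graph (V, F - {e})"
      using F(2) by (auto simp: acyclic_graph_def is_cycle_def)
    hence "F - {e} \<in> forests V j" using F p fin[OF p(2)] by (auto simp: forests_def)
    thus "(\<lambda>(F, e). (F - {e}, e)) p \<in> (SIGMA F:forests V j. ?N F)"
      using p F by (auto simp: insert_absorb)
    show "(\<lambda>(F, e). (insert e F, e)) ((\<lambda>(F, e). (F - {e}, e)) p) = p" using p ins by simp
    show "(case (\<lambda>(F, e). (F - {e}, e)) p of (F, e) \<Rightarrow> rootings V (insert e F)) = (case p of (F, e) \<Rightarrow> rootings V F)"
      using p ins by simp
  next
    fix p assume "p \<in> (SIGMA F:forests V j. ?N F)"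
    then obtain F e where p: "p = (F, e)" "F \<in> forests V j" "e \<in> ?N F" by auto
    show "(\<lambda>(F, e). (F - {e}, e)) ((\<lambda>(F, e). (insert e F, e)) p) = p" using p by auto
    show "(\<lambda>(F, e). (insert e F, e)) p \<in> (SIGMA F:forests V (Suc j). F)"
      using p fin[OF p(2)] by (auto simp: forests_def)
  qed
  also have "\<dots> = (\<Sum>F\<in>forests V j. \<Sum>e\<in>?N F. rootings V (insert e F))"
    using assms by (subst sum.Sigma) auto
  also have "\<dots> = real (card V) * (real (card V) - real (Suc j)) * (\<Sum>F\<in>forests V j. rootings V F)"
    unfolding sum_distrib_left
    by (rule sum.cong[OF refl]) (use sum_rootings_insert_edge[OF assms] in simp)
  finally show ?thesis .
qed

lemma sum_rootings_forests:
  assumes "finite V" "j < card V"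
  shows "(\<Sum>F\<in>forests V j. rootings V F) * fact j * fact (card V - 1 - j) = real (card V) ^ j * fact (card V - 1)"
  using assms(2)
proof (induction j)
  case 0
  have "acyclic_graph (V, {})" using card_verts_le[of V "{}"] assms(1)
    by (simp add: components_no_edges card_image)
  moreover have "F = {}" if "F \<in> forests V 0" for F
    using that finite_subset[OF _ finite_complete_edges[OF assms(1)]] by (auto simp: forests_def)
  ultimately have "forests V 0 = {{}}" by (auto simp: forests_def)
  moreover have "rootings V {} = 1"
    by (auto simp: rootings_def components_no_edges intro!: prod.neutral)
  ultimately show ?case by simp
next
  case (Suc j)
  define R where "R = (\<lambda>j. \<Sum>F\<in>forests V j. rootings V F)"
  define n where "n = card V"
  have n: "n - 1 - j = Suc (n - 1 - Suc j)" "real n - real (Suc j) = real (n - 1 - j)"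
    using Suc.prems by (auto simp: n_def of_nat_diff)
  have "R (Suc j) * fact (Suc j) * fact (n - 1 - Suc j) = (real (Suc j) * R (Suc j)) * fact j * fact (n - 1 - Suc j)"
    by (simp only: fact_Suc mult_ac)
  also have "real (Suc j) * R (Suc j) = real n * real (n - 1 - j) * R j"
    using sum_rootings_Suc[OF assms(1), of j] unfolding R_def n_def[symmetric] n(2) .
  also have "real n * real (n - 1 - j) * R j * fact j * fact (n - 1 - Suc j)
      = real n * (R j * fact j * fact (n - 1 - j))"
    by (simp only: n(1) fact_Suc mult_ac)
  also have "R j * fact j * fact (n - 1 - j) = real n ^ j * fact (n - 1)"
    using Suc by (simp add: R_def n_def)
  finally show ?case by (simp add: R_def n_def)
qed

text \<open>
  The number of trees on \<open>n\<close> labelled vertices is \<open>n ^ (n - 2)\<close>; the formula is stated for the trees with a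
  distinguished vertex, which avoids the exponent \<open>-1\<close> for \<open>n = 1\<close>.
\<close>

lemma cayley:
  assumes "finite V" "V \<noteq> {}"
  shows "card V * card {F. F \<subseteq> complete_edges V \<and> connected_graph (V, F) \<and> acyclic_graph (V, F)}
    = card V ^ (card V - 1)"
proof -
  let ?n = "card V"
  have n: "?n > 0" using assms by (simp add: card_gt_0_iff)
  have trees: "{F. F \<subseteq> complete_edges V \<and> connected_graph (V, F) \<and> acyclic_graph (V, F)} = forests V (?n - 1)"
  proof (intro equalityI subsetI)
    fix F assume "F \<in> {F. F \<subseteq> complete_edges V \<and> connected_graph (V, F) \<and> acyclic_graph (V, F)}"
    thus "F \<in> forests V (?n - 1)"
      using card_verts_le[OF assms(1), of F] components_connected[of V F] by (auto simp: forests_def)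
  next
    fix F assume F: "F \<in> forests V (?n - 1)"
    hence "card (components (V, F)) = 1" using card_verts_le[OF assms(1), of F] n by (auto simp: forests_def)
    thus "F \<in> {F. F \<subseteq> complete_edges V \<and> connected_graph (V, F) \<and> acyclic_graph (V, F)}"
      using F components_card_1_connected by (auto simp: forests_def)
  qed
  have "(\<Sum>F\<in>forests V (?n - 1). rootings V F) = (\<Sum>F\<in>forests V (?n - 1). real ?n)"
  proof (rule sum.cong[OF refl])
    fix F assume "F \<in> forests V (?n - 1)"
    hence "connected_graph (V, F)" unfolding trees[symmetric] by simp
    thus "rootings V F = real ?n" by (simp add: rootings_def components_connected)
  qed
  moreover have "(\<Sum>F\<in>forests V (?n - 1). rootings V F) = real ?n ^ (?n - 1)"
    using sum_rootings_forests[OF assms(1), of "?n - 1"] n by simp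
  ultimately have "real (?n * card (forests V (?n - 1))) = real (?n ^ (?n - 1))"
    by (simp add: mult.commute)
  thus ?thesis unfolding trees by (simp only: of_nat_eq_iff)
qed


section \<open>The weighted chromatic polynomial as a sum over edge sets\<close>

text \<open>
  The expansion of the weighted chromatic polynomial over the spanning subgraphs. The usual sign
  \<open>(-1) ^ (|F| - |V| + k(F))\<close> is the one given by the nullity.
\<close>

definition chromatic_expansion :: "'a graph \<Rightarrow> ('a \<Rightarrow> nat) \<Rightarrow> complex mser" where
  "chromatic_expansion G w = (\<Sum>F\<in>Pow (edges G). mser_const ((- 1) ^ nullity (verts G, F)) *
     (\<Prod>T\<in>components (verts G, F). mser_var (\<Sum>v\<in>T. w v)))"

text \<open>
  In an alternating sum of a function of the image \<open>f ` S\<close>, the members of a fibre of \<open>f\<close> behave like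
  a single element. This is why multiple edges may be merged after a contraction.
\<close>

lemma alternating_sum_image:
  fixes g :: "'b set \<Rightarrow> 'c :: comm_ring_1"
  assumes "finite X"
  shows "(\<Sum>S\<in>Pow X. (- 1) ^ card S * g (f ` S)) = (\<Sum>T\<in>Pow (f ` X). (- 1) ^ card T * g T)"
  using assms
proof (induction X arbitrary: g rule: finite_induct)
  case (insert x X)
  have Pow_insert_sum: "(\<Sum>S\<in>Pow (insert y Y). (- 1) ^ card S * h S)
      = (\<Sum>S\<in>Pow Y. (- 1) ^ card S * (h S - h (insert y S)))"
    if "finite Y" "y \<notin> Y" for y :: 'd and Y and h :: "'d set \<Rightarrow> 'c"
  proof -
    have "(\<Sum>S\<in>Pow (insert y Y). (- 1) ^ card S * h S)
        = (\<Sum>S\<in>Pow Y. (- 1) ^ card S * h S) + (\<Sum>S\<in>insert y ` Pow Y. (- 1) ^ card S * h S)"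
      unfolding Pow_insert using that by (intro sum.union_disjoint) auto
    also have "(\<Sum>S\<in>insert y ` Pow Y. (- 1) ^ card S * h S)
        = (\<Sum>S\<in>Pow Y. (- 1) ^ card (insert y S) * h (insert y S))"
      using that by (subst sum.reindex) (auto simp: inj_on_def)
    also have "\<dots> = (\<Sum>S\<in>Pow Y. - ((- 1) ^ card S * h (insert y S)))"
      using that by (intro sum.cong refl) (auto simp: card_insert_if finite_subset)
    finally show ?thesis by (simp add: sum_negf algebra_simps sum.distrib sum_subtractf)
  qed
  let ?h = "\<lambda>T. g T - g (insert (f x) T)"
  have "(\<Sum>S\<in>Pow (insert x X). (- 1) ^ card S * g (f ` S))
      = (\<Sum>S\<in>Pow X. (- 1) ^ card S * ?h (f ` S))"
    using Pow_insert_sum[OF insert.hyps, of "\<lambda>S. g (f ` S)"] by simp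
  also have "\<dots> = (\<Sum>T\<in>Pow (f ` X). (- 1) ^ card T * ?h T)"
    by (rule insert.IH)
  also have "\<dots> = (\<Sum>T\<in>Pow (f ` insert x X). (- 1) ^ card T * g T)"
  proof (cases "f x \<in> f ` X")
    case False
    thus ?thesis using Pow_insert_sum[of "f ` X" "f x" g] insert.hyps by simp
  next
    case True
    define Y where "Y = f ` X - {f x}"
    have Y: "f ` X = insert (f x) Y" "finite Y" "f x \<notin> Y" using True insert.hyps by (auto simp: Y_def)
    have "(\<Sum>T\<in>Pow (f ` X). (- 1) ^ card T * g (insert (f x) T))
        = (\<Sum>S\<in>Pow Y. (- 1) ^ card S * (g (insert (f x) S) - g (insert (f x) (insert (f x) S))))"
      unfolding Y(1) by (rule Pow_insert_sum) fact+
    also have "\<dots> = 0" by simp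
    finally have "(\<Sum>T\<in>Pow (f ` X). (- 1) ^ card T * ?h T) = (\<Sum>T\<in>Pow (f ` X). (- 1) ^ card T * g T)"
      by (simp add: algebra_simps sum_subtractf)
    thus ?thesis using True by (simp add: insert_absorb)
  qed
  finally show ?case .
qed simp

text \<open>The map \<open>c\<close> below contracts the edge \<open>{u, v}\<close> to the vertex \<open>u\<close>.\<close>

context
  fixes u v :: 'a and c :: "'a \<Rightarrow> 'a"
  assumes uv: "u \<noteq> v"
  defines "c \<equiv> (\<lambda>x. if x = v then u else x)"
begin

lemma contract_image_complete_edges:
  assumes "S \<subseteq> complete_edges V - {{u, v}}" "u \<in> V"
  shows "(`) c ` S \<subseteq> complete_edges (V - {v})"
proof safe
  fix e assume "e \<in> S"
  hence e: "e \<in> complete_edges V" "e \<noteq> {u, v}" using assms by auto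
  then obtain a b where ab: "e = {a, b}" "a \<noteq> b" "a \<in> V" "b \<in> V" by (elim complete_edgesE)
  have "c a \<noteq> c b" using ab e(2) by (auto simp: c_def insert_commute)
  hence "card (c ` e) = 2" using ab by simp
  moreover have "c x \<in> V - {v}" if "x \<in> V" for x using that uv assms(2) by (simp add: c_def)
  hence "c ` e \<subseteq> V - {v}" using ab by simp
  ultimately show "c ` e \<in> complete_edges (V - {v})" by (simp add: complete_edges_def)
qed

lemma reachable_contract:
  "reachable (V', (`) c ` S) (c x) (c y) \<longleftrightarrow> reachable (V, insert {u, v} S) x y" if S: "S \<subseteq> complete_edges V"
proof -
  let ?R = "reachable (V, insert {u, v} S)" and ?R' = "reachable (V', (`) c ` S)"
  have xc: "?R x (c x)" for x
    by (auto simp: c_def insert_commute intro!: reachable_edge)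
  show ?thesis
  proof
    assume "?R x y"
    thus "?R' (c x) (c y)"
    proof (induction rule: reachable_induct)
      case (step a b)
      have "?R' (c a) (c b)"
      proof (cases "{a, b} = {u, v}")
        case True
        hence "c a = c b" by (auto simp: c_def doubleton_eq_iff)
        thus ?thesis by simp
      next
        case False
        hence "c ` {a, b} \<in> (`) c ` S" using step by (intro imageI) simp
        thus ?thesis by (intro reachable_edge) simp
      qed
      thus ?case using step.IH by (meson reachable_trans)
    qed simp
  next
    assume "?R' (c x) (c y)"
    hence "?R (c x) (c y)"
    proof (induction rule: reachable_induct)
      case (step a b)
      then obtain e where e: "e \<in> S" "{a, b} = c ` e" by auto
      then obtain p q where pq: "e = {p, q}" using S complete_edgesE by (metis subsetD)
      have "?R p q" using e pq by (intro reachable_edge) simp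
      hence "?R (c p) (c q)" using xc by (meson reachable_sym reachable_trans)
      moreover have "a = c p \<and> b = c q \<or> a = c q \<and> b = c p"
        using e pq by (auto simp: doubleton_eq_iff)
      ultimately have "?R a b" by (auto intro: reachable_sym)
      thus ?case using step.IH by (meson reachable_trans)
    qed simp
    thus "?R x y" using xc by (meson reachable_sym reachable_trans)
  qed
qed

lemma components_contract:
  assumes "S \<subseteq> complete_edges V" "u \<in> V" "v \<in> V"
  shows "components (V - {v}, (`) c ` S) = (\<lambda>T. T - {v}) ` components (V, insert {u, v} S)"
    and "inj_on (\<lambda>T. T - {v}) (components (V, insert {u, v} S))"
    and "T \<in> components (V, insert {u, v} S) \<Longrightarrow> u \<in> T \<longleftrightarrow> v \<in> T"
proof -
  let ?R = "reachable (V, insert {u, v} S)" and ?R' = "reachable (V - {v}, (`) c ` S)"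
  let ?K = "components (V, insert {u, v} S)"
  have uvR: "?R u v" by (simp add: reachable_edge)
  have c_id: "c x = x" if "x \<noteq> v" for x using that by (simp add: c_def)
  have eq: "{y \<in> V - {v}. ?R' x y} = {y \<in> V. ?R x y} - {v}" if "x \<in> V - {v}" for x
  proof -
    have "?R' x y \<longleftrightarrow> ?R x y" if "y \<noteq> v" for y
      using reachable_contract[OF assms(1), of "V - {v}" x y] c_id[of x] c_id[OF that] \<open>x \<in> V - {v}\<close>
      by simp
    thus ?thesis by auto
  qed
  have "{y \<in> V. ?R v y} = {y \<in> V. ?R u y}"
    using component_eq_iff[OF assms(3,2), of "insert {u, v} S"] reachable_sym[OF uvR] by (rule iffD2)
  hence "?K = (\<lambda>x. {y \<in> V. ?R x y}) ` (V - {v})"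
    using assms uv unfolding components_def by (auto simp: image_iff) 
  thus "components (V - {v}, (`) c ` S) = (\<lambda>T. T - {v}) ` ?K"
    using eq unfolding components_def by (simp add: image_image)
  show uvT: "u \<in> T \<longleftrightarrow> v \<in> T" if "T \<in> ?K" for T
    using that assms uvR by (elim componentsE) (auto intro: reachable_trans reachable_sym)
  show "inj_on (\<lambda>T. T - {v}) ?K"
  proof (rule inj_onI)
    fix A B assume AB: "A \<in> ?K" "B \<in> ?K" "A - {v} = B - {v}"
    have "u \<in> A \<longleftrightarrow> u \<in> B" using AB(3) uv by auto
    hence "v \<in> A \<longleftrightarrow> v \<in> B" using uvT AB by simp
    thus "A = B" using AB(3) by blast
  qed
qed

text \<open>
  The edge sets without \<open>{u, v}\<close> give the expansion after the deletion. For a set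
  \<open>insert {u, v} S\<close>, the components and their total weights depend on the image of \<open>S\<close> under the
  contraction only, so that the alternating sum over the sets \<open>S\<close> becomes one over their images.
\<close>

lemma chromatic_expansion_deletion_contraction:
  assumes "simple_graph G" "{u, v} \<in> edges G"
  shows "chromatic_expansion G w = chromatic_expansion (delete_edge {u, v} G) w
    + chromatic_expansion (contract_edge u v G) (w(u := w u + w v))"
proof -
  obtain V E where G: "G = (V, E)" by (cases G)
  define D where "D = E - {{u, v}}"
  let ?w' = "w(u := w u + w v)"
  have V: "finite V" "E \<subseteq> complete_edges V" "u \<in> V" "v \<in> V"
    using assms by (auto simp: G simple_graph_iff complete_edges_def)
  have finE: "finite E" using V by (meson finite_complete_edges finite_subset)
  have ED: "E = insert {u, v} D" "{u, v} \<notin> D" "finite D" "D \<subseteq> complete_edges V"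
    using assms(2) finE V by (auto simp: D_def G)
  define p where "p = (\<lambda>V F w. \<Prod>T\<in>components (V :: 'a set, F). mser_var (\<Sum>x\<in>T. w x) :: complex mser)"
  define sgn where "sgn = (\<lambda>k :: nat. (- 1 :: complex mser) ^ k)"
  have const: "mser_const ((- 1) ^ k) = sgn k" for k
    by (cases "even k") (auto simp: sgn_def mser_eq_iff mser_const.rep_eq one_mser.rep_eq uminus_mser.rep_eq)
  have sgn_null: "sgn (nullity (V', F)) = sgn (card F) * sgn (card (components (V', F)) + card V')"
    if "finite V'" "F \<subseteq> complete_edges V'" for V' F
  proof -
    have "even (nullity (V', F)) \<longleftrightarrow> even (card F + (card (components (V', F)) + card V'))"
      using card_verts_le[OF that] by (auto simp: nullity_def)
    thus ?thesis unfolding sgn_def power_add[symmetric] by (simp add: minus_one_power_iff)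
  qed
  have expand: "chromatic_expansion (V', F) w
      = (\<Sum>S\<in>Pow F. sgn (card S) * (sgn (card (components (V', S)) + card V') * p V' S w))"
    if "finite V'" "F \<subseteq> complete_edges V'" for V' F w
    unfolding chromatic_expansion_def fst_conv snd_conv const
    by (rule sum.cong[OF refl]) (use sgn_null[OF that(1)] that(2) in \<open>auto simp: p_def mult.assoc\<close>)
  have split: "(\<Sum>S\<in>Pow E. f S) = (\<Sum>S\<in>Pow D. f S) + (\<Sum>S\<in>Pow D. f (insert {u, v} S))"
    for f :: "'a set set \<Rightarrow> complex mser"
  proof -
    have "(\<Sum>S\<in>Pow E. f S) = (\<Sum>S\<in>Pow D. f S) + (\<Sum>S\<in>insert {u, v} ` Pow D. f S)"
      unfolding ED(1) Pow_insert using ED(2,3) by (intro sum.union_disjoint) auto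
    also have "(\<Sum>S\<in>insert {u, v} ` Pow D. f S) = (\<Sum>S\<in>Pow D. f (insert {u, v} S))"
    proof (subst sum.reindex)
      show "inj_on (insert {u, v}) (Pow D)" using ED(2) by (intro inj_onI) (metis PowD insert_ident subsetD)
    qed simp
    finally show ?thesis .
  qed
  let ?V' = "V - {v}"
  define g where "g = (\<lambda>T. sgn (card (components (?V', T)) + card ?V') * p ?V' T ?w')"
  have summand: "sgn (card (insert {u, v} S)) * (sgn (card (components (V, insert {u, v} S)) + card V) * p V (insert {u, v} S) w)
      = sgn (card S) * g ((`) c ` S)" if S: "S \<in> Pow D" for S
  proof -
    have S': "S \<subseteq> complete_edges V" "{u, v} \<notin> S" "finite S" using S ED by (auto intro: finite_subset)
    note comp = components_contract[OF S'(1) V(3,4)]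
    have "card (components (?V', (`) c ` S)) = card (components (V, insert {u, v} S))"
      unfolding comp(1) by (rule card_image[OF comp(2)])
    moreover have "card V = Suc (card ?V')" using V by (metis card_Suc_Diff1)
    moreover have "p ?V' ((`) c ` S) ?w' = p V (insert {u, v} S) w"
    proof -
      have "(\<Sum>x\<in>T - {v}. ?w' x) = (\<Sum>x\<in>T. w x)" if T: "T \<in> components (V, insert {u, v} S)" for T
      proof (cases "v \<in> T")
        case True
        hence "u \<in> T" using comp(3)[OF T] by simp
        have fin: "finite T" using component_subset[OF T] V(1) by (rule finite_subset)
        have "(\<Sum>x\<in>T - {v}. ?w' x) = ?w' u + (\<Sum>x\<in>T - {v} - {u}. ?w' x)"
          using fin \<open>u \<in> T\<close> uv by (intro sum.remove) auto
        also have "(\<Sum>x\<in>T - {v} - {u}. ?w' x) = (\<Sum>x\<in>T - {v} - {u}. w x)" by (intro sum.cong) auto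
        also have "?w' u + \<dots> = w v + (w u + (\<Sum>x\<in>T - {v} - {u}. w x))" by simp
        also have "w u + (\<Sum>x\<in>T - {v} - {u}. w x) = (\<Sum>x\<in>T - {v}. w x)"
          using fin \<open>u \<in> T\<close> uv by (intro sum.remove[symmetric]) auto
        also have "w v + \<dots> = (\<Sum>x\<in>T. w x)" using fin True by (intro sum.remove[symmetric]) auto
        finally show ?thesis .
      next
        case False
        hence "u \<notin> T" using comp(3)[OF T] by simp
        thus ?thesis using False by (intro sum.cong) auto
      qed
      thus ?thesis unfolding p_def comp(1) by (subst prod.reindex[OF comp(2)]) simp
    qed
    ultimately show ?thesis using S' by (simp add: g_def sgn_def)
  qed
  have contract: "contract_edge u v G = (?V', (`) c ` D)"
    by (simp add: contract_edge_def G D_def c_def)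
  have cD: "(`) c ` D \<subseteq> complete_edges ?V'"
    using ED V by (intro contract_image_complete_edges) auto
  have "chromatic_expansion G w = (\<Sum>S\<in>Pow D. sgn (card S) * (sgn (card (components (V, S)) + card V) * p V S w))
      + (\<Sum>S\<in>Pow D. sgn (card S) * g ((`) c ` S))"
    unfolding G expand[OF V(1,2)] split by (simp add: summand)
  also have "(\<Sum>S\<in>Pow D. sgn (card S) * (sgn (card (components (V, S)) + card V) * p V S w))
      = chromatic_expansion (delete_edge {u, v} G) w"
    using expand[OF V(1) ED(4)] by (simp add: delete_edge_def G D_def)
  also have "(\<Sum>S\<in>Pow D. sgn (card S) * g ((`) c ` S)) = (\<Sum>T\<in>Pow ((`) c ` D). sgn (card T) * g T)"
    unfolding sgn_def by (rule alternating_sum_image) fact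
  also have "\<dots> = chromatic_expansion (contract_edge u v G) ?w'"
    unfolding contract using expand[OF _ cD] V(1) by (simp add: g_def)
  finally show ?thesis .
qed

lemma simple_graph_contract_edge:
  assumes "simple_graph G" "{u, v} \<in> edges G"
  shows "simple_graph (contract_edge u v G)" "card (edges (contract_edge u v G)) < card (edges G)"
proof -
  obtain V E where G: "G = (V, E)" by (cases G)
  have V: "finite V" "E \<subseteq> complete_edges V" "u \<in> V"
    using assms by (auto simp: G simple_graph_iff complete_edges_def)
  have finE: "finite E" using V by (meson finite_complete_edges finite_subset)
  have eq: "contract_edge u v G = (V - {v}, (`) c ` (E - {{u, v}}))"
    by (simp add: contract_edge_def G c_def)
  show "simple_graph (contract_edge u v G)"
    unfolding eq simple_graph_iff using V contract_image_complete_edges[of "E - {{u, v}}" V] by auto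
  have "card ((`) c ` (E - {{u, v}})) \<le> card (E - {{u, v}})" using finE by (intro card_image_le) simp
  also have "\<dots> < card E" using finE assms(2) by (intro psubset_card_mono) (auto simp: G)
  finally show "card (edges (contract_edge u v G)) < card (edges G)" unfolding eq by (simp add: G)
qed

end

lemma deletion_contraction_unique:
  assumes "deletion_contraction G w P" "simple_graph G"
  shows "P = chromatic_expansion G w"
  using assms
proof (induction rule: deletion_contraction.induct)
  case (no_edges G w)
  obtain V where G: "G = (V, {})" using no_edges by (cases G) auto
  have "nullity (V, {}) = 0"
    by (simp add: nullity_def components_no_edges card_image)
  thus ?case by (simp add: G chromatic_expansion_def components_no_edges prod.reindex)
next
  case (edge u v G w P Q)
  have "simple_graph (delete_edge {u, v} G)"
    using edge.prems by (auto simp: simple_graph_def delete_edge_def)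
  moreover have "simple_graph (contract_edge u v G)"
    using edge by (intro simple_graph_contract_edge)
  ultimately have "P = chromatic_expansion (delete_edge {u, v} G) w"
    "Q = chromatic_expansion (contract_edge u v G) (w(u := w u + w v))" using edge.IH by blast+
  thus ?case
    by (simp only: chromatic_expansion_deletion_contraction[OF edge.hyps(2) edge.prems edge.hyps(1)])
qed

lemma deletion_contraction_exists:
  assumes "simple_graph G"
  shows "\<exists>P. deletion_contraction G w P"
  using assms
proof (induction "card (edges G)" arbitrary: G w rule: less_induct)
  case less
  have fin: "finite (edges G)"
    using less.prems finite_subset[OF _ finite_complete_edges] simple_graph_iff[of "verts G" "edges G"] by auto
  show ?case
  proof (cases "edges G = {}")
    case True
    thus ?thesis using deletion_contraction.no_edges by blast
  next
    case False
    then obtain e where e: "e \<in> edges G" by auto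
    then obtain u v where uv: "e = {u, v}" "u \<noteq> v"
      using less.prems by (auto simp: simple_graph_def card_2_iff)
    have "simple_graph (delete_edge e G)"
      using less.prems by (auto simp: simple_graph_def delete_edge_def)
    moreover have "card (edges (delete_edge e G)) < card (edges G)"
      using card_Diff1_less[OF fin e] by (simp add: delete_edge_def)
    ultimately
    obtain P where "deletion_contraction (delete_edge e G) w P" using less.hyps by blast
    moreover obtain Q where "deletion_contraction (contract_edge u v G) (w(u := w u + w v)) Q"
      using less.hyps simple_graph_contract_edge[OF uv(2) less.prems] e uv by blast
    ultimately show ?thesis using deletion_contraction.edge[of u v G w P Q] e uv by blast
  qed
qed

lemma weighted_chromatic_poly_eq_expansion:
  assumes "simple_graph G"
  shows "weighted_chromatic_poly G w = chromatic_expansion G w"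
  unfolding weighted_chromatic_poly_def
proof (rule the_equality)
  obtain P where "deletion_contraction G w P" using deletion_contraction_exists assms by blast
  thus "deletion_contraction G w (chromatic_expansion G w)"
    using deletion_contraction_unique assms by blast
qed (use deletion_contraction_unique assms in blast)


section \<open>Graph polynomials defined by the nullity\<close>

text \<open>
  The family of weights that contains both polynomials. Since \<open>0 ^ 0 = 1\<close>, the value \<open>y = 0\<close>
  selects the forests.
\<close>

definition subgraph_weight :: "complex \<Rightarrow> (nat \<Rightarrow> complex) \<Rightarrow> 'a graph \<Rightarrow> complex mser" where
  "subgraph_weight y r G = mser_const (y ^ nullity G) *
     (\<Prod>T\<in>components G. mser_const (r (card T)) * mser_var (card T))"

text \<open>The sum of these weights over the spanning subgraphs.\<close>

definition nullity_poly :: "complex \<Rightarrow> (nat \<Rightarrow> complex) \<Rightarrow> 'a graph \<Rightarrow> complex mser" where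
  "nullity_poly y r G = (\<Sum>F\<in>Pow (edges G). subgraph_weight y r (verts G, F))"

lemma abel_poly_eq_nullity_poly:
  assumes "simple_graph G"
  shows "abel_poly G = nullity_poly 0 of_nat G"
proof -
  obtain V E where G: "G = (V, E)" by (cases G)
  have E: "finite V" "E \<subseteq> complete_edges V" using assms by (simp_all add: G simple_graph_iff)
  have finE: "finite E" using E by (meson finite_complete_edges finite_subset)
  have w: "subgraph_weight 0 of_nat (V, F) = (if acyclic_graph (V, F)
      then \<Prod>T\<in>components (V, F). of_nat (card T) * mser_var (card T) else 0)" if "F \<subseteq> E" for F
  proof -
    have "nullity (V, F) = 0 \<longleftrightarrow> acyclic_graph (V, F)"
      using nullity_eq_0_iff[of V F] that E by (auto simp: simple_graph_iff)
    thus ?thesis by (cases "acyclic_graph (V, F)") (auto simp: subgraph_weight_def mser_const_of_nat zero_power)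
  qed
  have "nullity_poly 0 of_nat G = (\<Sum>F\<in>Pow E. if acyclic_graph (V, F)
      then \<Prod>T\<in>components (V, F). of_nat (card T) * mser_var (card T) else 0)"
    unfolding nullity_poly_def G using w by (intro sum.cong) auto
  also have "\<dots> = (\<Sum>F | F \<in> Pow E \<and> acyclic_graph (V, F).
      \<Prod>T\<in>components (V, F). of_nat (card T) * mser_var (card T))"
    using finE by (intro sum.inter_filter[symmetric]) simp
  finally show ?thesis by (simp add: abel_poly_def G)
qed

lemma weighted_chromatic_poly_eq_nullity_poly:
  assumes "simple_graph G"
  shows "weighted_chromatic_poly G (\<lambda>_. 1) = nullity_poly (- 1) (\<lambda>_. 1) G"
  unfolding weighted_chromatic_poly_eq_expansion[OF assms]
  by (simp add: chromatic_expansion_def nullity_poly_def subgraph_weight_def)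

lemma multiplicativeD:
  assumes "multiplicative \<phi>" "finite B" "finite C" "B \<inter> C = {}"
    "E1 \<subseteq> complete_edges B" "E2 \<subseteq> complete_edges C"
  shows "\<phi> (B \<union> C, E1 \<union> E2) = \<phi> (B, E1) * \<phi> (C, E2)"
  using assms unfolding multiplicative_def by blast

lemma multiplicative_subgraph_sum:
  assumes "multiplicative \<phi>"
  shows "multiplicative (\<lambda>G. \<Sum>F\<in>Pow (edges G). \<phi> (verts G, F))"
  unfolding multiplicative_def
proof (intro allI impI)
  fix B C :: "'a set" and E1 E2
  assume A: "finite B" "finite C" "B \<inter> C = {}" "E1 \<subseteq> complete_edges B" "E2 \<subseteq> complete_edges C"
  have disj: "E1 \<inter> E2 = {}" using A complete_edges_disjoint[of B C] by blast
  have "(\<Sum>F\<in>Pow (E1 \<union> E2). \<phi> (B \<union> C, F))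
      = (\<Sum>(F1, F2)\<in>Pow E1 \<times> Pow E2. \<phi> (B, F1) * \<phi> (C, F2))"
  proof (rule sum.reindex_bij_witness[where i = "\<lambda>(F1, F2). F1 \<union> F2" and j = "\<lambda>F. (F \<inter> E1, F \<inter> E2)"])
    fix F assume F: "F \<in> Pow (E1 \<union> E2)"
    have "\<phi> (B \<union> C, (F \<inter> E1) \<union> (F \<inter> E2)) = \<phi> (B, F \<inter> E1) * \<phi> (C, F \<inter> E2)"
      using A by (intro multiplicativeD[OF assms]) auto
    moreover have "(F \<inter> E1) \<union> (F \<inter> E2) = F" using F by auto
    ultimately show "(case (F \<inter> E1, F \<inter> E2) of (F1, F2) \<Rightarrow> \<phi> (B, F1) * \<phi> (C, F2)) = \<phi> (B \<union> C, F)"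
      by simp
  qed (use disj in auto)
  also have "\<dots> = (\<Sum>F\<in>Pow E1. \<phi> (B, F)) * (\<Sum>F\<in>Pow E2. \<phi> (C, F))"
    by (simp add: sum_product sum.cartesian_product)
  finally show "(\<Sum>F\<in>Pow (edges (B \<union> C, E1 \<union> E2)). \<phi> (verts (B \<union> C, E1 \<union> E2), F))
      = (\<Sum>F\<in>Pow (edges (B, E1)). \<phi> (verts (B, E1), F)) * (\<Sum>F\<in>Pow (edges (C, E2)). \<phi> (verts (C, E2), F))"
    by simp
qed

lemma card_edges_disjoint_union:
  assumes "finite B" "finite C" "B \<inter> C = {}" "E1 \<subseteq> complete_edges B" "E2 \<subseteq> complete_edges C"
  shows "card (E1 \<union> E2) = card E1 + card E2"
  using assms complete_edges_disjoint[of B C] finite_subset[OF _ finite_complete_edges]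
  by (intro card_Un_disjoint) blast+

lemma multiplicative_subgraph_weight: "multiplicative (subgraph_weight y r)"
  unfolding multiplicative_def
proof (intro allI impI)
  fix B C :: "'a set" and E1 E2
  assume A: "finite B" "finite C" "B \<inter> C = {}" "E1 \<subseteq> complete_edges B" "E2 \<subseteq> complete_edges C"
  note comp = components_disjoint_union[OF A(3-5)] components_Int_disjoint[OF A(3), of E1 E2]
  have "card (components (B \<union> C, E1 \<union> E2)) = card (components (B, E1)) + card (components (C, E2))"
    unfolding comp(1) using A comp(2) by (intro card_Un_disjoint) auto
  hence "nullity (B \<union> C, E1 \<union> E2) = nullity (B, E1) + nullity (C, E2)"
    using card_edges_disjoint_union[OF A] card_Un_disjoint[OF A(1-3)]
      card_verts_le[OF A(1,4)] card_verts_le[OF A(2,5)] by (simp add: nullity_def)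
  moreover have "(\<Prod>T\<in>components (B \<union> C, E1 \<union> E2). f T)
      = (\<Prod>T\<in>components (B, E1). f T) * (\<Prod>T\<in>components (C, E2). f T)" for f :: "'a set \<Rightarrow> complex mser"
    unfolding comp(1) using A comp(2) by (intro prod.union_disjoint) auto
  ultimately show "subgraph_weight y r (B \<union> C, E1 \<union> E2) = subgraph_weight y r (B, E1) * subgraph_weight y r (C, E2)"
    by (simp add: subgraph_weight_def power_add mser_const_mult mult_ac)
qed

lemma invariant_subgraph_sum:
  assumes "isomorphism_invariant \<phi>"
  shows "isomorphism_invariant (\<lambda>G. \<Sum>F\<in>Pow (edges G). \<phi> (verts G, F))"
  unfolding isomorphism_invariant_def
proof (intro allI impI)
  fix V :: "'a set" and E and f :: "'a \<Rightarrow> 'a"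
  assume A: "finite V" "E \<subseteq> complete_edges V" "inj_on f V"
  have "inj_on ((`) f) (complete_edges V)"
    using bij_betw_complete_edges[of f V "f ` V"] A(3) by (auto simp: bij_betw_def)
  hence inj: "inj_on ((`) f) E" using A(2) by (rule inj_on_subset)
  have "(\<Sum>F\<in>Pow ((`) f ` E). \<phi> (f ` V, F)) = (\<Sum>F\<in>Pow E. \<phi> (f ` V, (`) f ` F))"
    using sum.reindex_bij_betw[OF bij_betw_Pow[OF inj_on_imp_bij_betw[OF inj]], of "\<lambda>F. \<phi> (f ` V, F)"] by simp
  also have "\<dots> = (\<Sum>F\<in>Pow E. \<phi> (V, F))"
    using A assms by (intro sum.cong) (auto simp: isomorphism_invariant_def)
  finally show "(\<Sum>F\<in>Pow (edges (f ` V, (`) f ` E)). \<phi> (verts (f ` V, (`) f ` E), F))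
      = (\<Sum>F\<in>Pow (edges (V, E)). \<phi> (verts (V, E), F))" by simp
qed

lemma card_edges_map: "inj_on f V \<Longrightarrow> E \<subseteq> complete_edges V \<Longrightarrow> card ((`) f ` E) = card E"
  using bij_betw_complete_edges[of f V "f ` V"]
  by (intro card_image) (auto simp: bij_betw_def intro: inj_on_subset)

lemma invariant_subgraph_weight: "isomorphism_invariant (subgraph_weight y r)"
  unfolding isomorphism_invariant_def
proof (intro allI impI)
  fix V :: "'a set" and E and f :: "'a \<Rightarrow> 'a"
  assume A: "finite V" "E \<subseteq> complete_edges V" "inj_on f V"
  note comp = components_map[OF A(3,2)]
  have inj: "inj_on ((`) f) (components (V, E))"
    by (rule inj_on_subset[OF inj_on_image_Pow[OF A(3)]]) (auto dest: component_subset)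
  have "nullity (f ` V, (`) f ` E) = nullity (V, E)"
    using card_edges_map[OF A(3,2)] card_image[OF A(3)] card_image[OF inj] comp
    by (simp add: nullity_def)
  moreover have "card (f ` T) = card T" if "T \<in> components (V, E)" for T
    using component_subset[OF that] A(3) by (intro card_image) (rule inj_on_subset)
  ultimately show "subgraph_weight y r (f ` V, (`) f ` E) = subgraph_weight y r (V, E)"
    unfolding subgraph_weight_def comp by (simp add: prod.reindex[OF inj])
qed

lemma homogeneous_subgraph_weight:
  assumes "finite V"
  shows "mser_homogeneous (card V) (subgraph_weight y r (V, F))"
proof -
  have "mser_homogeneous (\<Sum>T\<in>components (V, F). card T)
      (\<Prod>T\<in>components (V, F). mser_const (r (card T)) * mser_var (card T))"
    using assms component_card_pos[OF assms]
    by (intro mser_homogeneous_prod mser_homogeneous_const_mult mser_homogeneous_var) auto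
  thus ?thesis
    unfolding subgraph_weight_def sum_card_components[OF assms] by (rule mser_homogeneous_const_mult)
qed

lemma nullity_poly_eq: "nullity_poly y r = (\<lambda>G. \<Sum>F\<in>Pow (edges G). subgraph_weight y r (verts G, F))"
  by (simp add: nullity_poly_def fun_eq_iff)

lemma homogeneous_graph_sum:
  assumes "\<And>E. E \<subseteq> complete_edges {..<n} \<Longrightarrow> mser_homogeneous n (\<phi> ({..<n}, E))"
  shows "mser_homogeneous n (graph_sum P \<phi> n)"
  unfolding graph_sum_def by (rule mser_homogeneous_sum) (use assms in auto)

lemma homogeneous_nullity_poly:
  assumes "finite V"
  shows "mser_homogeneous (card V) (nullity_poly y r (V, E))"
  unfolding nullity_poly_eq by (auto intro!: mser_homogeneous_sum homogeneous_subgraph_weight assms)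


section \<open>The exponential formula\<close>

lemma exp_formula:
  fixes f g :: "nat \<Rightarrow> complex mser"
  assumes hom: "\<And>n. mser_homogeneous n (f n)" "\<And>n. mser_homogeneous n (g n)"
    and "f 0 = 1" "g 0 = 0"
    and rec: "\<And>n. n > 0 \<Longrightarrow> f n = (\<Sum>k=1..n. of_nat ((n - 1) choose (k - 1)) * g k * f (n - k))"
  shows "mser_graded (\<lambda>n. mser_const (1 / fact n) * f n) = mser_exp (mser_graded (\<lambda>n. mser_const (1 / fact n) * g n))"
proof (rule mser_graded_exp)
  fix n :: nat assume n: "n > 0"
  have "of_nat n * (mser_const (1 / fact n) * (of_nat ((n - 1) choose (k - 1)) * g k * f (n - k)))
      = of_nat k * (mser_const (1 / fact k) * g k) * (mser_const (1 / fact (n - k)) * f (n - k))"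
    if k: "k \<in> {1..n}" for k
  proof -
    have c: "of_nat n * (1 / fact n) * of_nat ((n - 1) choose (k - 1))
        = (of_nat k * (1 / fact k) * (1 / fact (n - k)) :: complex)"
    proof -
      have "n - 1 - (k - 1) = n - k" using k by auto
      hence "of_nat ((n - 1) choose (k - 1)) = (fact (n - 1) / (fact (k - 1) * fact (n - k)) :: complex)"
        using binomial_fact[of "k - 1" "n - 1", where 'a = complex] k by auto
      moreover have "fact n = (of_nat n * fact (n - 1) :: complex)" using n by (rule fact_reduce)
      moreover have "fact k = (of_nat k * fact (k - 1) :: complex)" using k by (intro fact_reduce) simp
      ultimately show ?thesis using n k by (simp add: field_simps)
    qed
    have "of_nat n * (mser_const (1 / fact n) * (of_nat ((n - 1) choose (k - 1)) * g k * f (n - k)))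
        = mser_const (of_nat n * (1 / fact n) * of_nat ((n - 1) choose (k - 1))) * (g k * f (n - k))"
      by (simp only: mser_const_mult mser_const_of_nat mult_ac)
    also have "\<dots> = of_nat k * (mser_const (1 / fact k) * g k) * (mser_const (1 / fact (n - k)) * f (n - k))"
      unfolding c by (simp only: mser_const_mult mser_const_of_nat mult_ac)
    finally show ?thesis .
  qed
  thus "of_nat n * (mser_const (1 / fact n) * f n)
      = (\<Sum>k=1..n. of_nat k * (mser_const (1 / fact k) * g k) * (mser_const (1 / fact (n - k)) * f (n - k)))"
    unfolding rec[OF n] by (simp add: sum_distrib_left)
qed (use assms in \<open>auto intro: mser_homogeneous_const_mult\<close>)

lemma graph_sum_True_0: "graph_sum (\<lambda>_. True) \<phi> 0 = \<phi> ({}, {})"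
proof -
  have "complete_edges {} = ({} :: nat set set)" by (auto simp: complete_edges_def)
  thus ?thesis by (simp add: graph_sum_def)
qed

lemma graph_sum_connected_0: "graph_sum connected_graph \<phi> 0 = 0"
  by (simp add: graph_sum_def connected_graph_def)

lemma components_empty: "components ({}, E) = {}"
  by (simp add: components_def)

lemma subgraph_weight_empty: "subgraph_weight y r ({}, {}) = 1"
  by (simp add: subgraph_weight_def nullity_def components_empty)

lemma nullity_poly_empty: "nullity_poly y r ({}, {}) = 1"
  by (simp add: nullity_poly_def subgraph_weight_empty)

text \<open>
  The equation with \<open>nullity_poly\<close> is required for simple graphs only: \<open>abel_poly\<close> and
  \<open>weighted_chromatic_poly\<close> need not agree with it elsewhere.
\<close>

lemma class_sum_nullity_poly:
  assumes eq: "\<forall>G. simple_graph G \<longrightarrow> \<Phi> G = nullity_poly y r G" and P: "isomorphism_invariant P"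
  shows "class_sum P \<Phi> = mser_graded (\<lambda>n. mser_const (1 / fact n) * graph_sum P (nullity_poly y r) n)"
proof -
  have inv: "isomorphism_invariant (nullity_poly y r :: nat graph \<Rightarrow> _)"
    unfolding nullity_poly_eq by (intro invariant_subgraph_sum invariant_subgraph_weight)
  have "isomorphism_invariant \<Phi>"
    unfolding isomorphism_invariant_def
  proof (intro allI impI)
    fix V :: "nat set" and E and f :: "nat \<Rightarrow> nat"
    assume A: "finite V" "E \<subseteq> complete_edges V" "inj_on f V"
    hence "simple_graph (V, E)" "simple_graph (f ` V, (`) f ` E)"
      using complete_edges_map[OF A(3,2)] by (simp_all add: simple_graph_iff)
    thus "\<Phi> (f ` V, (`) f ` E) = \<Phi> (V, E)"
      using eq inv A unfolding isomorphism_invariant_def by simp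
  qed
  hence "class_sum P \<Phi> = mser_graded (\<lambda>n. mser_const (1 / fact n) * graph_sum P \<Phi> n)"
    using P by (rule class_sum_eq_graded) (use eq homogeneous_nullity_poly in \<open>auto simp: simple_graph_iff\<close>)
  moreover have "graph_sum P \<Phi> n = graph_sum P (nullity_poly y r) n" for n
    unfolding graph_sum_def by (rule sum.cong) (use eq in \<open>auto simp: simple_graph_iff\<close>)
  ultimately show ?thesis by simp
qed

lemma class_sum_connected_constant_term:
  assumes "\<forall>G. simple_graph G \<longrightarrow> \<Phi> G = nullity_poly y r G"
  shows "mser_nth (class_sum connected_graph \<Phi>) {#} = 0"
  unfolding class_sum_nullity_poly[OF assms invariant_connected]
  by (simp add: mser_graded.rep_eq graph_sum_connected_0 zero_mser.rep_eq)

lemma class_sum_exp: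
  assumes "\<forall>G. simple_graph G \<longrightarrow> \<Phi> G = nullity_poly y r G"
  shows "class_sum (\<lambda>_. True) \<Phi> = mser_exp (class_sum connected_graph \<Phi>)"
  unfolding class_sum_nullity_poly[OF assms invariant_connected] class_sum_nullity_poly[OF assms invariant_True]
proof (rule exp_formula)
  have hom: "mser_homogeneous n (graph_sum P (nullity_poly y r) n)" for n P
    by (rule homogeneous_graph_sum) (use homogeneous_nullity_poly[of "{..<n}" y r] in simp)
  show "mser_homogeneous n (graph_sum (\<lambda>_. True) (nullity_poly y r) n)"
    "mser_homogeneous n (graph_sum connected_graph (nullity_poly y r) n)" for n
    by (rule hom)+
  fix n :: nat assume "n > 0"
  thus "graph_sum (\<lambda>_. True) (nullity_poly y r) n = (\<Sum>k=1..n. of_nat ((n - 1) choose (k - 1))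
      * graph_sum connected_graph (nullity_poly y r) k * graph_sum (\<lambda>_. True) (nullity_poly y r) (n - k))"
    unfolding nullity_poly_eq
    by (intro graph_sum_recurrence multiplicative_subgraph_sum multiplicative_subgraph_weight
        invariant_subgraph_sum invariant_subgraph_weight)
qed (simp_all add: graph_sum_True_0 graph_sum_connected_0 nullity_poly_empty)


section \<open>A tau function made of one-part Schur polynomials\<close>

text \<open>
  The common value of both generating functions after the substitutions: the series
  \<open>\<Sum>\<^sub>n 2 ^ (n choose 2) * s\<^sub>n\<close>.
\<close>

definition one_part_tau :: "complex mser" where
  "one_part_tau = mser_graded (\<lambda>n. mser_const (2 ^ (n choose 2)) * schur_one (int n))"

text \<open>
  The recurrence is \<open>n * s\<^sub>n = p\<^sub>1 * s\<^bsub>n-1\<^esub> + \<dots> + p\<^sub>n * s\<^sub>0\<close>, written for \<open>h\<^sub>n = n! * s\<^sub>n\<close>.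
\<close>

lemma schur_one_eqI:
  fixes h :: "nat \<Rightarrow> complex mser"
  assumes hom: "\<And>n. mser_homogeneous n (h n)" and "h 0 = 1"
    and rec: "\<And>n. n > 0 \<Longrightarrow> h n = (\<Sum>k=1..n. of_nat ((n - 1) choose (k - 1))
      * (mser_const (fact (k - 1)) * mser_var k) * h (n - k))"
  shows "schur_one (int n) = mser_const (1 / fact n) * h n"
proof -
  define g where "g = (\<lambda>k. if k = 0 then 0 else mser_const (fact (k - 1)) * mser_var k :: complex mser)"
  have "mser_graded (\<lambda>n. mser_const (1 / fact n) * h n) = mser_exp (mser_graded (\<lambda>n. mser_const (1 / fact n) * g n))"
  proof (rule exp_formula)
    show "mser_homogeneous n (g n)" for n
      by (simp add: g_def mser_homogeneous_const_mult)
    fix n :: nat assume "n > 0"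
    thus "h n = (\<Sum>k=1..n. of_nat ((n - 1) choose (k - 1)) * g k * h (n - k))"
      unfolding rec[OF \<open>n > 0\<close>] by (intro sum.cong) (auto simp: g_def)
  qed (use assms in \<open>simp_all add: g_def\<close>)
  also have "mser_graded (\<lambda>n. mser_const (1 / fact n) * g n)
      = mser_Sum {1..} (\<lambda>k. mser_const (1 / of_nat k) * mser_var k)"
    unfolding mser_eq_iff
  proof
    fix m :: "nat multiset"
    define n where "n = sum_mset m"
    have gn: "mser_const (1 / fact k) * g k = mser_const (1 / of_nat k) * mser_var k" if "k > 0" for k
    proof -
      have "1 / fact k * fact (k - 1) = (1 / of_nat k :: complex)"
        using that by (simp add: fact_reduce[of k])
      thus ?thesis using that by (simp add: g_def mult.assoc[symmetric] mser_const_mult[symmetric])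
    qed
    have "mser_nth (mser_Sum {1..} (\<lambda>k. mser_const (1 / of_nat k) * mser_var k)) m
        = (\<Sum>k\<in>{n} - {0}. mser_nth (mser_const (1 / of_nat k) * mser_var k :: complex mser) m)"
      by (rule mser_nth_Sum_finite) (auto simp: mser_var.rep_eq n_def Suc_le_eq)
    also have "\<dots> = mser_nth (mser_const (1 / fact n) * g n) m"
      using gn[of n] by (cases "n = 0") (auto simp: g_def zero_mser.rep_eq)
    finally show "mser_nth (mser_graded (\<lambda>n. mser_const (1 / fact n) * g n)) m
        = mser_nth (mser_Sum {1..} (\<lambda>k. mser_const (1 / of_nat k) * mser_var k)) m"
      by (simp add: mser_graded.rep_eq n_def)
  qed
  finally have exp: "mser_exp (mser_Sum {1..} (\<lambda>k. mser_const (1 / of_nat k) * mser_var k))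
      = mser_graded (\<lambda>n. mser_const (1 / fact n) * h n)" ..
  show ?thesis
    unfolding schur_one_def exp mser_eq_iff mser_homogeneous_part.rep_eq mser_graded.rep_eq of_nat_eq_iff
    using hom[of n] by (auto simp: mser_homogeneous_def)
qed

lemma mser_nth_schur_one: "mser_nth (schur_one (int k)) m \<noteq> 0 \<Longrightarrow> sum_mset m = k"
  unfolding schur_one_def mser_homogeneous_part.rep_eq of_nat_eq_iff by (simp split: if_splits)

lemma schur_Nil: "schur [] = 1"
  by (simp add: schur_def)

lemma schur_single: "schur [n] = schur_one (int n)"
  unfolding schur_def by (subst det_single) auto

text \<open>
  \<open>\<beta>\<^sub>1 = \<Sum>\<^sub>n 2 ^ (n choose 2) * z ^ (n - 1)\<close>, and \<open>\<beta>\<^sub>i = z ^ (- i)\<close> for \<open>i \<noteq> 1\<close>. The first series can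
  have arbitrary coefficients here, so every combination of one-part Schur polynomials with constant
  term \<open>1\<close> is a tau function.
\<close>

definition one_part_basis :: "nat \<Rightarrow> complex fls" where
  "one_part_basis i = (if i = 1 then fls_shift 1 (fps_to_fls (Abs_fps (\<lambda>n. 2 ^ (n choose 2))))
     else fls_shift (int i) 1)"

lemma admissible_one_part_basis: "admissible_basis one_part_basis"
  by (auto simp: admissible_basis_def one_part_basis_def binomial_eq_0)

lemma wedge_coeff_one_part:
  assumes "\<mu> \<in> partitions"
  shows "wedge_coeff one_part_basis \<mu>
    = (if length \<mu> \<le> 1 then 2 ^ (sum_list \<mu> choose 2) else 0)"
proof (cases "length \<mu> \<le> 1")
  case True
  then consider "\<mu> = []" | n where "\<mu> = [n]" by (cases \<mu>) auto
  thus ?thesis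
  proof cases
    case 1
    thus ?thesis by (simp add: wedge_coeff_def binomial_eq_0)
  next
    case 2
    hence "n > 0" using assms by (simp add: partitions_def)
    have "wedge_coeff one_part_basis \<mu> = fls_nth (one_part_basis 1) (int n - 1)"
      unfolding wedge_coeff_def 2 by (subst det_single) auto
    also have "\<dots> = 2 ^ (n choose 2)" using \<open>n > 0\<close> by (simp add: one_part_basis_def)
    finally show ?thesis using 2 by simp
  qed
next
  case False
  define l where "l = length \<mu>"
  have l: "l \<ge> 2" using False by (simp add: l_def)
  let ?M = "mat l l (\<lambda>(i, j). fls_nth (one_part_basis (Suc i)) (int (\<mu> ! j) - int (Suc j)))"
  \<comment> \<open>The last row belongs to \<open>\<beta>\<^sub>l = z ^ (- l)\<close>, while all exponents \<open>\<mu>\<^sub>j - j\<close> with \<open>j \<le> l\<close> exceed \<open>- l\<close>.\<close>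
  have zero: "?M $$ (l - 1, j) = 0" if "j < l" for j
  proof -
    have "\<mu> ! j > 0" using assms that by (auto simp: partitions_def l_def)
    thus ?thesis using l that by (auto simp: one_part_basis_def)
  qed
  have "det ?M = (\<Sum>p | p permutes {0..<l}. signof p * (\<Prod>i=0..<l. ?M $$ (i, p i)))"
    by (rule det_def') simp
  also have "\<dots> = 0"
  proof (rule sum.neutral, safe)
    fix p assume p: "p permutes {0..<l}"
    have "l - 1 \<in> {0..<l}" using l by simp
    hence "p (l - 1) < l" using permutes_in_image[OF p, of "l - 1"] by simp
    hence "?M $$ (l - 1, p (l - 1)) = 0" by (rule zero)
    hence "(\<Prod>i=0..<l. ?M $$ (i, p i)) = 0"
      using \<open>l - 1 \<in> {0..<l}\<close> by (intro prod_zero) auto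
    thus "signof p * (\<Prod>i=0..<l. ?M $$ (i, p i)) = 0" by simp
  qed
  finally show ?thesis using False by (simp add: wedge_coeff_def l_def)
qed

lemma KP_one_part_tau:
  assumes schur0: "schur_one 0 = 1"
  shows "KP_tau_function one_part_tau"
  unfolding KP_tau_function_def
proof (intro exI conjI)
  show "admissible_basis one_part_basis" by (rule admissible_one_part_basis)
  show "one_part_tau = mser_Sum partitions (\<lambda>\<mu>. mser_const (wedge_coeff one_part_basis \<mu>) * schur \<mu>)"
    unfolding mser_eq_iff
  proof
    fix m :: "nat multiset"
    define n where "n = sum_mset m"
    define f where "f = (\<lambda>\<mu>. mser_nth (mser_const (wedge_coeff one_part_basis \<mu>) * schur \<mu>) m)"
    define \<mu>n where "\<mu>n = (if n = 0 then [] else [n])"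
    have part: "\<mu>n \<in> partitions" by (simp add: \<mu>n_def partitions_def)
    \<comment> \<open>Partitions with at least two parts have coefficient \<open>0\<close>; of the others, only \<open>\<mu>n\<close> has the degree of \<open>m\<close>.\<close>
    have vanish: "f \<mu> = 0" if "\<mu> \<in> partitions" "\<mu> \<noteq> \<mu>n" for \<mu>
    proof (cases "length \<mu> \<le> 1")
      case False
      thus ?thesis using that wedge_coeff_one_part[of \<mu>] by (simp add: f_def)
    next
      case True
      then consider "\<mu> = []" | k where "\<mu> = [k]" by (cases \<mu>) auto
      hence "mser_nth (schur \<mu>) m = 0"
      proof cases
        case 1
        hence "n \<noteq> 0" using that(2) by (auto simp: \<mu>n_def split: if_splits)
        hence "m \<noteq> {#}" by (auto simp: n_def)
        thus ?thesis using 1 by (simp add: schur_Nil one_mser.rep_eq)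
      next
        case 2
        hence "k > 0" using that(1) by (simp add: partitions_def)
        hence "k \<noteq> n" using 2 that(2) by (auto simp: \<mu>n_def)
        thus ?thesis using mser_nth_schur_one[of k m] 2 by (auto simp: schur_single n_def)
      qed
      thus ?thesis by (simp add: f_def)
    qed
    have "mser_nth (mser_Sum partitions (\<lambda>\<mu>. mser_const (wedge_coeff one_part_basis \<mu>) * schur \<mu>)) m
        = (\<Sum>\<mu>\<in>{\<mu>n}. f \<mu>)"
      unfolding f_def by (rule mser_nth_Sum_finite) (use part vanish in \<open>auto simp: f_def\<close>)
    also have "\<dots> = 2 ^ (n choose 2) * mser_nth (schur_one (int n)) m"
      using wedge_coeff_one_part[OF part]
      by (auto simp: f_def \<mu>n_def schur_Nil schur_single schur0)
    also have "\<dots> = mser_nth one_part_tau m"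
      by (simp only: one_part_tau_def mser_graded.rep_eq mser_nth_const_mult n_def)
    finally show "mser_nth one_part_tau m
        = mser_nth (mser_Sum partitions (\<lambda>\<mu>. mser_const (wedge_coeff one_part_basis \<mu>) * schur \<mu>)) m" ..
  qed
qed


section \<open>Evaluation of the generating functions\<close>

text \<open>
  The weight of a spanning subgraph, divided by \<open>2 ^ |F|\<close>: it accounts for the number of graphs that
  contain the edge set \<open>F\<close>, up to a power of \<open>2\<close> that depends on the number of vertices only.
\<close>

definition half_weight :: "complex \<Rightarrow> (nat \<Rightarrow> complex) \<Rightarrow> 'a graph \<Rightarrow> complex mser" where
  "half_weight y r G = mser_const ((1 / 2) ^ card (edges G)) * subgraph_weight y r G"

lemma multiplicative_half_weight: "multiplicative (half_weight y r)"
  unfolding multiplicative_def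
proof (intro allI impI)
  fix B C :: "'a set" and E1 E2
  assume A: "finite B" "finite C" "B \<inter> C = {}" "E1 \<subseteq> complete_edges B" "E2 \<subseteq> complete_edges C"
  show "half_weight y r (B \<union> C, E1 \<union> E2) = half_weight y r (B, E1) * half_weight y r (C, E2)"
    using card_edges_disjoint_union[OF A] multiplicativeD[OF multiplicative_subgraph_weight A, of y r]
    by (simp add: half_weight_def power_add mser_const_mult mult_ac)
qed

lemma invariant_half_weight: "isomorphism_invariant (half_weight y r)"
  unfolding isomorphism_invariant_def
proof (intro allI impI)
  fix V :: "'a set" and E and f :: "'a \<Rightarrow> 'a"
  assume A: "finite V" "E \<subseteq> complete_edges V" "inj_on f V"
  hence "subgraph_weight y r (f ` V, (`) f ` E) = subgraph_weight y r (V, E)"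
    using invariant_subgraph_weight unfolding isomorphism_invariant_def by blast
  thus "half_weight y r (f ` V, (`) f ` E) = half_weight y r (V, E)"
    using card_edges_map[OF A(3,2)] by (simp add: half_weight_def)
qed

text \<open>An edge set \<open>F\<close> is contained in \<open>2 ^ (n choose 2 - |F|)\<close> graphs with the vertices \<open>{..<n}\<close>.\<close>

lemma graph_sum_nullity_poly:
  "graph_sum (\<lambda>_. True) (nullity_poly y r) n
    = mser_const (2 ^ (n choose 2)) * graph_sum (\<lambda>_. True) (half_weight y r) n"
proof -
  let ?K = "complete_edges {..<n}"
  have finK: "finite ?K" and cardK: "card ?K = n choose 2" by (simp_all add: card_complete_edges)
  have supersets: "card {E. E \<in> Pow ?K \<and> F \<subseteq> E} = 2 ^ (card ?K - card F)" if F: "F \<subseteq> ?K" for F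
  proof -
    have "bij_betw (\<lambda>E. E - F) {E. E \<in> Pow ?K \<and> F \<subseteq> E} (Pow (?K - F))"
      by (rule bij_betw_byWitness[of _ "\<lambda>E. E \<union> F"]) (use F in auto)
    hence "card {E. E \<in> Pow ?K \<and> F \<subseteq> E} = card (Pow (?K - F))" by (rule bij_betw_same_card)
    also have "\<dots> = 2 ^ (card ?K - card F)"
      using F finK by (simp add: card_Pow card_Diff_subset finite_subset)
    finally show ?thesis .
  qed
  have "graph_sum (\<lambda>_. True) (nullity_poly y r) n
      = (\<Sum>E\<in>Pow ?K. \<Sum>F | F \<in> Pow ?K \<and> F \<subseteq> E. subgraph_weight y r ({..<n}, F))"
    unfolding graph_sum_def nullity_poly_def by (intro sum.cong) auto
  also have "\<dots> = (\<Sum>F\<in>Pow ?K. \<Sum>E | E \<in> Pow ?K \<and> F \<subseteq> E. subgraph_weight y r ({..<n}, F))"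
    using finK by (intro sum.swap_restrict) auto
  also have "\<dots> = (\<Sum>F\<in>Pow ?K. mser_const (2 ^ (n choose 2)) * half_weight y r ({..<n}, F))"
  proof (rule sum.cong[OF refl])
    fix F assume F: "F \<in> Pow ?K"
    have "card F \<le> card ?K" using F finK by (simp add: card_mono)
    hence "(2 :: complex) ^ (card ?K - card F) = 2 ^ card ?K / 2 ^ card F"
      by (intro power_diff) auto
    hence pow: "2 ^ (n choose 2) * (1 / 2) ^ card F = (of_nat (2 ^ (card ?K - card F)) :: complex)"
      by (simp add: cardK power_one_over)
    have "mser_const (2 ^ (n choose 2)) * half_weight y r ({..<n}, F)
        = mser_const (2 ^ (n choose 2) * (1 / 2) ^ card F) * subgraph_weight y r ({..<n}, F)"
      by (simp only: half_weight_def mult.assoc mser_const_mult snd_conv)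
    also have "\<dots> = of_nat (2 ^ (card ?K - card F)) * subgraph_weight y r ({..<n}, F)"
      unfolding pow mser_const_of_nat ..
    finally have "mser_const (2 ^ (n choose 2)) * half_weight y r ({..<n}, F)
        = of_nat (2 ^ (card ?K - card F)) * subgraph_weight y r ({..<n}, F)" .
    thus "(\<Sum>E | E \<in> Pow ?K \<and> F \<subseteq> E. subgraph_weight y r ({..<n}, F))
        = mser_const (2 ^ (n choose 2)) * half_weight y r ({..<n}, F)"
      using supersets[of F] F by simp
  qed
  finally show ?thesis by (simp add: graph_sum_def sum_distrib_left Pow_def)
qed

text \<open>
  The coefficient of \<open>q\<^sub>n\<close> in the sum of \<open>half_weight y r\<close> over the connected graphs on \<open>n\<close> vertices. It
  equals \<open>a\<^sub>n / 2 ^ (n choose 2)\<close> for the Abel polynomial and \<open>c\<^sub>n / 2 ^ (n choose 2)\<close> for the chromatic one.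
\<close>

definition connected_coeff :: "complex \<Rightarrow> (nat \<Rightarrow> complex) \<Rightarrow> nat \<Rightarrow> complex" where
  "connected_coeff y r n
    = r n * graph_sum connected_graph (\<lambda>G. (1 / 2) ^ card (edges G) * y ^ nullity G) n"

lemma graph_sum_connected_half_weight:
  "graph_sum connected_graph (half_weight y r) n = mser_const (connected_coeff y r n) * mser_var n"
proof -
  have "half_weight y r ({..<n}, E)
      = mser_const (r n * ((1 / 2) ^ card E * y ^ nullity ({..<n}, E))) * mser_var n"
    if "connected_graph ({..<n}, E)" for E
    using components_connected[OF that] by (simp add: half_weight_def subgraph_weight_def mser_const_mult mult_ac)
  hence "graph_sum connected_graph (half_weight y r) n
      = (\<Sum>E | E \<in> Pow (complete_edges {..<n}) \<and> connected_graph ({..<n}, E).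
          mser_const (r n * ((1 / 2) ^ card E * y ^ nullity ({..<n}, E))) * mser_var n)"
    unfolding graph_sum_def by (intro sum.cong) auto
  thus ?thesis
    by (simp add: connected_coeff_def graph_sum_def sum_distrib_left mser_const_sum sum_distrib_right)
qed

text \<open>
  The condition on \<open>s\<close> normalizes the connected part of degree \<open>k\<close> to \<open>(k - 1)! * p\<^sub>k\<close>, whatever the
  values of \<open>y\<close> and \<open>r\<close> are.
\<close>

lemma schur_one_eq_half_weight_sum:
  assumes s: "\<forall>n>0. s n * connected_coeff y r n = fact (n - 1)"
  shows "schur_one (int n)
    = mser_const (1 / fact n) * mser_rescale s (graph_sum (\<lambda>_. True) (half_weight y r) n)"
proof (rule schur_one_eqI)
  show "mser_homogeneous n (mser_rescale s (graph_sum (\<lambda>_. True) (half_weight y r) n))" for n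
    unfolding half_weight_def
    by (intro mser_homogeneous_rescale homogeneous_graph_sum mser_homogeneous_const_mult)
       (use homogeneous_subgraph_weight[of "{..<n}" y r] in simp)
  show "mser_rescale s (graph_sum (\<lambda>_. True) (half_weight y r) 0) = 1"
    by (simp add: graph_sum_True_0 half_weight_def subgraph_weight_empty)
next
  fix n :: nat assume n: "n > 0"
  have "mser_rescale s (graph_sum connected_graph (half_weight y r) k)
      = mser_const (fact (k - 1)) * mser_var k" if "k > 0" for k
  proof -
    have "connected_coeff y r k * s k = fact (k - 1)" using s that by (simp add: mult.commute)
    thus ?thesis
      unfolding graph_sum_connected_half_weight mser_rescale_mult mser_rescale_const mser_rescale_var
        mult.assoc[symmetric] mser_const_mult[symmetric] by simp
  qed
  thus "mser_rescale s (graph_sum (\<lambda>_. True) (half_weight y r) n)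
      = (\<Sum>k=1..n. of_nat ((n - 1) choose (k - 1)) * (mser_const (fact (k - 1)) * mser_var k)
          * mser_rescale s (graph_sum (\<lambda>_. True) (half_weight y r) (n - k)))"
    unfolding graph_sum_recurrence[OF multiplicative_half_weight invariant_half_weight n]
      mser_rescale_sum mser_rescale_mult mser_rescale_of_nat
    by (intro sum.cong) auto
qed

lemma rescale_class_sum_eq_tau:
  assumes "\<forall>G. simple_graph G \<longrightarrow> \<Phi> G = nullity_poly y r G"
    and s: "\<forall>n>0. s n * connected_coeff y r n = fact (n - 1)"
  shows "mser_rescale s (class_sum (\<lambda>_. True) \<Phi>) = one_part_tau"
proof -
  have "mser_rescale s (class_sum (\<lambda>_. True) \<Phi>)
      = mser_graded (\<lambda>n. mser_rescale s (mser_const (1 / fact n) * graph_sum (\<lambda>_. True) (nullity_poly y r) n))"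
    unfolding class_sum_nullity_poly[OF assms(1) invariant_True]
    by (simp add: mser_eq_iff mser_nth_rescale mser_graded.rep_eq)
  also have "\<dots> = one_part_tau"
    unfolding one_part_tau_def
  proof (rule mser_graded_eqI)
    fix n
    show "mser_rescale s (mser_const (1 / fact n) * graph_sum (\<lambda>_. True) (nullity_poly y r) n)
        = mser_const (2 ^ (n choose 2)) * schur_one (int n)"
      unfolding schur_one_eq_half_weight_sum[OF s] graph_sum_nullity_poly mser_rescale_mult mser_rescale_const
      by (simp only: mult_ac)
  qed
  finally show ?thesis .
qed


section \<open>The scaling coefficients\<close>

text \<open>
  For \<open>y = 0\<close> only the trees contribute to the connected part; all of them have \<open>n - 1\<close> edges.
\<close>

lemma abel_scale_connected_coeff:
  assumes "n > 0"
  shows "abel_scale n * connected_coeff 0 of_nat n = fact (n - 1)"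
proof -
  let ?trees = "{E. E \<subseteq> complete_edges {..<n} \<and> connected_graph ({..<n}, E) \<and> acyclic_graph ({..<n}, E)}"
  let ?conn = "{E. E \<in> Pow (complete_edges {..<n}) \<and> connected_graph ({..<n}, E)}"
  have term_eq: "(1 / 2) ^ card E * 0 ^ nullity ({..<n}, E)
      = (if acyclic_graph ({..<n}, E) then (1 / 2) ^ (n - 1) else 0 :: complex)" if "E \<in> ?conn" for E
  proof -
    have E: "E \<subseteq> complete_edges {..<n}" "components ({..<n}, E) = {{..<n}}"
      using that components_connected[of "{..<n}" E] by auto
    have "nullity ({..<n}, E) = 0 \<longleftrightarrow> acyclic_graph ({..<n}, E)"
      using nullity_eq_0_iff E(1) by (auto simp: simple_graph_iff)
    moreover have "card E = n - 1" if "acyclic_graph ({..<n}, E)"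
      using card_verts_le[OF _ E(1)] that by (simp add: E(2))
    ultimately show ?thesis by auto
  qed
  have "graph_sum connected_graph (\<lambda>G. (1 / 2) ^ card (edges G) * 0 ^ nullity G) n
      = (\<Sum>E\<in>?conn. if acyclic_graph ({..<n}, E) then (1 / 2) ^ (n - 1) else 0 :: complex)"
    unfolding graph_sum_def using term_eq by (intro sum.cong) auto
  also have "\<dots> = (\<Sum>E | E \<in> ?conn \<and> acyclic_graph ({..<n}, E). (1 / 2) ^ (n - 1))"
    by (rule sum.inter_filter[symmetric]) (rule finite_subset[of _ "Pow (complete_edges {..<n})"], auto)
  also have "{E. E \<in> ?conn \<and> acyclic_graph ({..<n}, E)} = ?trees" by auto
  finally have "connected_coeff 0 of_nat n = of_nat (n * card ?trees) * (1 / 2) ^ (n - 1)"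
    by (simp add: connected_coeff_def)
  also have "n * card ?trees = n ^ (n - 1)" using cayley[of "{..<n}"] assms by auto
  finally have c: "connected_coeff 0 of_nat n = of_nat n ^ (n - 1) / 2 ^ (n - 1)"
    by (simp add: power_one_over)
  have "n * (n - 1) div 2 = (n - 1) * (n - 2) div 2 + (n - 1)"
  proof -
    obtain m where m: "n = Suc m" using assms by (cases n) auto
    have "(Suc m) choose 2 = (m choose 2) + m" by (simp add: numeral_2_eq_2)
    thus ?thesis unfolding choose_two m by simp
  qed
  hence "(2 :: complex) ^ (n * (n - 1) div 2) = 2 ^ ((n - 1) * (n - 2) div 2) * 2 ^ (n - 1)"
    by (simp add: power_add)
  thus ?thesis using assms unfolding abel_scale_def abel_seq_def c by (simp add: field_simps)
qed

lemma graph_sum_power_card: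
  "graph_sum (\<lambda>_. True) (\<lambda>G. a ^ card (edges G)) n = (1 + a :: 'a :: comm_ring_1) ^ (n choose 2)"
proof -
  let ?K = "complete_edges {..<n}"
  have "(\<Prod>e\<in>?K. a + 1) = (\<Sum>F\<in>Pow ?K. (\<Prod>e\<in>F. a) * (\<Prod>e\<in>?K - F. 1))"
    by (rule prod_add) simp
  thus ?thesis by (simp add: graph_sum_def Pow_def card_complete_edges add.commute)
qed

text \<open>
  Up to normalization the numbers \<open>c\<^sub>n\<close> are the sums of \<open>(-1/2) ^ |F|\<close> over the connected graphs
  \<open>({..<n}, F)\<close>: their recurrence comes from splitting off the connected component of a vertex in the sum
  \<open>(1/2) ^ (n choose 2)\<close> of \<open>(-1/2) ^ |F|\<close> over all graphs.
\<close>

lemma chromatic_seq_eq: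
  "of_int (chromatic_seq n) = 2 ^ (n choose 2) * connected_coeff (- 1) (\<lambda>_. 1) n" if "n > 0"
  using that
proof (induction n rule: less_induct)
  case (less n)
  define \<phi> where "\<phi> = (\<lambda>G :: nat graph. (- 1 / 2 :: complex) ^ card (edges G))"
  define e where "e = graph_sum connected_graph \<phi>"
  define c where "c = (\<lambda>n. 2 ^ (n choose 2) * connected_coeff (- 1) (\<lambda>_. 1) n)"
  have mult: "multiplicative \<phi>"
    unfolding multiplicative_def \<phi>_def by (auto simp: card_edges_disjoint_union power_add)
  have inv: "isomorphism_invariant \<phi>"
    unfolding isomorphism_invariant_def \<phi>_def by (auto simp: card_edges_map)
  have e: "(- 1) ^ (k + 1) * c k = 2 ^ (k choose 2) * e k" if "k > 0" for k
  proof -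
    have "(1 / 2) ^ card E * (- 1) ^ nullity ({..<k}, E) = (- 1) ^ (k + 1) * (- 1 / 2 :: complex) ^ card E"
      if E: "E \<in> Pow (complete_edges {..<k})" "connected_graph ({..<k}, E)" for E
    proof -
      have "k \<le> card E + 1" "nullity ({..<k}, E) = card E + 1 - k"
        using card_verts_le[of "{..<k}" E] E components_connected[OF E(2)] by (simp_all add: nullity_def)
      hence "(- 1 :: complex) ^ nullity ({..<k}, E) = (- 1) ^ (k + 1) * (- 1) ^ card E"
        by (simp add: minus_one_power_iff)
      moreover have "(- 1 / 2 :: complex) ^ card E = (- 1) ^ card E * (1 / 2) ^ card E"
        by (simp flip: power_mult_distrib)
      ultimately show ?thesis by simp
    qed
    hence "connected_coeff (- 1) (\<lambda>_. 1) k = (- 1) ^ (k + 1) * e k"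
      unfolding connected_coeff_def e_def graph_sum_def \<phi>_def sum_distrib_left
      by (intro sum.cong) auto
    thus ?thesis by (simp add: c_def minus_one_power_iff)
  qed
  have split: "n choose 2 = (k choose 2) + (n - k choose 2) + k * (n - k)" if "k \<le> n" for k
  proof -
    obtain l where "n = k + l" using \<open>k \<le> n\<close> le_Suc_ex by blast
    moreover have "(k + l) choose 2 = (k choose 2) + (l choose 2) + k * l"
      by (induction l) (auto simp: numeral_2_eq_2)
    ultimately show ?thesis by simp
  qed
  have all: "graph_sum (\<lambda>_. True) \<phi> k = (1 / 2) ^ (k choose 2)" for k
    unfolding \<phi>_def graph_sum_power_card by simp
  have "1 = (2 :: complex) ^ (n choose 2) * graph_sum (\<lambda>_. True) \<phi> n"
    unfolding all by (simp flip: power_mult_distrib)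
  also have "\<dots> = (\<Sum>k=1..n. 2 ^ (n choose 2) * (of_nat ((n - 1) choose (k - 1)) * e k * (1 / 2) ^ (n - k choose 2)))"
    by (subst graph_sum_recurrence[OF mult inv less.prems]) (simp only: all e_def sum_distrib_left)
  also have "\<dots> = (\<Sum>k=1..n. 2 ^ (k * (n - k)) * of_nat ((n - 1) choose (k - 1)) * ((- 1) ^ (k + 1) * c k))"
  proof (rule sum.cong[OF refl])
    fix k assume k: "k \<in> {1..n}"
    have "(2 :: complex) ^ (n choose 2) * (1 / 2) ^ (n - k choose 2) = 2 ^ (k choose 2) * 2 ^ (k * (n - k))"
      using split[of k] k by (simp add: power_add power_one_over)
    thus "2 ^ (n choose 2) * (of_nat ((n - 1) choose (k - 1)) * e k * (1 / 2) ^ (n - k choose 2))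
        = 2 ^ (k * (n - k)) * of_nat ((n - 1) choose (k - 1)) * ((- 1) ^ (k + 1) * c k)"
      using e[of k] k by (simp add: algebra_simps)
  qed
  also have "{1..n} = insert n {1..n - 1}" using less.prems by auto
  also have "(\<Sum>k\<in>insert n {1..n - 1}. 2 ^ (k * (n - k)) * of_nat ((n - 1) choose (k - 1)) * ((- 1) ^ (k + 1) * c k))
      = (- 1) ^ (n + 1) * c n
        - (\<Sum>k=1..n-1. (- 1) ^ k * 2 ^ (k * (n - k)) * of_nat ((n - 1) choose (k - 1)) * c k)"
    using less.prems by (subst sum.insert) (auto simp: sum_negf[symmetric] mult_ac intro!: sum.cong)
  finally have rec: "(- 1) ^ (n + 1) * c n
      = 1 + (\<Sum>k=1..n-1. (- 1) ^ k * 2 ^ (k * (n - k)) * of_nat ((n - 1) choose (k - 1)) * c k)"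
    by (simp add: algebra_simps)
  have "c n = (- 1) ^ (n + 1) * ((- 1) ^ (n + 1) * c n)"
    by (simp add: minus_one_power_iff)
  also have "\<dots> = (- 1) ^ (n + 1) * (1 + (\<Sum>k=1..n-1. (- 1) ^ k * 2 ^ (k * (n - k)) * of_nat ((n - 1) choose (k - 1)) * c k))"
    unfolding rec ..
  also have "\<dots> = of_int (chromatic_seq n)"
    unfolding chromatic_seq.simps[of n] using less.IH by (auto simp: c_def intro!: sum.cong)
  finally show ?case by (simp add: c_def)
qed

text \<open>In particular \<open>c\<^sub>n\<close> is not zero, so that the second substitution does not divide by zero.\<close>

lemma odd_chromatic_seq: "odd (chromatic_seq n)" if "n > 0"
proof -
  have "even ((- 1) ^ k * 2 ^ (k * (n - k)) * int ((n - 1) choose (k - 1)) * chromatic_seq k)"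
    if "k \<in> {1..n-1}" for k
    using that by auto
  hence "even (\<Sum>k=1..n-1. (- 1) ^ k * 2 ^ (k * (n - k)) * int ((n - 1) choose (k - 1)) * chromatic_seq k)"
    by (intro dvd_sum)
  thus ?thesis by (subst chromatic_seq.simps) simp
qed

lemma chromatic_scale_connected_coeff:
  assumes "n > 0"
  shows "chromatic_scale n * connected_coeff (- 1) (\<lambda>_. 1) n = fact (n - 1)"
proof -
  have "chromatic_seq n \<noteq> 0" using odd_chromatic_seq[OF assms] by auto
  hence "of_int (chromatic_seq n) \<noteq> (0 :: complex)" by simp
  thus ?thesis
    using chromatic_seq_eq[OF assms] unfolding chromatic_scale_def choose_two[symmetric]
    by (simp add: field_simps)
qed


section \<open>Solutions of the KP hierarchy\<close>

lemma rescale_connected_sum_eq_ln_tau: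
  assumes "\<forall>G. simple_graph G \<longrightarrow> \<Phi> G = nullity_poly y r G"
    and "\<forall>n>0. s n * connected_coeff y r n = fact (n - 1)"
  shows "mser_rescale s (class_sum connected_graph \<Phi>) = mser_ln one_part_tau"
    and "mser_rescale s (mser_exp (class_sum connected_graph \<Phi>)) = one_part_tau"
proof -
  note const = class_sum_connected_constant_term[OF assms(1)]
  show tau: "mser_rescale s (mser_exp (class_sum connected_graph \<Phi>)) = one_part_tau"
    unfolding class_sum_exp[OF assms(1), symmetric] using assms by (rule rescale_class_sum_eq_tau)
  show "mser_rescale s (class_sum connected_graph \<Phi>) = mser_ln one_part_tau"
    unfolding tau[symmetric] mser_rescale_exp[OF const]
    by (rule mser_ln_exp[symmetric]) (simp add: mser_nth_rescale const)
qed

theorem theorem2p2: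
  shows "mser_exp abel_gf = class_sum (\<lambda>_. True) abel_poly
    \<and> KP_solution (mser_rescale abel_scale abel_gf)
    \<and> mser_rescale abel_scale abel_gf = mser_rescale chromatic_scale chromatic_gf
    \<and> KP_tau_function (mser_rescale abel_scale (mser_exp abel_gf))
    \<and> mser_rescale abel_scale (mser_exp abel_gf)
        = mser_rescale chromatic_scale (mser_exp chromatic_gf)"
proof -
  have abel: "\<forall>G :: nat graph. simple_graph G \<longrightarrow> abel_poly G = nullity_poly 0 of_nat G"
    by (simp add: abel_poly_eq_nullity_poly)
  have chromatic: "\<forall>G :: nat graph. simple_graph G \<longrightarrow>
      weighted_chromatic_poly G (\<lambda>_. 1) = nullity_poly (- 1) (\<lambda>_. 1) G"
    using weighted_chromatic_poly_eq_nullity_poly by blast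
  have sA: "\<forall>n>0. abel_scale n * connected_coeff 0 of_nat n = fact (n - 1)"
    using abel_scale_connected_coeff by blast
  have sW: "\<forall>n>0. chromatic_scale n * connected_coeff (- 1) (\<lambda>_. 1) n = fact (n - 1)"
    using chromatic_scale_connected_coeff by blast
  note A = rescale_connected_sum_eq_ln_tau[OF abel sA, folded abel_gf_def]
  note W = rescale_connected_sum_eq_ln_tau[OF chromatic sW, folded chromatic_gf_def]
  \<comment> \<open>\<open>s\<^sub>0\<close> is the contribution of the empty graph.\<close>
  have "schur_one (int 0) = 1"
    using schur_one_eq_half_weight_sum[OF sA, of 0]
    by (simp add: graph_sum_True_0 half_weight_def subgraph_weight_empty)
  hence "KP_tau_function one_part_tau" by (intro KP_one_part_tau) simp
  moreover have "mser_exp abel_gf = class_sum (\<lambda>_. True) abel_poly"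
    unfolding abel_gf_def by (rule class_sum_exp[OF abel, symmetric])
  ultimately show ?thesis using A W by (auto simp: KP_solution_def)
qed

end
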